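(* The forward operator $F:D(F)\subset H^2(\underline u,\overline u)\to L^2(0,T)$, $a\mapsto\triangle p$ (defined in the context), maps sequences in $D(F)$ that converge weakly in $H^2(\underline u,\overline u)$ to strongly convergent sequences in $L^2(0,T)$. In particular, $F$ is compact.
   Context: Fix $T>0$ and positive constants $a_0,a_1,a_2,a_3$. Consider the condition (A1) $a\in W^{3,\infty}_{loc}(\mathbb R)$ with $a(0)=0$, $a_0\le a'(\cdot)\le a_1$, $|a''(\cdot)|\le a_2$, $|a'''(\cdot)|\le a_3$. Fix data satisfying (A2) $u_0=0$ and $p_0=c$ with $c\in\mathbb R$; (A3) $g_0,g_1\in C^4([0,T])$, $g_0(0)=g_1(0)=0$, $g_0'(0)=g_1'(0)=0$. State system: for $a$ satisfying (A1), $(p,u)\in C^1([0,T];L^2(0,1)^2)\cap C([0,T];H^1(0,1)^2)$ denotes the unique classical solution of $\partial_t p+\partial_x u=0$, $\partial_t u+\partial_x p+a(u)=0$ on $(0,1)\times(0,T)$ with $u(0,t)=g_0(t)$, $u(1,t)=g_1(t)$, $p(\cdot,0)=p_0$, $u(\cdot,0)=u_0$. There are constants $\underline u<\overline u$, independent of $a$, such that $\underline u\le u(x,t)\le\overline u$ for all $x\in[0,1]$, $t\in[0,T]$ and every $a$ satisfying (A1); fix such constants. Parameters are restricted to $[\underline u,\overline u]$ (the solution only depends on this restriction), and $D(F)=\{a\in H^2(\underline u,\overline u): \text{(A1) holds}\}$, i.e. the set of restrictions to $[\underline u,\overline u]$ of functions satisfying (A1) with the fixed constants; $D(F)$ is a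 closed and convex subset of $H^2(\underline u,\overline u)$. The forward operator is $F(a)=\triangle p:=p(0,\cdot)-p(1,\cdot)$, where $(p,u)$ is the solution for the parameter $a$. Compact means that bounded subsets of $D(F)$ are mapped to relatively compact subsets of $L^2(0,T)$. *)

theory Defs
  imports "HOL-Analysis.Analysis"
begin

text \<open>
  Spaces of (classes of) functions on an open set \<open>S\<close> are represented by sets of functions
  \<open>real \<Rightarrow> real\<close>; only the values on \<open>S\<close> matter, and norms do not distinguish functions that agree
  almost everywhere on \<open>S\<close>.
\<close>

definition L2 :: "real set \<Rightarrow> (real \<Rightarrow> real) set" where
  "L2 S = {f \<in> borel_measurable (lebesgue_on S). integrable (lebesgue_on S) (\<lambda>x. (f x)\<^sup>2)}"

definition L2_norm :: "real set \<Rightarrow> (real \<Rightarrow> real) \<Rightarrow> real" where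
  "L2_norm S f = sqrt (LINT x|lebesgue_on S. (f x)\<^sup>2)"

definition Linf_loc :: "real set \<Rightarrow> (real \<Rightarrow> real) set" where
  "Linf_loc S = {f \<in> borel_measurable (lebesgue_on S).
     \<forall>K. compact K \<and> K \<subseteq> S \<longrightarrow> (\<exists>C. AE x in lebesgue_on K. \<bar>f x\<bar> \<le> C)}"

definition locally_integrable :: "real set \<Rightarrow> (real \<Rightarrow> real) \<Rightarrow> bool" where
  "locally_integrable S f \<longleftrightarrow> (\<forall>K. compact K \<and> K \<subseteq> S \<longrightarrow> integrable (lebesgue_on K) f)"

definition test_functions :: "real set \<Rightarrow> (real \<Rightarrow> real) set" where
  "test_functions S = {\<phi>. (\<forall>n x. (deriv ^^ n) \<phi> field_differentiable at x) \<and>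
     (\<exists>K. compact K \<and> K \<subseteq> S \<and> (\<forall>x. x \<notin> K \<longrightarrow> \<phi> x = 0))}"

definition is_weak_deriv :: "nat \<Rightarrow> real set \<Rightarrow> (real \<Rightarrow> real) \<Rightarrow> (real \<Rightarrow> real) \<Rightarrow> bool" where
  "is_weak_deriv k S f g \<longleftrightarrow> locally_integrable S f \<and> locally_integrable S g \<and>
     (\<forall>\<phi> \<in> test_functions S.
        (LINT x|lebesgue_on S. f x * (deriv ^^ k) \<phi> x) = (-1) ^ k * (LINT x|lebesgue_on S. g x * \<phi> x))"

text \<open>Weak derivatives are unique up to null sets, so any choice will do.\<close>

definition weak_deriv :: "nat \<Rightarrow> real set \<Rightarrow> (real \<Rightarrow> real) \<Rightarrow> real \<Rightarrow> real" where
  "weak_deriv k S f = (SOME g. is_weak_deriv k S f g)"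

text \<open>Functions whose weak derivatives up to order \<open>k\<close> exist and belong to \<open>X\<close>.\<close>

definition sobolev :: "nat \<Rightarrow> (real \<Rightarrow> real) set \<Rightarrow> real set \<Rightarrow> (real \<Rightarrow> real) set" where
  "sobolev k X S = {f. \<forall>i\<le>k. \<exists>g\<in>X. is_weak_deriv i S f g}"

abbreviation H :: "nat \<Rightarrow> real set \<Rightarrow> (real \<Rightarrow> real) set" where
  "H k S \<equiv> sobolev k (L2 S) S"

definition H_norm :: "nat \<Rightarrow> real set \<Rightarrow> (real \<Rightarrow> real) \<Rightarrow> real" where
  "H_norm k S f = sqrt (\<Sum>i\<le>k. (L2_norm S (weak_deriv i S f))\<^sup>2)"

definition H_dual :: "nat \<Rightarrow> real set \<Rightarrow> ((real \<Rightarrow> real) \<Rightarrow> real) set" where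
  "H_dual k S = {l.
     (\<forall>f \<in> H k S. \<forall>g \<in> H k S. l (\<lambda>x. f x + g x) = l f + l g) \<and>
     (\<forall>r. \<forall>f \<in> H k S. l (\<lambda>x. r * f x) = r * l f) \<and>
     (\<exists>C. \<forall>f \<in> H k S. \<bar>l f\<bar> \<le> C * H_norm k S f)}"

definition H_weakly_converges ::
  "nat \<Rightarrow> real set \<Rightarrow> (nat \<Rightarrow> real \<Rightarrow> real) \<Rightarrow> (real \<Rightarrow> real) \<Rightarrow> bool" where
  "H_weakly_converges k S f h \<longleftrightarrow> (\<forall>n. f n \<in> H k S) \<and> h \<in> H k S \<and>
     (\<forall>l \<in> H_dual k S. (\<lambda>n. l (f n)) \<longlonglongrightarrow> l h)"

definition H_bounded :: "nat \<Rightarrow> real set \<Rightarrow> (real \<Rightarrow> real) set \<Rightarrow> bool" where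
  "H_bounded k S B \<longleftrightarrow> B \<subseteq> H k S \<and> (\<exists>C. \<forall>f \<in> B. H_norm k S f \<le> C)"

text \<open>
  The Banach space of classes of square integrable functions, as a metric space; it carries the
  strong topology used for the range of the forward operator.
\<close>

definition L2_rel :: "real set \<Rightarrow> ((real \<Rightarrow> real) \<times> (real \<Rightarrow> real)) set" where
  "L2_rel S = {(f, g). f \<in> L2 S \<and> g \<in> L2 S \<and> (AE x in lebesgue_on S. f x = g x)}"

definition L2_class :: "real set \<Rightarrow> (real \<Rightarrow> real) \<Rightarrow> (real \<Rightarrow> real) set" where
  "L2_class S f = L2_rel S `` {f}"

definition L2_space :: "real set \<Rightarrow> (real \<Rightarrow> real) set set" where
  "L2_space S = L2 S // L2_rel S"

definition L2_dist :: "real set \<Rightarrow> (real \<Rightarrow> real) set \<Rightarrow> (real \<Rightarrow> real) set \<Rightarrow> real" where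
  "L2_dist S A B = L2_norm S (\<lambda>x. (SOME f. f \<in> A) x - (SOME g. g \<in> B) x)"

definition L2_topology :: "real set \<Rightarrow> (real \<Rightarrow> real) set topology" where
  "L2_topology S = Metric_space.mtopology (L2_space S) (L2_dist S)"

lemma L2_mult_integrable:
  assumes "f \<in> L2 S" "g \<in> L2 S"
  shows "integrable (lebesgue_on S) (\<lambda>x. f x * g x)"
proof (rule Bochner_Integration.integrable_bound)
  show "integrable (lebesgue_on S) (\<lambda>x. (f x)\<^sup>2 + (g x)\<^sup>2)"
    using assms by (auto simp: L2_def)
  show "(\<lambda>x. f x * g x) \<in> borel_measurable (lebesgue_on S)"
    using assms by (auto simp: L2_def)
  have "\<bar>r * s\<bar> \<le> r\<^sup>2 + s\<^sup>2" for r s :: real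
  proof -
    have "2 * (\<bar>r\<bar> * \<bar>s\<bar>) \<le> r\<^sup>2 + s\<^sup>2"
      using sum_squares_bound[of "\<bar>r\<bar>" "\<bar>s\<bar>"] by (simp add: mult.assoc)
    moreover have "0 \<le> \<bar>r\<bar> * \<bar>s\<bar>" by simp
    ultimately show ?thesis unfolding abs_mult by linarith
  qed
  then show "AE x in lebesgue_on S. norm (f x * g x) \<le> norm ((f x)\<^sup>2 + (g x)\<^sup>2)"
    by simp
qed

lemma L2_diff:
  assumes "f \<in> L2 S" "g \<in> L2 S"
  shows "(\<lambda>x. f x - g x) \<in> L2 S"
proof -
  have "integrable (lebesgue_on S) (\<lambda>x. (f x)\<^sup>2 + (g x)\<^sup>2 - 2 * (f x * g x))"
    using assms L2_mult_integrable[OF assms] by (auto simp: L2_def)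
  then show ?thesis
    using assms by (auto simp: L2_def power2_diff mult.assoc)
qed

lemma L2_norm_triangle:
  assumes f: "f \<in> L2 S" and g: "g \<in> L2 S"
  shows "L2_norm S (\<lambda>x. f x + g x) \<le> L2_norm S f + L2_norm S g"
proof -
  let ?M = "lebesgue_on S"
  define A B C where "A = (LINT x|?M. (f x)\<^sup>2)" and "B = (LINT x|?M. (g x)\<^sup>2)"
    and "C = (LINT x|?M. f x * g x)"
  have i: "integrable ?M (\<lambda>x. (f x)\<^sup>2)" "integrable ?M (\<lambda>x. (g x)\<^sup>2)"
    "integrable ?M (\<lambda>x. f x * g x)"
    using f g L2_mult_integrable by (auto simp: L2_def)
  have pos: "A \<ge> 0" "B \<ge> 0"
    by (simp_all add: A_def B_def)
  have expand: "(LINT x|?M. (r * f x + s * g x)\<^sup>2) = r\<^sup>2 * A + s\<^sup>2 * B + 2 * r * s * C" for r s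
  proof -
    have "(\<lambda>x. (r * f x + s * g x)\<^sup>2)
        = (\<lambda>x. r\<^sup>2 * (f x)\<^sup>2 + s\<^sup>2 * (g x)\<^sup>2 + 2 * r * s * (f x * g x))"
      by (simp add: power2_sum power_mult_distrib algebra_simps)
    then show ?thesis
      using i by (simp add: A_def B_def C_def)
  qed
  have q: "0 \<le> r\<^sup>2 * A + s\<^sup>2 * B + 2 * r * s * C" for r s
    unfolding expand[symmetric] by simp
  have "C\<^sup>2 \<le> A * B"
  proof (cases "B = 0")
    case True
    have "C = 0"
    proof (rule ccontr)
      assume "C \<noteq> 0"
      then have "2 * (- (A + 1) / (2 * C)) * C = - (A + 1)" by simp
      then show False
        using q[of 1 "- (A + 1) / (2 * C)"] True by simp
    qed
    then show ?thesis using True by simp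
  next
    case False
    then have "B > 0" using pos by simp
    have "0 \<le> B * (A * B - C\<^sup>2)"
      using q[of B "- C"] by (simp add: power2_eq_square algebra_simps)
    then show ?thesis
      using \<open>B > 0\<close> by (simp add: zero_le_mult_iff)
  qed
  then have "C \<le> sqrt A * sqrt B"
    by (metis real_le_rsqrt real_sqrt_mult)
  then have "A + B + 2 * C \<le> (sqrt A + sqrt B)\<^sup>2"
    using pos by (simp add: power2_sum)
  then have "sqrt (A + B + 2 * C) \<le> sqrt A + sqrt B"
    using pos by (simp add: real_le_lsqrt)
  then show ?thesis
    using expand[of 1 1] by (simp add: L2_norm_def A_def B_def)
qed

lemma equiv_L2_rel: "equiv (L2 S) (L2_rel S)"
proof (rule equivI)
  show "L2_rel S \<subseteq> L2 S \<times> L2 S" by (auto simp: L2_rel_def)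
  show "refl_on (L2 S) (L2_rel S)" by (auto simp: refl_on_def L2_rel_def)
  show "sym (L2_rel S)" by (auto simp: sym_def L2_rel_def elim: AE_mp)
  show "trans (L2_rel S)"
  proof (rule transI)
    fix f g h assume a: "(f, g) \<in> L2_rel S" "(g, h) \<in> L2_rel S"
    then have "AE x in lebesgue_on S. f x = g x" "AE x in lebesgue_on S. g x = h x"
      by (auto simp: L2_rel_def)
    then have "AE x in lebesgue_on S. f x = h x" by eventually_elim simp
    then show "(f, h) \<in> L2_rel S" using a by (auto simp: L2_rel_def)
  qed
qed

lemma L2_norm_diff_zero_iff:
  assumes "f \<in> L2 S" "g \<in> L2 S"
  shows "L2_norm S (\<lambda>x. f x - g x) = 0 \<longleftrightarrow> (f, g) \<in> L2_rel S"
proof -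
  have "integrable (lebesgue_on S) (\<lambda>x. (f x - g x)\<^sup>2)"
    using L2_diff[OF assms] by (simp add: L2_def)
  then show ?thesis
    using assms by (simp add: L2_norm_def integral_nonneg_eq_0_iff_AE L2_rel_def)
qed

lemma Metric_space_L2: "Metric_space (L2_space S) (L2_dist S)"
proof -
  have rep: "(SOME f. f \<in> A) \<in> A \<and> (SOME f. f \<in> A) \<in> L2 S" if "A \<in> L2_space S" for A
  proof -
    have "A \<noteq> {}" "A \<subseteq> L2 S"
      using that equiv_L2_rel[of S] in_quotient_imp_non_empty in_quotient_imp_subset
      unfolding L2_space_def by blast+
    then show ?thesis using some_in_eq by blast
  qed
  show ?thesis
  proof
    fix A B
    show "0 \<le> L2_dist S A B"
      by (simp add: L2_dist_def L2_norm_def)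
    show "L2_dist S A B = L2_dist S B A"
      by (simp add: L2_dist_def L2_norm_def power2_commute)
  next
    fix A B assume AB: "A \<in> L2_space S" "B \<in> L2_space S"
    have "L2_dist S A B = 0 \<longleftrightarrow> (SOME f. f \<in> A, SOME g. g \<in> B) \<in> L2_rel S"
      unfolding L2_dist_def using rep AB by (intro L2_norm_diff_zero_iff) auto
    also have "\<dots> \<longleftrightarrow> A = B"
      using quotient_eq_iff[OF equiv_L2_rel[of S]] rep AB unfolding L2_space_def by blast
    finally show "L2_dist S A B = 0 \<longleftrightarrow> A = B" .
  next
    fix A B C assume ABC: "A \<in> L2_space S" "B \<in> L2_space S" "C \<in> L2_space S"
    let ?r = "\<lambda>A. SOME f. f \<in> A"
    have "L2_norm S (\<lambda>x. (?r A x - ?r B x) + (?r B x - ?r C x))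
        \<le> L2_norm S (\<lambda>x. ?r A x - ?r B x) + L2_norm S (\<lambda>x. ?r B x - ?r C x)"
      using rep ABC by (intro L2_norm_triangle L2_diff) auto
    then show "L2_dist S A C \<le> L2_dist S A B + L2_dist S B C"
      by (simp add: L2_dist_def)
  qed
qed

text \<open>
  Curves \<open>v\<close> on a time interval \<open>I\<close> in a function space \<open>X\<close> normed by \<open>N\<close>: \<open>v t\<close> is the function
  \<open>x \<mapsto> v(x,t)\<close>. In \<open>C1_curve\<close>, \<open>w\<close> is the strong time derivative of \<open>v\<close>.
\<close>

definition C0_curve ::
  "(real \<Rightarrow> real) set \<Rightarrow> ((real \<Rightarrow> real) \<Rightarrow> real) \<Rightarrow> real set \<Rightarrow> (real \<Rightarrow> real \<Rightarrow> real) \<Rightarrow> bool" where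
  "C0_curve X N I v \<longleftrightarrow> (\<forall>t\<in>I. v t \<in> X) \<and>
     (\<forall>t\<in>I. ((\<lambda>s. N (\<lambda>x. v s x - v t x)) \<longlongrightarrow> 0) (at t within I))"

definition C1_curve ::
  "(real \<Rightarrow> real) set \<Rightarrow> ((real \<Rightarrow> real) \<Rightarrow> real) \<Rightarrow> real set \<Rightarrow>
     (real \<Rightarrow> real \<Rightarrow> real) \<Rightarrow> (real \<Rightarrow> real \<Rightarrow> real) \<Rightarrow> bool" where
  "C1_curve X N I v w \<longleftrightarrow> C0_curve X N I v \<and> C0_curve X N I w \<and>
     (\<forall>t\<in>I. ((\<lambda>s. N (\<lambda>x. (v s x - v t x) / (s - t) - w t x)) \<longlongrightarrow> 0) (at t within I))"

definition Ck_on :: "nat \<Rightarrow> real set \<Rightarrow> (real \<Rightarrow> real) \<Rightarrow> bool" where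
  "Ck_on k I g \<longleftrightarrow> (\<exists>d. d 0 = g \<and> continuous_on I (d k) \<and>
     (\<forall>i<k. \<forall>t\<in>I. (d i has_real_derivative d (Suc i) t) (at t within I)))"

text \<open>
  Elements of \<open>W\<^sup>3\<^sup>,\<^sup>\<infinity>\<^sub>l\<^sub>o\<^sub>c(\<real>)\<close> are represented by their continuous version, so that \<open>a 0\<close> and
  \<open>a (u t x)\<close> make sense.
\<close>

definition A1 :: "real \<Rightarrow> real \<Rightarrow> real \<Rightarrow> real \<Rightarrow> (real \<Rightarrow> real) \<Rightarrow> bool" where
  "A1 a0 a1 a2 a3 a \<longleftrightarrow>
     a \<in> sobolev 3 (Linf_loc UNIV) UNIV \<and> continuous_on UNIV a \<and> a 0 = 0 \<and>
     (AE y in lebesgue. a0 \<le> weak_deriv 1 UNIV a y \<and> weak_deriv 1 UNIV a y \<le> a1) \<and>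
     (AE y in lebesgue. \<bar>weak_deriv 2 UNIV a y\<bar> \<le> a2) \<and>
     (AE y in lebesgue. \<bar>weak_deriv 3 UNIV a y\<bar> \<le> a3)"

definition A3 :: "real \<Rightarrow> (real \<Rightarrow> real) \<Rightarrow> bool" where
  "A3 T g \<longleftrightarrow> Ck_on 4 {0..T} g \<and> g 0 = 0 \<and> (g has_real_derivative 0) (at 0 within {0..T})"

text \<open>
  Each \<open>p t\<close> and \<open>u t\<close> is taken to be the version of the \<open>H\<^sup>1(0,1)\<close> function that is continuous on
  \<open>[0,1]\<close>; hence its values at the end points are the traces.
\<close>

definition classical_solution ::
  "real \<Rightarrow> (real \<Rightarrow> real) \<Rightarrow> (real \<Rightarrow> real) \<Rightarrow> (real \<Rightarrow> real) \<Rightarrow> (real \<Rightarrow> real) \<Rightarrow> (real \<Rightarrow> real) \<Rightarrow>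
     (real \<Rightarrow> real \<Rightarrow> real) \<Rightarrow> (real \<Rightarrow> real \<Rightarrow> real) \<Rightarrow> bool" where
  "classical_solution T p0 u0 g0 g1 a p u \<longleftrightarrow>
     (\<forall>t\<in>{0..T}. continuous_on {0..1} (p t) \<and> continuous_on {0..1} (u t)) \<and>
     C0_curve (H 1 {0<..<1}) (H_norm 1 {0<..<1}) {0..T} p \<and>
     C0_curve (H 1 {0<..<1}) (H_norm 1 {0<..<1}) {0..T} u \<and>
     (\<exists>p' u'.
        C1_curve (L2 {0<..<1}) (L2_norm {0<..<1}) {0..T} p p' \<and>
        C1_curve (L2 {0<..<1}) (L2_norm {0<..<1}) {0..T} u u' \<and>
        (\<forall>t\<in>{0<..<T}. AE x in lebesgue_on {0<..<1}.
           p' t x + weak_deriv 1 {0<..<1} (u t) x = 0 \<and>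
           u' t x + weak_deriv 1 {0<..<1} (p t) x + a (u t x) = 0)) \<and>
     (\<forall>t\<in>{0..T}. u t 0 = g0 t \<and> u t 1 = g1 t) \<and>
     (\<forall>x\<in>{0..1}. p 0 x = p0 x \<and> u 0 x = u0 x)"

definition restricts_A1 ::
  "real \<Rightarrow> real \<Rightarrow> real \<Rightarrow> real \<Rightarrow> real \<Rightarrow> real \<Rightarrow> (real \<Rightarrow> real) \<Rightarrow> (real \<Rightarrow> real) \<Rightarrow> bool" where
  "restricts_A1 a0 a1 a2 a3 ul uu a b \<longleftrightarrow> A1 a0 a1 a2 a3 b \<and> (\<forall>y\<in>{ul..uu}. a y = b y)"

definition DF :: "real \<Rightarrow> real \<Rightarrow> real \<Rightarrow> real \<Rightarrow> real \<Rightarrow> real \<Rightarrow> (real \<Rightarrow> real) set" where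
  "DF a0 a1 a2 a3 ul uu = {a \<in> H 2 {ul<..<uu}. \<exists>b. restricts_A1 a0 a1 a2 a3 ul uu a b}"

text \<open>
  The equation is solved for some extension \<open>b\<close> of \<open>a\<close> to \<open>\<real>\<close>. When all solutions take values in
  \<open>[ul, uu]\<close>, the solution depends neither on the extension nor on the choices made here.
\<close>

definition forward ::
  "real \<Rightarrow> real \<Rightarrow> real \<Rightarrow> real \<Rightarrow> real \<Rightarrow> real \<Rightarrow> real \<Rightarrow>
     (real \<Rightarrow> real) \<Rightarrow> (real \<Rightarrow> real) \<Rightarrow> (real \<Rightarrow> real) \<Rightarrow> (real \<Rightarrow> real) \<Rightarrow>
     (real \<Rightarrow> real) \<Rightarrow> real \<Rightarrow> real" where
  "forward a0 a1 a2 a3 ul uu T p0 u0 g0 g1 a =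
     (SOME y. \<exists>b p u. restricts_A1 a0 a1 a2 a3 ul uu a b \<and>
        classical_solution T p0 u0 g0 g1 b p u \<and> y = (\<lambda>t. p t 0 - p t 1))"

end

theory Submission
  imports Defs "HOL-Complex_Analysis.Great_Picard"
begin

text \<open>
  The forward operator is Lipschitz continuous from the parameters, measured in the maximum norm on
  \<open>[ul, uu]\<close>, to \<open>L\<^sup>2(0,T)\<close>; all assertions follow from this and from the fact that weak convergence
  in \<open>H\<^sup>2\<close> implies uniform convergence on the equi-Lipschitz set \<open>D(F)\<close>.

  Lipschitz continuity (\<open>solution_stability\<close>). Let \<open>(p,u)\<close> and \<open>(q,v)\<close> solve the system for \<open>a\<close> and
  \<open>b\<close>, and put \<open>r = p - q\<close>, \<open>w = u - v\<close>. Then \<open>r\<^sub>t + w\<^sub>x = 0\<close> and \<open>w\<^sub>t + r\<^sub>x = -f\<close> with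
  \<open>f = a(u) - b(v)\<close>, the initial values vanish, and \<open>w = 0\<close> at both end points. As \<open>v\<close> takes values in
  \<open>[ul, uu]\<close>, we have \<open>\<bar>f\<bar> \<le> L\<bar>w\<bar> + \<delta>\<close>, where \<open>\<delta>\<close> bounds \<open>\<bar>a - b\<bar>\<close> on that interval. Testing with \<open>r\<close> and \<open>w\<close>
  and Gronwall's inequality bound the energy by a multiple of \<open>\<delta>\<^sup>2\<close>. The output consists of boundary
  values of \<open>r\<close>, which an \<open>L\<^sup>2\<close> bound in space does not control; but with \<open>m(x) = x - 1/2\<close>, testing with
  \<open>m w\<close> and \<open>m r\<close> gives
  \<open>d/dt \<integral> m r w dx + (r(0)\<^sup>2 + r(1)\<^sup>2) / 4 = \<integral> (r\<^sup>2 + w\<^sup>2) / 2 dx - \<integral> m r f dx\<close>,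
  and integration in time bounds the traces in \<open>L\<^sup>2(0,T)\<close> by \<open>\<delta>\<close> as well
  (\<open>hidden_trace_regularity\<close>). In particular solutions are unique.

  Compactness. Functions with (A1) vanish at \<open>0\<close> and have a common Lipschitz constant. Hence every
  sequence in \<open>D(F)\<close> has a uniformly convergent subsequence by Arzela and Ascoli
  (\<open>DF_sequentially_precompact\<close>). If the sequence converges weakly in \<open>H\<^sup>2\<close>, its integrals over compact
  subintervals converge, and an equi-Lipschitz sequence with this property is uniformly Cauchy
  (\<open>uniformly_Cauchy_if_integrals_converge\<close>). In both cases the outputs form a Cauchy sequence, and
  completeness of \<open>L\<^sup>2\<close> (\<open>mcomplete_L2\<close>) provides the limit even if the chosen weak limit is not
  a continuous representative, so that \<open>F\<close> need not be meaningful there.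

  The rest relates weak derivatives to integrals. Products of two rescaled copies of \<open>e\<^sup>-\<^sup>1\<^sup>/\<^sup>x\<close> are test
  functions that increase to the indicator of an interval; inserting them into the definition shows
  that weak derivatives are unique (\<open>weak_deriv_unique\<close>) and that continuous functions are the
  integrals of their weak derivatives (\<open>weak_deriv_FTC\<close>).
\<close>

section \<open>Smooth cutoff functions\<close>

text \<open>
  The functions \<open>P(1/x) e\<^sup>-\<^sup>1\<^sup>/\<^sup>x\<close>, extended by \<open>0\<close>: a family that contains \<open>e\<^sup>-\<^sup>1\<^sup>/\<^sup>x\<close> and is closed under
  differentiation.
\<close>

definition flat :: "real poly \<Rightarrow> real \<Rightarrow> real" where
  "flat P x = (if x > 0 then poly P (1 / x) * exp (- (1 / x)) else 0)"

lemma poly_times_exp_minus_tendsto_0: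
  fixes P :: "real poly"
  shows "((\<lambda>y. poly P y * exp (- y)) \<longlongrightarrow> 0) at_top"
proof -
  have "((\<lambda>y. \<Sum>i\<le>degree P. coeff P i * (y ^ i / exp y)) \<longlongrightarrow> (\<Sum>i\<le>degree P. coeff P i * 0)) at_top"
    by (intro tendsto_sum tendsto_mult tendsto_const tendsto_power_div_exp_0)
  then show ?thesis
    by (simp add: poly_altdef sum_distrib_right exp_minus divide_inverse mult.assoc)
qed

text \<open>
  For \<open>x > 0\<close> the derivative is \<open>(P(1/x) - P'(1/x)) x\<^sup>-\<^sup>2 e\<^sup>-\<^sup>1\<^sup>/\<^sup>x\<close>. At \<open>0\<close> the difference quotient is
  \<open>y P(y) e\<^sup>-\<^sup>y\<close> with \<open>y = 1/h \<rightarrow> \<infinity>\<close>.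
\<close>

lemma has_real_derivative_flat:
  "(flat P has_real_derivative flat ([:0, 0, 1:] * (P - pderiv P)) x) (at x)"
proof -
  consider "x > 0" | "x < 0" | "x = 0" by linarith
  then show ?thesis
  proof cases
    case 1
    have 2: "((\<lambda>x. 1 / x) has_real_derivative - (1 / x * (1 / x))) (at x)"
      using 1 by (auto intro!: derivative_eq_intros)
    have "((\<lambda>x. poly P (1 / x)) has_real_derivative
        poly (pderiv P) (1 / x) * - (1 / x * (1 / x))) (at x)"
      by (rule DERIV_chain2[OF poly_DERIV 2])
    moreover have "((\<lambda>x. exp (- (1 / x))) has_real_derivative
        exp (- (1 / x)) * (1 / x * (1 / x))) (at x)"
      using DERIV_chain2[OF DERIV_exp DERIV_minus[OF 2]] by simp
    ultimately have "((\<lambda>x. poly P (1 / x) * exp (- (1 / x))) has_real_derivative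
        poly (pderiv P) (1 / x) * - (1 / x * (1 / x)) * exp (- (1 / x))
        + exp (- (1 / x)) * (1 / x * (1 / x)) * poly P (1 / x)) (at x)"
      by (rule DERIV_mult)
    moreover have "poly (pderiv P) (1 / x) * - (1 / x * (1 / x)) * exp (- (1 / x))
        + exp (- (1 / x)) * (1 / x * (1 / x)) * poly P (1 / x)
        = flat ([:0, 0, 1:] * (P - pderiv P)) x"
      using 1 by (simp add: flat_def del: mult_pCons_left) (simp add: diff_divide_distrib algebra_simps del: mult_pCons_left)
    ultimately have "((\<lambda>x. poly P (1 / x) * exp (- (1 / x))) has_real_derivative
        flat ([:0, 0, 1:] * (P - pderiv P)) x) (at x)"
      by simp
    then show ?thesis
      by (rule DERIV_cong_ev[THEN iffD1, rotated 3])
        (use 1 eventually_nhds_in_open[of "{0<..}" x] in \<open>auto elim!: eventually_mono simp: flat_def\<close>)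
  next
    case 2
    have "((\<lambda>x. 0) has_real_derivative flat ([:0, 0, 1:] * (P - pderiv P)) x) (at x)"
      using 2 by (auto simp: flat_def)
    then show ?thesis
      by (rule DERIV_cong_ev[THEN iffD1, rotated 3])
        (use 2 eventually_nhds_in_open[of "{..<0}" x] in \<open>auto elim!: eventually_mono simp: flat_def\<close>)
  next
    case 3
    have "((\<lambda>h. poly (pCons 0 P) (inverse h) * exp (- inverse h)) \<longlongrightarrow> 0) (at_right 0)"
      by (rule filterlim_compose[OF poly_times_exp_minus_tendsto_0 filterlim_inverse_at_top_right])
    then have "((\<lambda>h. flat P h / h) \<longlongrightarrow> 0) (at_right 0)"
      by (rule Lim_transform_eventually)
        (auto simp: eventually_at_filter flat_def field_simps)
    moreover have "((\<lambda>h. flat P h / h) \<longlongrightarrow> 0) (at_left 0)"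
      by (rule tendsto_eventually) (auto simp: eventually_at_filter flat_def)
    ultimately have "((\<lambda>h. flat P h / h) \<longlongrightarrow> 0) (at 0)"
      by (simp add: filterlim_at_split)
    then show ?thesis
      using 3 by (simp add: DERIV_def flat_def)
  qed
qed

text \<open>
  The derivative of a generator is a generator, constant factors being absorbed by \<open>P\<close>, so this algebra
  is closed under differentiation. This yields smoothness of products without the Leibniz formula for
  higher derivatives.
\<close>

inductive flat_alg :: "(real \<Rightarrow> real) \<Rightarrow> bool" where
  base: "flat_alg (\<lambda>x. flat P (c * x + d))"
| add: "flat_alg f \<Longrightarrow> flat_alg g \<Longrightarrow> flat_alg (\<lambda>x. f x + g x)"
| mult: "flat_alg f \<Longrightarrow> flat_alg g \<Longrightarrow> flat_alg (\<lambda>x. f x * g x)"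

lemma flat_smult: "flat (smult c P) x = c * flat P x"
  by (simp add: flat_def)

lemma flat_alg_has_derivative:
  assumes "flat_alg f"
  shows "\<exists>f'. flat_alg f' \<and> (\<forall>x. (f has_real_derivative f' x) (at x))"
  using assms
proof induction
  case (base P c d)
  let ?Q = "smult c ([:0, 0, 1:] * (P - pderiv P))"
  have "((\<lambda>x. flat P (c * x + d)) has_real_derivative flat ?Q (c * x + d)) (at x)" for x
    unfolding flat_smult
    by (rule DERIV_chain2[OF has_real_derivative_flat, THEN DERIV_cong])
      (auto intro!: derivative_eq_intros)
  then show ?case using flat_alg.base by blast
next
  case (add f g)
  then obtain f' g' where "flat_alg f'" "flat_alg g'"
    "\<And>x. (f has_real_derivative f' x) (at x)" "\<And>x. (g has_real_derivative g' x) (at x)" by blast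
  then show ?case
    by (intro exI[of _ "\<lambda>x. f' x + g' x"]) (auto intro: flat_alg.add DERIV_add)
next
  case (mult f g)
  then obtain f' g' where fg: "flat_alg f'" "flat_alg g'"
    "\<And>x. (f has_real_derivative f' x) (at x)" "\<And>x. (g has_real_derivative g' x) (at x)" by blast
  then have "flat_alg (\<lambda>x. f' x * g x + f x * g' x)"
    using mult.hyps by (intro flat_alg.add flat_alg.mult) 
  moreover have "((\<lambda>x. f x * g x) has_real_derivative (f' x * g x + f x * g' x)) (at x)" for x
    using DERIV_mult[OF fg(3,4)] by (simp add: mult.commute)
  ultimately show ?case by blast
qed

lemma flat_alg_smooth:
  assumes "flat_alg f"
  shows "(deriv ^^ n) f field_differentiable at x"
proof -
  have "flat_alg ((deriv ^^ n) f)"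
  proof (induction n)
    case 0
    then show ?case using assms by simp
  next
    case (Suc n)
    then obtain f' where f': "flat_alg f'" "\<And>x. ((deriv ^^ n) f has_real_derivative f' x) (at x)"
      using flat_alg_has_derivative by blast
    then have "deriv ((deriv ^^ n) f) = f'"
      by (auto intro: DERIV_imp_deriv)
    then show ?case using f' by simp
  qed
  then show ?thesis
    using flat_alg_has_derivative field_differentiable_def by blast
qed

text \<open>
  The factor \<open>n + 1\<close> drives both exponentials \<open>exp (- 1 / ((n + 1) y))\<close>, \<open>y > 0\<close>, to \<open>1\<close>, while the
  support remains \<open>[\<alpha>, \<beta>]\<close> for all \<open>n\<close>.
\<close>

definition cutoff :: "nat \<Rightarrow> real \<Rightarrow> real \<Rightarrow> real \<Rightarrow> real" where
  "cutoff n \<alpha> \<beta> x = flat 1 (real (Suc n) * (x - \<alpha>)) * flat 1 (real (Suc n) * (\<beta> - x))"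

lemma flat_1_bounds: "0 \<le> flat 1 x" "flat 1 x \<le> 1"
  by (auto simp: flat_def)

lemma cutoff_bounds: "0 \<le> cutoff n \<alpha> \<beta> x" "cutoff n \<alpha> \<beta> x \<le> 1"
  using flat_1_bounds by (auto simp: cutoff_def mult_le_one)

lemma cutoff_eq_0: "x \<notin> {\<alpha><..<\<beta>} \<Longrightarrow> cutoff n \<alpha> \<beta> x = 0"
  by (auto simp: cutoff_def flat_def zero_less_mult_iff)

lemma flat_1_scaled_tendsto:
  assumes "y > 0"
  shows "(\<lambda>n. flat 1 (real (Suc n) * y)) \<longlonglongrightarrow> 1"
proof -
  have "(\<lambda>n. inverse (real (Suc n))) \<longlonglongrightarrow> 0"
    by (rule LIMSEQ_inverse_real_of_nat)
  from tendsto_exp[OF tendsto_minus[OF tendsto_mult_left[OF this, of "1 / y"]]]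
  have "(\<lambda>n. exp (- (1 / y * inverse (real (Suc n))))) \<longlonglongrightarrow> 1"
    by simp
  moreover have "flat 1 (real (Suc n) * y) = exp (- (1 / y * inverse (real (Suc n))))" for n
    using assms by (simp add: flat_def field_simps del: of_nat_Suc)
  ultimately show ?thesis by simp
qed

lemma cutoff_tendsto:
  assumes "x \<in> {\<alpha><..<\<beta>}"
  shows "(\<lambda>n. cutoff n \<alpha> \<beta> x) \<longlonglongrightarrow> 1"
  using tendsto_mult[OF flat_1_scaled_tendsto[of "x - \<alpha>"] flat_1_scaled_tendsto[of "\<beta> - x"]] assms
  by (simp add: cutoff_def)

lemma cutoff_flat_alg: "flat_alg (cutoff n \<alpha> \<beta>)"
proof -
  have "cutoff n \<alpha> \<beta> = (\<lambda>x. flat 1 (real (Suc n) * x + (- real (Suc n) * \<alpha>))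
      * flat 1 ((- real (Suc n)) * x + real (Suc n) * \<beta>))"
    by (auto simp: cutoff_def algebra_simps fun_eq_iff)
  then show ?thesis
    using flat_alg.mult[OF flat_alg.base flat_alg.base] by metis
qed

lemma cutoff_test_function:
  assumes "{\<alpha>..\<beta>} \<subseteq> S"
  shows "cutoff n \<alpha> \<beta> \<in> test_functions S"
  unfolding test_functions_def
proof (clarsimp, intro conjI allI exI)
  show "(deriv ^^ m) (cutoff n \<alpha> \<beta>) field_differentiable at x" for m x
    by (rule flat_alg_smooth[OF cutoff_flat_alg])
  show "compact {\<alpha>..\<beta>}" "{\<alpha>..\<beta>} \<subseteq> S" using assms by auto
  show "x \<notin> {\<alpha>..\<beta>} \<longrightarrow> cutoff n \<alpha> \<beta> x = 0" for x
    by (auto intro: cutoff_eq_0)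
qed

lemma continuous_on_flat [continuous_intros]:
  "continuous_on T f \<Longrightarrow> continuous_on T (\<lambda>x. flat P (f x))"
  by (rule continuous_on_compose2[of UNIV "flat P"])
    (auto intro: DERIV_continuous_on has_real_derivative_flat)

lemma cutoff_derivative:
  "((\<lambda>x. flat 1 (real (Suc n) * (x - \<alpha>))) has_real_derivative
      real (Suc n) * flat [:0, 0, 1:] (real (Suc n) * (x - \<alpha>))) (at x)"
  "((\<lambda>x. flat 1 (real (Suc n) * (\<beta> - x))) has_real_derivative
      - (real (Suc n) * flat [:0, 0, 1:] (real (Suc n) * (\<beta> - x)))) (at x)"
proof -
  have d: "(flat 1 has_real_derivative flat [:0, 0, 1:] y) (at y)" for y
    using has_real_derivative_flat[of 1 y] by simp
  have k: "((\<lambda>x. k * (x - \<alpha>)) has_real_derivative k) (at x)"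
    "((\<lambda>x. k * (\<beta> - x)) has_real_derivative - k) (at x)" for k
    by (auto intro!: derivative_eq_intros)
  show "((\<lambda>x. flat 1 (real (Suc n) * (x - \<alpha>))) has_real_derivative
      real (Suc n) * flat [:0, 0, 1:] (real (Suc n) * (x - \<alpha>))) (at x)"
    using DERIV_chain2[OF d k(1), of "real (Suc n)"] by (simp only: mult.commute)
  show "((\<lambda>x. flat 1 (real (Suc n) * (\<beta> - x))) has_real_derivative
      - (real (Suc n) * flat [:0, 0, 1:] (real (Suc n) * (\<beta> - x)))) (at x)"
    using DERIV_chain2[OF d k(2), of "real (Suc n)"]
    by (simp only: mult.commute[of "flat _ _"] mult_minus_left)
qed

lemma DERIV_cutoff:
  fixes n \<alpha> \<beta>
  defines "k \<equiv> real (Suc n)"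
  shows "(cutoff n \<alpha> \<beta> has_real_derivative
      k * flat [:0, 0, 1:] (k * (x - \<alpha>)) * flat 1 (k * (\<beta> - x))
      - k * flat [:0, 0, 1:] (k * (\<beta> - x)) * flat 1 (k * (x - \<alpha>))) (at x)"
proof -
  have "cutoff n \<alpha> \<beta> = (\<lambda>x. flat 1 (k * (x - \<alpha>)) * flat 1 (k * (\<beta> - x)))"
    by (rule ext) (simp only: cutoff_def k_def)
  moreover have "((\<lambda>x. flat 1 (k * (x - \<alpha>)) * flat 1 (k * (\<beta> - x))) has_real_derivative
      k * flat [:0, 0, 1:] (k * (x - \<alpha>)) * flat 1 (k * (\<beta> - x))
      + - (k * flat [:0, 0, 1:] (k * (\<beta> - x))) * flat 1 (k * (x - \<alpha>))) (at x)"
    unfolding k_def by (rule DERIV_mult[OF cutoff_derivative])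
  ultimately show ?thesis by (simp only: mult_minus_left add_uminus_conv_diff)
qed

lemmas deriv_cutoff = DERIV_cutoff[THEN DERIV_imp_deriv]

lemma has_real_derivative_cutoff:
  "(cutoff n \<alpha> \<beta> has_real_derivative deriv (cutoff n \<alpha> \<beta>) x) (at x)"
  by (simp only: deriv_cutoff DERIV_cutoff)

lemma continuous_on_cutoff: "continuous_on T (cutoff n \<alpha> \<beta>)"
  by (meson DERIV_continuous_on has_field_derivative_at_within has_real_derivative_cutoff)

lemma continuous_on_deriv_cutoff: "continuous_on T (deriv (cutoff n \<alpha> \<beta>))"
proof -
  have "deriv (cutoff n \<alpha> \<beta>) = (\<lambda>x. real (Suc n) * flat [:0, 0, 1:] (real (Suc n) * (x - \<alpha>))
      * flat 1 (real (Suc n) * (\<beta> - x))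
      - real (Suc n) * flat [:0, 0, 1:] (real (Suc n) * (\<beta> - x))
      * flat 1 (real (Suc n) * (x - \<alpha>)))"
    by (rule ext) (simp only: deriv_cutoff)
  then show ?thesis
    by (simp only:) (intro continuous_intros)
qed

lemma flat_sq_nonneg: "0 \<le> flat [:0, 0, 1:] x"
  by (auto simp: flat_def)

text \<open>
  One factor increases, the other decreases, and both lie in \<open>[0, 1]\<close>. By the product rule the integral is
  at most the sum of their total variations, uniformly in \<open>n\<close> although the derivatives concentrate at
  the end points.
\<close>

lemma cutoff_variation:
  assumes "\<alpha> \<le> \<beta>"
  shows "integral {\<alpha>..\<beta>} (\<lambda>x. \<bar>deriv (cutoff n \<alpha> \<beta>) x\<bar>) \<le> 2"
proof -
  define k where "k = real (Suc n)"
  have kpos: "k > 0" by (simp add: k_def)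
  define A where "A = (\<lambda>x. flat 1 (k * (x - \<alpha>)))"
  define B where "B = (\<lambda>x. flat 1 (k * (\<beta> - x)))"
  define A' where "A' = (\<lambda>x. k * flat [:0, 0, 1:] (k * (x - \<alpha>)))"
  define B' where "B' = (\<lambda>x. - (k * flat [:0, 0, 1:] (k * (\<beta> - x))))"
  have dA: "(A has_real_derivative A' x) (at x)" and dB: "(B has_real_derivative B' x) (at x)" for x
    unfolding A_def B_def A'_def B'_def k_def by (fact cutoff_derivative)+
  have i: "((\<lambda>x. A' x - B' x) has_integral ((A \<beta> - B \<beta>) - (A \<alpha> - B \<alpha>))) {\<alpha>..\<beta>}"
    using dA dB assms
    by (intro fundamental_theorem_of_calculus)
      (auto simp: has_real_derivative_iff_has_vector_derivative[symmetric]
        intro: DERIV_diff DERIV_subset)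
  have "integral {\<alpha>..\<beta>} (\<lambda>x. \<bar>deriv (cutoff n \<alpha> \<beta>) x\<bar>) \<le> integral {\<alpha>..\<beta>} (\<lambda>x. A' x - B' x)"
  proof (rule integral_le)
    show "(\<lambda>x. \<bar>deriv (cutoff n \<alpha> \<beta>) x\<bar>) integrable_on {\<alpha>..\<beta>}"
      by (intro integrable_continuous_interval continuous_intros continuous_on_deriv_cutoff)
    show "(\<lambda>x. A' x - B' x) integrable_on {\<alpha>..\<beta>}" using i by blast
    fix x
    have "deriv (cutoff n \<alpha> \<beta>) x = A' x * B x + A x * B' x"
      by (simp only: deriv_cutoff A'_def B'_def A_def B_def k_def) (simp only: minus_mult_left[symmetric] minus_mult_right[symmetric] add_uminus_conv_diff mult.commute mult.left_commute)
    moreover have "0 \<le> A' x" "B' x \<le> 0" "0 \<le> A x" "A x \<le> 1" "0 \<le> B x" "B x \<le> 1"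
      using kpos flat_1_bounds flat_sq_nonneg by (simp_all add: A'_def B'_def A_def B_def)
    moreover then have "A' x * B x \<le> A' x" "A x * - B' x \<le> - B' x"
      "0 \<le> A' x * B x" "0 \<le> A x * - B' x"
      using mult_left_le[of "B x" "A' x"] mult_left_le_one_le[of "- B' x" "A x"]
      by (simp_all add: mult_nonneg_nonpos)
    ultimately show "\<bar>deriv (cutoff n \<alpha> \<beta>) x\<bar> \<le> A' x - B' x" by auto
  qed
  also have "\<dots> = (A \<beta> - B \<beta>) - (A \<alpha> - B \<alpha>)" using i by (rule integral_unique)
  also have "\<dots> \<le> 2" using flat_1_bounds(2)[of "k * (\<beta> - \<alpha>)"]
    by (simp add: A_def B_def) (simp add: flat_def)
  finally show ?thesis .
qed

section \<open>Weak derivatives on open subsets of the real line\<close>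

lemma LINT_restrict_support:
  fixes F :: "real \<Rightarrow> real"
  assumes "S \<in> sets lebesgue" "K \<in> sets lebesgue" "K \<subseteq> S" "\<And>x. x \<in> S - K \<Longrightarrow> F x = 0"
  shows "(LINT x|lebesgue_on S. F x) = (LINT x|lebesgue_on K. F x)"
proof -
  have "indicator S x *\<^sub>R F x = indicator K x *\<^sub>R F x" for x
    using assms by (auto simp: indicator_def)
  then have "(\<lambda>x. indicator S x *\<^sub>R F x) = (\<lambda>x. indicator K x *\<^sub>R F x)" by blast
  then show ?thesis
    using assms by (simp only: integral_restrict_space sets.Int_space_eq2)
qed

lemma integrable_restrict_support:
  fixes F :: "real \<Rightarrow> real"
  assumes "S \<in> sets lebesgue" "K \<in> sets lebesgue" "K \<subseteq> S" "\<And>x. x \<in> S - K \<Longrightarrow> F x = 0"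
  shows "integrable (lebesgue_on S) F \<longleftrightarrow> integrable (lebesgue_on K) F"
proof -
  have "indicator S x *\<^sub>R F x = indicator K x *\<^sub>R F x" for x
    using assms by (auto simp: indicator_def)
  then have "(\<lambda>x. indicator S x *\<^sub>R F x) = (\<lambda>x. indicator K x *\<^sub>R F x)" by blast
  then show ?thesis
    using assms by (simp only: integrable_restrict_space sets.Int_space_eq2)
qed

text \<open>
  The complement of \<open>K\<close> is open, hence derivatives there only see the zero function.
\<close>

lemma deriv_funpow_eq_0_outside:
  fixes \<phi> :: "real \<Rightarrow> real"
  assumes "closed K" "\<And>x. x \<notin> K \<Longrightarrow> \<phi> x = 0" "x \<notin> K"
  shows "(deriv ^^ k) \<phi> x = 0"
  using assms(3)
proof (induction k arbitrary: x)
  case 0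
  then show ?case using assms(2) by simp
next
  case (Suc k)
  have "\<forall>\<^sub>F y in nhds x. y \<in> - K"
    using Suc.prems assms(1) by (intro eventually_nhds_in_open) auto
  then have "\<forall>\<^sub>F y in nhds x. (deriv ^^ k) \<phi> y = 0"
    by eventually_elim (use Suc.IH in auto)
  then have "deriv ((deriv ^^ k) \<phi>) x = deriv (\<lambda>_. 0) x"
    by (rule deriv_cong_ev) simp
  then show ?case by simp
qed

text \<open>
  Dominated convergence. The cutoffs vanish at \<open>\<alpha>\<close> and \<open>\<beta>\<close> for every \<open>n\<close>, so the pointwise limit is
  correct only up to these two points.
\<close>

lemma LINT_cutoff_tendsto:
  assumes g: "integrable (lebesgue_on {\<alpha>..\<beta>}) g"
  shows "(\<lambda>n. LINT x|lebesgue_on {\<alpha>..\<beta>}. g x * cutoff n \<alpha> \<beta> x)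
    \<longlonglongrightarrow> (LINT x|lebesgue_on {\<alpha>..\<beta>}. g x)"
proof (rule integral_dominated_convergence[where w = "\<lambda>x. \<bar>g x\<bar>"])
  show "g \<in> borel_measurable (lebesgue_on {\<alpha>..\<beta>})" using g by blast
  show "(\<lambda>x. g x * cutoff n \<alpha> \<beta> x) \<in> borel_measurable (lebesgue_on {\<alpha>..\<beta>})" for n
    by (intro borel_measurable_times borel_measurable_integrable[OF g]
        continuous_imp_measurable_on_sets_lebesgue continuous_on_cutoff) auto
  show "integrable (lebesgue_on {\<alpha>..\<beta>}) (\<lambda>x. \<bar>g x\<bar>)" using g by simp
  have "AE x in lebesgue. x \<noteq> \<alpha> \<and> x \<noteq> \<beta>"
    by (intro AE_completion AE_conjI AE_lborel_singleton)
  then have "AE x in lebesgue_on {\<alpha>..\<beta>}. x \<noteq> \<alpha> \<and> x \<noteq> \<beta>"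
    by (simp add: AE_restrict_space_iff) (auto elim: eventually_mono)
  moreover have "AE x in lebesgue_on {\<alpha>..\<beta>}. x \<in> {\<alpha>..\<beta>}"
    by (rule AE_I2) simp
  ultimately show "AE x in lebesgue_on {\<alpha>..\<beta>}. (\<lambda>n. g x * cutoff n \<alpha> \<beta> x) \<longlonglongrightarrow> g x"
  proof eventually_elim
    case (elim x)
    then show ?case using tendsto_mult_left[OF cutoff_tendsto[of x \<alpha> \<beta>], of "g x"] by auto
  qed
  show "AE x in lebesgue_on {\<alpha>..\<beta>}. norm (g x * cutoff n \<alpha> \<beta> x) \<le> \<bar>g x\<bar>" for n
    using cutoff_bounds[of n \<alpha> \<beta>] by (auto simp: abs_mult intro!: AE_I2 mult_left_le)
qed

lemma is_weak_deriv_cutoff: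
  assumes wd: "is_weak_deriv k S f g" and S: "S \<in> sets lebesgue" "{\<alpha>..\<beta>} \<subseteq> S"
  shows "(LINT x|lebesgue_on {\<alpha>..\<beta>}. f x * (deriv ^^ k) (cutoff n \<alpha> \<beta>) x)
    = (-1) ^ k * (LINT x|lebesgue_on {\<alpha>..\<beta>}. g x * cutoff n \<alpha> \<beta> x)"
proof -
  have out: "(deriv ^^ k) (cutoff n \<alpha> \<beta>) x = 0" if "x \<notin> {\<alpha>..\<beta>}" for x
    by (rule deriv_funpow_eq_0_outside[OF _ _ that]) (auto intro: cutoff_eq_0)
  have "(LINT x|lebesgue_on S. f x * (deriv ^^ k) (cutoff n \<alpha> \<beta>) x)
      = (-1) ^ k * (LINT x|lebesgue_on S. g x * cutoff n \<alpha> \<beta> x)"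
    using wd cutoff_test_function[OF S(2)] unfolding is_weak_deriv_def by blast
  moreover have "(LINT x|lebesgue_on S. f x * (deriv ^^ k) (cutoff n \<alpha> \<beta>) x)
      = (LINT x|lebesgue_on {\<alpha>..\<beta>}. f x * (deriv ^^ k) (cutoff n \<alpha> \<beta>) x)"
    using S by (intro LINT_restrict_support) (auto simp: out)
  moreover have "(LINT x|lebesgue_on S. g x * cutoff n \<alpha> \<beta> x)
      = (LINT x|lebesgue_on {\<alpha>..\<beta>}. g x * cutoff n \<alpha> \<beta> x)"
    using S by (intro LINT_restrict_support) (auto simp: cutoff_eq_0)
  ultimately show ?thesis by simp
qed

lemma is_weak_deriv_integrable:
  assumes "is_weak_deriv k S f g" "{\<alpha>..\<beta>} \<subseteq> S"
  shows "integrable (lebesgue_on {\<alpha>..\<beta>}) f" "integrable (lebesgue_on {\<alpha>..\<beta>}) g"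
  using assms by (auto simp: is_weak_deriv_def locally_integrable_def)

text \<open>
  Tested with the same cutoff, \<open>g\<close> and \<open>g'\<close> give the same number; let the cutoffs tend to the indicator of
  the interval.
\<close>

lemma weak_deriv_integral_unique:
  assumes "is_weak_deriv k S f g" "is_weak_deriv k S f g'" and S: "S \<in> sets lebesgue" "{\<alpha>..\<beta>} \<subseteq> S"
  shows "(LINT x|lebesgue_on {\<alpha>..\<beta>}. g x) = (LINT x|lebesgue_on {\<alpha>..\<beta>}. g' x)"
proof (rule LIMSEQ_unique)
  show "(\<lambda>n. LINT x|lebesgue_on {\<alpha>..\<beta>}. g x * cutoff n \<alpha> \<beta> x)
    \<longlonglongrightarrow> (LINT x|lebesgue_on {\<alpha>..\<beta>}. g x)"
    using assms by (intro LINT_cutoff_tendsto is_weak_deriv_integrable)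
  have "(LINT x|lebesgue_on {\<alpha>..\<beta>}. g x * cutoff n \<alpha> \<beta> x)
      = (LINT x|lebesgue_on {\<alpha>..\<beta>}. g' x * cutoff n \<alpha> \<beta> x)" for n
    using is_weak_deriv_cutoff[OF assms(1) S, of n] is_weak_deriv_cutoff[OF assms(2) S, of n] by simp
  then show "(\<lambda>n. LINT x|lebesgue_on {\<alpha>..\<beta>}. g x * cutoff n \<alpha> \<beta> x)
    \<longlonglongrightarrow> (LINT x|lebesgue_on {\<alpha>..\<beta>}. g' x)"
    using assms by (simp add: LINT_cutoff_tendsto is_weak_deriv_integrable)
qed

text \<open>
  The positive and the negative part of \<open>h\<close> are densities of two finite measures that agree on all
  half-lines, hence of the same measure, and densities are unique. The uniqueness theorem is about Borel
  measures, so \<open>h\<close> is first replaced by a Borel function that agrees with it almost everywhere.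
\<close>

lemma AE_eq_0_if_interval_integrals_0:
  fixes h :: "real \<Rightarrow> real"
  assumes h: "integrable (lebesgue_on {A..B}) h"
    and 0: "\<And>\<alpha>. A \<le> \<alpha> \<Longrightarrow> (LINT x|lebesgue_on {\<alpha>..B}. h x) = 0"
  shows "AE x in lebesgue_on {A..B}. h x = 0"
proof -
  define h0 where "h0 = (\<lambda>x. indicator {A..B} x * h x)"
  have h0: "integrable lebesgue h0"
    using h unfolding h0_def by (simp add: integrable_restrict_space)
  then obtain k where k: "k \<in> borel_measurable lborel" "AE x in lborel. h0 x = k x"
    using completion_ex_borel_measurable_real[of h0 lborel] by blast
  have AEk: "AE x in lebesgue. h0 x = k x" by (rule AE_completion[OF k(2)])
  have "integrable lebesgue k"
    by (rule integrable_cong_AE_imp[OF h0 measurable_completion[OF k(1)]])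
      (use AEk in eventually_elim, simp)
  then have ki: "integrable lborel k" using integrable_completion[OF k(1)] by simp
  have int0: "(LINT x|lborel. indicator {y<..} x * k x) = 0" for y
  proof -
    have "(LINT x|lborel. indicator {y<..} x * k x) = (LINT x|lebesgue. indicator {y<..} x * k x)"
      by (intro integral_completion[symmetric] borel_measurable_times k(1)
          borel_measurable_indicator) auto
    also have "\<dots> = (LINT x|lebesgue. indicator {max A y..B} x *\<^sub>R h x)"
    proof (rule integral_cong_AE)
      show "(\<lambda>x. indicator {y<..} x * k x) \<in> borel_measurable lebesgue"
        by (intro borel_measurable_times measurable_completion[OF k(1)]
            borel_measurable_indicator) auto
      have "integrable (lebesgue_on {max A y..B}) h"
        by (rule integrable_subinterval[OF h]) auto
      then show "(\<lambda>x. indicator {max A y..B} x *\<^sub>R h x) \<in> borel_measurable lebesgue"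
        by (simp add: integrable_restrict_space borel_measurable_integrable)
      have "AE x in lebesgue. x \<noteq> y" by (intro AE_completion AE_lborel_singleton)
      then show "AE x in lebesgue. indicator {y<..} x * k x = indicator {max A y..B} x *\<^sub>R h x"
        using AEk
      proof eventually_elim
        case (elim x)
        from elim(2)[symmetric] show ?case using elim(1) by (auto simp: h0_def indicator_def)
      qed
    qed
    also have "\<dots> = (LINT x|lebesgue_on {max A y..B}. h x)"
      by (simp add: integral_restrict_space)
    also have "\<dots> = 0" by (rule 0) simp
    finally show ?thesis .
  qed
  have fin: "(\<integral>\<^sup>+ x. ennreal (indicator {y<..} x * k x) \<partial>lborel) < \<infinity>"
     "(\<integral>\<^sup>+ x. ennreal (- (indicator {y<..} x * k x)) \<partial>lborel) < \<infinity>" for y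
  proof -
    have "integrable lborel (\<lambda>x. indicator {y<..} x * k x)"
      using integrable_mult_indicator[OF _ ki, of "{y<..}"] by simp
    then show "(\<integral>\<^sup>+ x. ennreal (indicator {y<..} x * k x) \<partial>lborel) < \<infinity>"
     "(\<integral>\<^sup>+ x. ennreal (- (indicator {y<..} x * k x)) \<partial>lborel) < \<infinity>"
      by (auto simp: real_integrable_def less_top)
  qed
  have eq: "(\<integral>\<^sup>+ x. ennreal (indicator {y<..} x * k x) \<partial>lborel)
      = (\<integral>\<^sup>+ x. ennreal (- (indicator {y<..} x * k x)) \<partial>lborel)" for y
  proof -
    have "integrable lborel (\<lambda>x. indicator {y<..} x * k x)"
      using integrable_mult_indicator[OF _ ki, of "{y<..}"] by simp
    from real_lebesgue_integral_def[OF this] int0[of y]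
    have "enn2real (\<integral>\<^sup>+ x. ennreal (indicator {y<..} x * k x) \<partial>lborel)
      = enn2real (\<integral>\<^sup>+ x. ennreal (- (indicator {y<..} x * k x)) \<partial>lborel)" by simp
    then show ?thesis using fin[of y] by (metis ennreal_enn2real infinity_ennreal_def)
  qed
  have e1: "emeasure (density lborel (\<lambda>x. ennreal (k x))) {y<..}
      = (\<integral>\<^sup>+ x. ennreal (indicator {y<..} x * k x) \<partial>lborel)" for y
    using k(1) by (subst emeasure_density) (auto intro!: nn_integral_cong simp: indicator_def)
  have e2: "emeasure (density lborel (\<lambda>x. ennreal (- k x))) {y<..}
      = (\<integral>\<^sup>+ x. ennreal (- (indicator {y<..} x * k x)) \<partial>lborel)" for y
    using k(1) by (subst emeasure_density) (auto intro!: nn_integral_cong simp: indicator_def)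
  have "density lborel (\<lambda>x. ennreal (k x)) = density lborel (\<lambda>x. ennreal (- k x))"
    by (rule measure_eqI_lessThan) (use fin eq in \<open>simp_all add: e1 e2\<close>)
  then have "AE x in lborel. ennreal (k x) = ennreal (- k x)"
    using k(1) by (intro sigma_finite_measure.density_unique[OF sigma_finite_lborel]) auto
  then have "AE x in lborel. k x = 0"
  proof eventually_elim
    case (elim x)
    have "k x \<le> 0 \<longleftrightarrow> - k x \<le> 0"
      unfolding ennreal_eq_0_iff[symmetric] elim ..
    then show ?case by linarith
  qed
  from AE_completion[OF this] AEk have "AE x in lebesgue. h0 x = 0"
    by eventually_elim simp
  then show ?thesis
    by (simp add: AE_restrict_space_iff h0_def) (auto elim: eventually_mono)
qed

lemma open_countable_union_Icc:
  fixes S :: "real set"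
  assumes "open S"
  obtains C where "countable C" "S = \<Union>C" "\<And>K. K \<in> C \<Longrightarrow> \<exists>a b. K = {a..b}"
proof
  let ?C = "(\<lambda>(a, b). {a..b}) ` {(a, b). a \<in> \<rat> \<and> b \<in> \<rat> \<and> {a..b} \<subseteq> S}"
  have "countable ((\<rat> :: real set) \<times> \<rat>)" by (intro countable_SIGMA countable_rat)
  then show "countable ?C"
    by (rule countable_image[OF countable_subset, rotated]) auto
  show "S = \<Union>?C"
  proof
    show "S \<subseteq> \<Union>?C"
    proof
      fix x assume "x \<in> S"
      then obtain e where e: "e > 0" "ball x e \<subseteq> S" using assms open_contains_ball by blast
      obtain a where a: "a \<in> \<rat>" "x - e < a" "a < x" using Rats_dense_in_real[of "x - e" x] e by auto
      obtain b where b: "b \<in> \<rat>" "x < b" "b < x + e" using Rats_dense_in_real[of x "x + e"] e by auto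
      have "{a..b} \<subseteq> ball x e" using a b by (auto simp: dist_real_def)
      then show "x \<in> \<Union>?C" using a b e by (intro UnionI[of "{a..b}"]) auto
    qed
  qed auto
  show "\<exists>a b. K = {a..b}" if "K \<in> ?C" for K using that by auto
qed

text \<open>
  Uniqueness is local: \<open>S\<close> is a countable union of compact intervals, and on each of them the difference
  has vanishing integral over all subintervals.
\<close>

theorem weak_deriv_unique:
  assumes g: "is_weak_deriv k S f g" and g': "is_weak_deriv k S f g'" and S: "open S"
  shows "AE x in lebesgue_on S. g x = g' x"
proof -
  obtain C where C: "countable C" "S = \<Union>C" "\<And>K. K \<in> C \<Longrightarrow> \<exists>a b. K = {a..b}"
    using open_countable_union_Icc[OF S] by blast
  have S': "S \<in> sets lebesgue" using S by auto
  have "AE x in lebesgue. x \<in> K \<longrightarrow> g x = g' x" if "K \<in> C" for K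
  proof -
    obtain a b where K: "K = {a..b}" using C(3)[OF \<open>K \<in> C\<close>] by blast
    have sub: "{\<alpha>..b} \<subseteq> S" if "a \<le> \<alpha>" for \<alpha> using that C(2) \<open>K \<in> C\<close> K by fastforce
    have "AE x in lebesgue_on {a..b}. g x - g' x = 0"
    proof (rule AE_eq_0_if_interval_integrals_0)
      show "integrable (lebesgue_on {a..b}) (\<lambda>x. g x - g' x)"
        using is_weak_deriv_integrable[OF g sub] is_weak_deriv_integrable[OF g' sub] by auto
      fix \<alpha> assume "a \<le> \<alpha>"
      then show "(LINT x|lebesgue_on {\<alpha>..b}. g x - g' x) = 0"
        using weak_deriv_integral_unique[OF g g' S' sub]
          is_weak_deriv_integrable[OF g sub] is_weak_deriv_integrable[OF g' sub] by simp
    qed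
    then show ?thesis by (simp add: K AE_restrict_space_iff)
  qed
  then have "AE x in lebesgue. \<forall>K\<in>C. x \<in> K \<longrightarrow> g x = g' x"
    by (intro AE_ball_countable[OF C(1), THEN iffD2] ballI)
  then have "AE x in lebesgue. x \<in> S \<longrightarrow> g x = g' x"
    by eventually_elim (use C(2) in blast)
  then show ?thesis using S' by (simp add: AE_restrict_space_iff)
qed

lemma locally_integrable_measurable:
  assumes g: "locally_integrable S g" and S: "open S"
  shows "g \<in> borel_measurable (lebesgue_on S)"
proof -
  obtain C where C: "countable C" "S = \<Union>C" "\<And>K. K \<in> C \<Longrightarrow> \<exists>a b. K = {a..b}"
    using open_countable_union_Icc[OF S] by blast
  show ?thesis
  proof (rule measurable_piecewise_restrict[OF C(1)])
    show "space (lebesgue_on S) \<subseteq> \<Union>C" using C by simp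
    fix K assume "K \<in> C"
    then obtain a b where K: "K = {a..b}" "{a..b} \<subseteq> S" using C by (metis Union_upper)
    then show "K \<inter> space (lebesgue_on S) \<in> sets (lebesgue_on S)"
      using S by (auto simp: sets_restrict_space)
    have "integrable (lebesgue_on {a..b}) g"
      using g K by (auto simp: locally_integrable_def)
    moreover have "restrict_space (lebesgue_on S) K = lebesgue_on {a..b}"
      using K S by (subst restrict_restrict_space) (auto simp: Int_absorb1)
    ultimately show "g \<in> borel_measurable (restrict_space (lebesgue_on S) K)"
      by (simp add: borel_measurable_integrable)
  qed
qed

lemma is_weak_deriv_weak_deriv:
  assumes "f \<in> sobolev k X S" "i \<le> k"
  shows "is_weak_deriv i S f (weak_deriv i S f)"
proof -
  obtain g where "is_weak_deriv i S f g" using assms unfolding sobolev_def by blast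
  then show ?thesis unfolding weak_deriv_def by (rule someI[of "is_weak_deriv i S f"])
qed

text \<open>
  Membership in the Sobolev space only provides some weak derivative in \<open>L\<^sup>2\<close>; uniqueness transfers this to
  the one selected by \<open>weak_deriv\<close>.
\<close>

lemma weak_deriv_in_L2:
  assumes f: "f \<in> H k S" and i: "i \<le> k" and S: "open S"
  shows "weak_deriv i S f \<in> L2 S"
proof -
  obtain g where g: "g \<in> L2 S" "is_weak_deriv i S f g"
    using f i unfolding sobolev_def by blast
  note wd = is_weak_deriv_weak_deriv[OF f i]
  have m: "weak_deriv i S f \<in> borel_measurable (lebesgue_on S)"
    using wd S by (auto intro: locally_integrable_measurable simp: is_weak_deriv_def)
  have "AE x in lebesgue_on S. (g x)\<^sup>2 = (weak_deriv i S f x)\<^sup>2"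
    using weak_deriv_unique[OF g(2) wd S] by eventually_elim simp
  then have "integrable (lebesgue_on S) (\<lambda>x. (weak_deriv i S f x)\<^sup>2)"
    using g(1) m integrable_cong_AE_imp[of "lebesgue_on S" "\<lambda>x. (g x)\<^sup>2" "\<lambda>x. (weak_deriv i S f x)\<^sup>2"]
    by (auto simp: L2_def)
  then show ?thesis using m by (simp add: L2_def)
qed

text \<open>
  With the cutoffs \<open>\<phi>\<^sub>n\<close>, the definition reads \<open>\<integral> f \<phi>\<^sub>n' = - \<integral> g \<phi>\<^sub>n\<close>, and the right-hand side tends to
  \<open>- \<integral> g\<close>. The left-hand side tends to \<open>f \<alpha> - f \<beta>\<close>: for polynomials this is integration by parts, and the
  uniform bound on \<open>\<integral> \<bar>\<phi>\<^sub>n'\<bar>\<close> extends it to their uniform limits, that is, to all continuous functions.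
\<close>

theorem weak_deriv_FTC:
  assumes wd: "is_weak_deriv 1 S f g" and S: "S \<in> sets lebesgue" "{\<alpha>..\<beta>} \<subseteq> S"
    and "\<alpha> \<le> \<beta>" and f: "continuous_on {\<alpha>..\<beta>} f"
  shows "f \<beta> - f \<alpha> = (LINT x|lebesgue_on {\<alpha>..\<beta>}. g x)"
proof (cases "\<alpha> = \<beta>")
  case True
  have "(LINT x|lebesgue_on {\<alpha>..\<beta>}. g x) = integral {\<alpha>..\<beta>} g"
    by (rule lebesgue_integral_eq_integral[OF is_weak_deriv_integrable(2)[OF wd S(2)]]) simp
  then show ?thesis using True by simp
next
  case False
  with \<open>\<alpha> \<le> \<beta>\<close> have "\<alpha> < \<beta>" by simp
  let ?M = "lebesgue_on {\<alpha>..\<beta>}"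
  let ?\<phi> = "\<lambda>n. cutoff n \<alpha> \<beta>"
  have lim: "(\<lambda>n. LINT x|?M. f x * deriv (?\<phi> n) x) \<longlonglongrightarrow> f \<alpha> - f \<beta>"
  proof (rule LIMSEQ_I)
    fix \<epsilon> :: real assume "\<epsilon> > 0"
    \<comment> \<open>With \<open>\<epsilon> / 8\<close>, the error on the left is at most \<open>2 \<epsilon> / 8\<close> because \<open>\<integral> \<bar>\<phi>\<^sub>n'\<bar> \<le> 2\<close>, and the errors
        at \<open>\<alpha>\<close> and \<open>\<beta>\<close> add another \<open>2 \<epsilon> / 8\<close>; \<open>\<epsilon> / 4\<close> is left for the limit.\<close>
    obtain P where P: "real_polynomial_function P" "\<And>x. x \<in> {\<alpha>..\<beta>} \<Longrightarrow> \<bar>f x - P x\<bar> < \<epsilon> / 8"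
      using Stone_Weierstrass_real_polynomial_function[OF _ f, of "\<epsilon> / 8"] \<open>\<epsilon> > 0\<close> by auto
    obtain P' where P': "real_polynomial_function P'" "\<And>x. (P has_real_derivative P' x) (at x)"
      using has_real_derivative_polynomial_function[OF P(1)] by blast
    have cP: "continuous_on {\<alpha>..\<beta>} P" "continuous_on {\<alpha>..\<beta>} P'"
      using P(1) P'(1) by (auto intro: continuous_on_polymonial_function simp: real_polynomial_function_eq)
    have iP': "(LINT x|?M. P' x) = P \<beta> - P \<alpha>"
    proof -
      have "(LINT x|?M. P' x) = integral {\<alpha>..\<beta>} P'"
        using cP by (intro lebesgue_integral_eq_integral continuous_imp_integrable_real) auto
      also have "\<dots> = P \<beta> - P \<alpha>"
        using P'(2) \<open>\<alpha> \<le> \<beta>\<close> by (intro integral_unique fundamental_theorem_of_calculus)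
          (auto simp: has_real_derivative_iff_has_vector_derivative[symmetric] intro: DERIV_subset)
      finally show ?thesis .
    qed
    have parts: "(LINT x|?M. P x * deriv (?\<phi> n) x) = - (LINT x|?M. P' x * ?\<phi> n x)" for n
    proof -
      have "((\<lambda>x. P x * deriv (?\<phi> n) x + P' x * ?\<phi> n x) has_integral
          P \<beta> * ?\<phi> n \<beta> - P \<alpha> * ?\<phi> n \<alpha>) {\<alpha>..\<beta>}"
      proof (rule fundamental_theorem_of_calculus[OF \<open>\<alpha> \<le> \<beta>\<close>, where f = "\<lambda>x. P x * ?\<phi> n x"])
        fix x
        have "((\<lambda>x. P x * ?\<phi> n x) has_real_derivative
            P x * deriv (?\<phi> n) x + P' x * ?\<phi> n x) (at x)"
          by (rule DERIV_mult[OF P'(2) has_real_derivative_cutoff, THEN DERIV_cong])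
            (simp add: mult.commute)
        then show "((\<lambda>x. P x * ?\<phi> n x) has_vector_derivative
            P x * deriv (?\<phi> n) x + P' x * ?\<phi> n x) (at x within {\<alpha>..\<beta>})"
          by (simp only: has_real_derivative_iff_has_vector_derivative has_vector_derivative_at_within)
      qed
      then have "integral {\<alpha>..\<beta>} (\<lambda>x. P x * deriv (?\<phi> n) x + P' x * ?\<phi> n x) = 0"
        by (simp add: cutoff_eq_0 integral_unique)
      moreover have "continuous_on {\<alpha>..\<beta>} (\<lambda>x. P x * deriv (?\<phi> n) x)"
        "continuous_on {\<alpha>..\<beta>} (\<lambda>x. P' x * ?\<phi> n x)"
        by (intro continuous_intros cP continuous_on_cutoff continuous_on_deriv_cutoff)+
      then have int: "integrable ?M (\<lambda>x. P x * deriv (?\<phi> n) x)" "integrable ?M (\<lambda>x. P' x * ?\<phi> n x)"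
        by (auto intro: continuous_imp_integrable_real)
      ultimately show ?thesis
        using lebesgue_integral_eq_integral[OF Bochner_Integration.integrable_add[OF int]] int by simp
    qed
    have "(\<lambda>n. LINT x|?M. P x * deriv (?\<phi> n) x) \<longlonglongrightarrow> - (P \<beta> - P \<alpha>)"
      unfolding parts iP'[symmetric]
      by (intro tendsto_minus LINT_cutoff_tendsto continuous_imp_integrable_real cP)
    from LIMSEQ_D[OF this divide_pos_pos[OF \<open>\<epsilon> > 0\<close> zero_less_numeral, of "num.Bit0 (num.Bit0 num.One)"]]
    obtain N where
      N: "\<And>n. n \<ge> N \<Longrightarrow> \<bar>(LINT x|?M. P x * deriv (?\<phi> n) x) - - (P \<beta> - P \<alpha>)\<bar> < \<epsilon> / 4"
      by (auto simp only: real_norm_def)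
    have near: "\<bar>(LINT x|?M. f x * deriv (?\<phi> n) x) - (LINT x|?M. P x * deriv (?\<phi> n) x)\<bar> \<le> \<epsilon> / 4" for n
    proof -
      have cd: "continuous_on {\<alpha>..\<beta>} (\<lambda>x. f x * deriv (?\<phi> n) x)"
        "continuous_on {\<alpha>..\<beta>} (\<lambda>x. P x * deriv (?\<phi> n) x)"
        "continuous_on {\<alpha>..\<beta>} (\<lambda>x. \<bar>deriv (?\<phi> n) x\<bar>)"
        by (intro continuous_intros cP f continuous_on_deriv_cutoff)+
      note int = cd[THEN continuous_imp_integrable_real]
      have "\<bar>(LINT x|?M. f x * deriv (?\<phi> n) x) - (LINT x|?M. P x * deriv (?\<phi> n) x)\<bar>
          = \<bar>LINT x|?M. f x * deriv (?\<phi> n) x - P x * deriv (?\<phi> n) x\<bar>"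
        using int by simp
      also have "\<dots> \<le> (LINT x|?M. \<bar>f x * deriv (?\<phi> n) x - P x * deriv (?\<phi> n) x\<bar>)"
        by (rule integral_abs_bound)
      also have "\<dots> \<le> (LINT x|?M. \<epsilon> / 8 * \<bar>deriv (?\<phi> n) x\<bar>)"
      proof (rule integral_mono)
        show "\<bar>f x * deriv (?\<phi> n) x - P x * deriv (?\<phi> n) x\<bar> \<le> \<epsilon> / 8 * \<bar>deriv (?\<phi> n) x\<bar>"
          if "x \<in> space ?M" for x
          using P(2)[of x] that
          unfolding left_diff_distrib[symmetric] abs_mult by (intro mult_right_mono) auto
      qed (use int in auto)
      also have "\<dots> = \<epsilon> / 8 * integral {\<alpha>..\<beta>} (\<lambda>x. \<bar>deriv (?\<phi> n) x\<bar>)"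
        using int(3) by (simp add: lebesgue_integral_eq_integral)
      also have "\<dots> \<le> \<epsilon> / 8 * 2"
        using cutoff_variation[OF \<open>\<alpha> \<le> \<beta>\<close>] \<open>\<epsilon> > 0\<close> by (intro mult_left_mono) auto
      finally show ?thesis by simp
    qed
    show "\<exists>N. \<forall>n\<ge>N. norm ((LINT x|?M. f x * deriv (?\<phi> n) x) - (f \<alpha> - f \<beta>)) < \<epsilon>"
    proof (intro exI allI impI)
      fix n assume "n \<ge> N"
      have "\<bar>f \<alpha> - P \<alpha>\<bar> < \<epsilon> / 8" "\<bar>f \<beta> - P \<beta>\<bar> < \<epsilon> / 8"
        using P(2) \<open>\<alpha> \<le> \<beta>\<close> by auto
      then show "norm ((LINT x|?M. f x * deriv (?\<phi> n) x) - (f \<alpha> - f \<beta>)) < \<epsilon>"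
        using N[OF \<open>n \<ge> N\<close>] near[of n] unfolding real_norm_def by linarith
    qed
  qed
  have "(LINT x|?M. f x * deriv (?\<phi> n) x) = - (LINT x|?M. g x * ?\<phi> n x)" for n
    using is_weak_deriv_cutoff[OF wd S, of n] by simp
  with lim have "(\<lambda>n. - (LINT x|?M. g x * ?\<phi> n x)) \<longlonglongrightarrow> f \<alpha> - f \<beta>" by simp
  moreover have "(\<lambda>n. - (LINT x|?M. g x * ?\<phi> n x)) \<longlonglongrightarrow> - (LINT x|?M. g x)"
    by (intro tendsto_minus LINT_cutoff_tendsto is_weak_deriv_integrable[OF wd S(2)])
  ultimately have "f \<alpha> - f \<beta> = - (LINT x|?M. g x)" by (rule LIMSEQ_unique)
  then show ?thesis by simp
qed

lemma integrable_mult_test_function: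
  assumes f: "locally_integrable S f" and \<phi>: "\<phi> \<in> test_functions S" and S: "S \<in> sets lebesgue"
  shows "integrable (lebesgue_on S) (\<lambda>x. f x * (deriv ^^ k) \<phi> x)"
proof -
  obtain K where K: "compact K" "K \<subseteq> S" "\<And>x. x \<notin> K \<Longrightarrow> \<phi> x = 0"
    and d: "\<And>n x. (deriv ^^ n) \<phi> field_differentiable at x"
    using \<phi> by (auto simp: test_functions_def)
  have Ks: "K \<in> sets lebesgue" using K(1) by (simp add: lmeasurable_compact fmeasurableD)
  have out: "(deriv ^^ k) \<phi> x = 0" if "x \<notin> K" for x
    by (rule deriv_funpow_eq_0_outside[OF compact_imp_closed[OF K(1)] K(3) that])
  have c: "continuous_on K ((deriv ^^ k) \<phi>)"
    using d field_differentiable_imp_continuous_at by (intro continuous_at_imp_continuous_on) blast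
  have fK: "integrable (lebesgue_on K) f" using f K by (simp add: locally_integrable_def)
  obtain B where B: "\<And>x. x \<in> K \<Longrightarrow> \<bar>(deriv ^^ k) \<phi> x\<bar> \<le> B"
    using compact_imp_bounded[OF compact_continuous_image[OF c K(1)]] by (auto simp: bounded_iff)
  have "integrable (lebesgue_on K) (\<lambda>x. f x * (deriv ^^ k) \<phi> x)"
  proof (rule Bochner_Integration.integrable_bound)
    show "integrable (lebesgue_on K) (\<lambda>x. B * f x)" using fK by simp
    show "(\<lambda>x. f x * (deriv ^^ k) \<phi> x) \<in> borel_measurable (lebesgue_on K)"
      by (intro borel_measurable_times borel_measurable_integrable[OF fK]
          continuous_imp_measurable_on_sets_lebesgue c Ks)
    show "AE x in lebesgue_on K. norm (f x * (deriv ^^ k) \<phi> x) \<le> norm (B * f x)"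
    proof (rule AE_I2)
      fix x assume "x \<in> space (lebesgue_on K)"
      then have "\<bar>(deriv ^^ k) \<phi> x\<bar> \<le> \<bar>B\<bar>" using B[of x] by simp
      then have "\<bar>f x\<bar> * \<bar>(deriv ^^ k) \<phi> x\<bar> \<le> \<bar>f x\<bar> * \<bar>B\<bar>" by (intro mult_left_mono) auto
      then show "norm (f x * (deriv ^^ k) \<phi> x) \<le> norm (B * f x)" by (simp add: abs_mult mult.commute)
    qed
  qed
  then show ?thesis
    using integrable_restrict_support[OF S Ks K(2)] out by simp
qed

lemma is_weak_deriv_diff:
  assumes f: "is_weak_deriv k S f f'" and g: "is_weak_deriv k S g g'" and S: "S \<in> sets lebesgue"
  shows "is_weak_deriv k S (\<lambda>x. f x - g x) (\<lambda>x. f' x - g' x)"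
proof -
  have li: "locally_integrable S f" "locally_integrable S g" "locally_integrable S f'" "locally_integrable S g'"
    using f g by (auto simp: is_weak_deriv_def)
  show ?thesis
    unfolding is_weak_deriv_def
  proof (intro conjI ballI)
    show "locally_integrable S (\<lambda>x. f x - g x)" "locally_integrable S (\<lambda>x. f' x - g' x)"
      using li by (auto simp: locally_integrable_def)
    fix \<phi> assume \<phi>: "\<phi> \<in> test_functions S"
    note i = integrable_mult_test_function[OF _ \<phi> S]
    have "(LINT x|lebesgue_on S. f x * (deriv ^^ k) \<phi> x) = (-1) ^ k * (LINT x|lebesgue_on S. f' x * \<phi> x)"
      "(LINT x|lebesgue_on S. g x * (deriv ^^ k) \<phi> x) = (-1) ^ k * (LINT x|lebesgue_on S. g' x * \<phi> x)"
      using f g \<phi> by (auto simp: is_weak_deriv_def)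
    then show "(LINT x|lebesgue_on S. (f x - g x) * (deriv ^^ k) \<phi> x)
        = (-1) ^ k * (LINT x|lebesgue_on S. (f' x - g' x) * \<phi> x)"
      using i[OF li(1), of k] i[OF li(2), of k] i[OF li(3), of 0] i[OF li(4), of 0]
      by (simp add: left_diff_distrib right_diff_distrib)
  qed
qed

lemma H_diff:
  assumes f: "f \<in> H k S" and g: "g \<in> H k S" and S: "S \<in> sets lebesgue"
  shows "(\<lambda>x. f x - g x) \<in> H k S"
  unfolding sobolev_def
proof clarify
  fix i assume "i \<le> k"
  then obtain f' g' where "f' \<in> L2 S" "is_weak_deriv i S f f'" "g' \<in> L2 S" "is_weak_deriv i S g g'"
    using f g unfolding sobolev_def by blast
  then show "\<exists>h\<in>L2 S. is_weak_deriv i S (\<lambda>x. f x - g x) h"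
    using is_weak_deriv_diff[OF _ _ S] L2_diff by blast
qed

section \<open>Absolutely continuous functions\<close>

text \<open>
  Absolute continuity in integrated form: \<open>f\<close> is absolutely continuous on \<open>[a, b]\<close>, and \<open>f'\<close> is a version of
  its derivative.
\<close>

definition AC_on :: "real \<Rightarrow> real \<Rightarrow> (real \<Rightarrow> real) \<Rightarrow> (real \<Rightarrow> real) \<Rightarrow> bool" where
  "AC_on a b f f' \<longleftrightarrow> f' absolutely_integrable_on {a..b} \<and>
     (\<forall>x\<in>{a..b}. f x = f a + integral {a..x} f')"

lemma AC_on_absolutely_integrable: "AC_on a b f f' \<Longrightarrow> f' absolutely_integrable_on {a..b}"
  by (simp add: AC_on_def)

lemma AC_on_integrable:
  assumes "AC_on a b f f'" "a \<le> c" "d \<le> b"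
  shows "f' integrable_on {c..d}"
proof (rule integrable_on_subinterval)
  show "f' integrable_on {a..b}"
    using assms by (simp add: AC_on_def set_lebesgue_integral_eq_integral)
qed (use assms in auto)

lemma AC_on_continuous:
  assumes "AC_on a b f f'"
  shows "continuous_on {a..b} f"
proof -
  have "continuous_on {a..b} (\<lambda>x. f a + integral {a..x} f')"
    using AC_on_integrable[OF assms order_refl order_refl]
    by (intro continuous_on_add continuous_on_const indefinite_integral_continuous_1)
  then show ?thesis
    by (rule continuous_on_eq) (use assms in \<open>unfold AC_on_def, metis\<close>)
qed

lemma AC_on_FTC:
  assumes f: "AC_on a b f f'" and "a \<le> c" "c \<le> d" "d \<le> b"
  shows "integral {c..d} f' = f d - f c"
proof -
  have "integral {a..c} f' + integral {c..d} f' = integral {a..d} f'"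
    using assms by (intro Henstock_Kurzweil_Integration.integral_combine AC_on_integrable[OF f]) auto
  moreover have "f c = f a + integral {a..c} f'" "f d = f a + integral {a..d} f'"
    using assms unfolding AC_on_def by (meson atLeastAtMost_iff order_trans)+
  ultimately show ?thesis by linarith
qed

lemma AC_on_diff:
  assumes f: "AC_on a b f f'" and g: "AC_on a b g g'"
  shows "AC_on a b (\<lambda>x. f x - g x) (\<lambda>x. f' x - g' x)"
  unfolding AC_on_def
proof (intro conjI ballI)
  show "(\<lambda>x. f' x - g' x) absolutely_integrable_on {a..b}"
    using f g by (intro set_integral_diff AC_on_absolutely_integrable)
  fix x assume x: "x \<in> {a..b}"
  have "integral {a..x} (\<lambda>x. f' x - g' x) = integral {a..x} f' - integral {a..x} g'"
    using x by (intro Henstock_Kurzweil_Integration.integral_diff AC_on_integrable[OF f] AC_on_integrable[OF g]) auto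
  moreover have "f x = f a + integral {a..x} f'" "g x = g a + integral {a..x} g'"
    using f g x unfolding AC_on_def by blast+
  ultimately show "f x - g x = f a - g a + integral {a..x} (\<lambda>x. f' x - g' x)" by linarith
qed

lemma AC_on_translate: "AC_on a b (\<lambda>x. x + c) (\<lambda>x. 1)"
  by (auto simp: AC_on_def)

lemma absolutely_integrable_continuous_mult:
  fixes f g :: "real \<Rightarrow> real"
  assumes "continuous_on {a..b} f" "g absolutely_integrable_on {a..b}"
  shows "(\<lambda>x. f x * g x) absolutely_integrable_on {a..b}"
  using assms
  by (intro absolutely_integrable_bounded_measurable_product_real continuous_imp_measurable_on_sets_lebesgue
      compact_imp_bounded compact_continuous_image) auto

text \<open>
  The defect \<open>f g - \<integral> (f' g + f g')\<close> is an additive interval function. On \<open>[c, d]\<close> it equals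
  \<open>\<integral> f'(s) (g(d) - g(s)) ds + \<integral> g'(s) (f(c) - f(s)) ds\<close>, so on short intervals it is at most \<open>\<epsilon>\<close> times the
  integral of \<open>\<bar>f'\<bar> + \<bar>g'\<bar>\<close>. Bolzano's subdivision principle transfers this bound to long intervals, for every
  \<open>\<epsilon> > 0\<close>.
\<close>

theorem AC_on_mult:
  assumes f: "AC_on a b f f'" and g: "AC_on a b g g'"
  shows "AC_on a b (\<lambda>x. f x * g x) (\<lambda>x. f' x * g x + f x * g' x)"
proof -
  let ?h = "\<lambda>x. f' x * g x + f x * g' x"
  let ?k = "\<lambda>x. \<bar>f' x\<bar> + \<bar>g' x\<bar>"
  note cf = AC_on_continuous[OF f] and cg = AC_on_continuous[OF g]
  have fg: "(\<lambda>x. f x * g' x) absolutely_integrable_on {a..b}"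
    "(\<lambda>x. f' x * g x) absolutely_integrable_on {a..b}"
    using absolutely_integrable_continuous_mult[OF cf AC_on_absolutely_integrable[OF g]]
      absolutely_integrable_continuous_mult[OF cg AC_on_absolutely_integrable[OF f]]
    by (simp_all add: mult.commute)
  then have h: "?h absolutely_integrable_on {a..b}" by (intro set_integral_add)
  have k: "?k integrable_on {a..b}"
    using f g by (intro Henstock_Kurzweil_Integration.integrable_add) (auto simp: AC_on_def absolutely_integrable_on_def)
  have sub: "F integrable_on {c..d}" if "F integrable_on {a..b}" "a \<le> c" "d \<le> b" for F :: "real \<Rightarrow> real" and c d
    by (rule integrable_on_subinterval[OF that(1)]) (use that in auto)
  have hk: "?h integrable_on {c..d}" "?k integrable_on {c..d}"
    "(\<lambda>x. f' x * g x) integrable_on {c..d}" "(\<lambda>x. f x * g' x) integrable_on {c..d}"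
    if "a \<le> c" "d \<le> b" for c d
    using that h k fg by - (rule sub; simp add: set_lebesgue_integral_eq_integral)+
  have est: "\<bar>f d * g d - f c * g c - integral {c..d} ?h\<bar> \<le> \<epsilon> * integral {c..d} ?k"
    if cd: "a \<le> c" "c \<le> d" "d \<le> b"
      and small: "\<And>s. s \<in> {c..d} \<Longrightarrow> \<bar>g d - g s\<bar> \<le> \<epsilon>" "\<And>s. s \<in> {c..d} \<Longrightarrow> \<bar>f c - f s\<bar> \<le> \<epsilon>" for c d \<epsilon>
  proof -
    have f': "((\<lambda>s. g d * f' s) has_integral g d * (f d - f c)) {c..d}"
      using AC_on_FTC[OF f cd] AC_on_integrable[OF f cd(1,3)]
      by (intro has_integral_mult_right) (simp add: has_integral_iff)
    have g': "((\<lambda>s. f c * g' s) has_integral f c * (g d - g c)) {c..d}"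
      using AC_on_FTC[OF g cd] AC_on_integrable[OF g cd(1,3)]
      by (intro has_integral_mult_right) (simp add: has_integral_iff)
    have "((\<lambda>s. (g d * f' s + f c * g' s) - ?h s) has_integral
        (g d * (f d - f c) + f c * (g d - g c)) - integral {c..d} ?h) {c..d}"
      by (intro has_integral_diff has_integral_add f' g' integrable_integral hk cd)
    then have "((\<lambda>s. (g d - g s) * f' s + (f c - f s) * g' s) has_integral
        f d * g d - f c * g c - integral {c..d} ?h) {c..d}"
      by (simp add: algebra_simps)
    moreover have "((\<lambda>s. \<epsilon> * ?k s) has_integral \<epsilon> * integral {c..d} ?k) {c..d}"
      by (intro has_integral_mult_right integrable_integral hk cd)
    moreover have "\<bar>(g d - g s) * f' s + (f c - f s) * g' s\<bar> \<le> \<epsilon> * ?k s" if "s \<in> {c..d}" for s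
    proof -
      have "\<bar>(g d - g s) * f' s\<bar> \<le> \<epsilon> * \<bar>f' s\<bar>" "\<bar>(f c - f s) * g' s\<bar> \<le> \<epsilon> * \<bar>g' s\<bar>"
        unfolding abs_mult using small[OF that] by (auto intro!: mult_right_mono)
      then show ?thesis by (simp add: distrib_left)
    qed
    ultimately show ?thesis
      using integral_norm_bound_integral[of "\<lambda>s. (g d - g s) * f' s + (f c - f s) * g' s" "{c..d}" "\<lambda>s. \<epsilon> * ?k s"]
      by (simp add: has_integral_iff)
  qed
  have "f x * g x = f a * g a + integral {a..x} ?h" if x: "x \<in> {a..b}" for x
  proof -
    have bound: "\<bar>f x * g x - f a * g a - integral {a..x} ?h\<bar> \<le> \<epsilon> * integral {a..x} ?k" if "\<epsilon> > 0" for \<epsilon>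
    proof -
      \<comment> \<open>The guard keeps all intervals inside \<open>[a, x]\<close>, where the integrals are additive.\<close>
      define P where "P u v \<longleftrightarrow> (a \<le> u \<and> v \<le> x \<longrightarrow>
        \<bar>f v * g v - f u * g u - integral {u..v} ?h\<bar> \<le> \<epsilon> * integral {u..v} ?k)" for u v
      have "a \<le> x" using x by simp
      then have "P a x"
      proof (rule Bolzano)
        fix u v w assume uv: "P u v" "P v w" "u \<le> v" "v \<le> w"
        show "P u w"
          unfolding P_def
        proof
          assume uw: "a \<le> u \<and> w \<le> x"
          then have i: "integral {u..v} ?h + integral {v..w} ?h = integral {u..w} ?h"
            "integral {u..v} ?k + integral {v..w} ?k = integral {u..w} ?k"
            using uv x by (intro Henstock_Kurzweil_Integration.integral_combine hk; simp)+
          then show "\<bar>f w * g w - f u * g u - integral {u..w} ?h\<bar> \<le> \<epsilon> * integral {u..w} ?k"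
            using uv uw unfolding P_def i[symmetric] distrib_left by linarith
        qed
      next
        fix y assume y: "a \<le> y" "y \<le> x"
        have "\<epsilon> / 2 > 0" using \<open>\<epsilon> > 0\<close> by simp
        then obtain d1 where d1: "d1 > 0" "\<And>s. s \<in> {a..b} \<Longrightarrow> dist s y < d1 \<Longrightarrow> dist (f s) (f y) < \<epsilon> / 2"
          using cf x y unfolding continuous_on_iff by (metis atLeastAtMost_iff order_trans)
        obtain d2 where d2: "d2 > 0" "\<And>s. s \<in> {a..b} \<Longrightarrow> dist s y < d2 \<Longrightarrow> dist (g s) (g y) < \<epsilon> / 2"
          using cg x y \<open>\<epsilon> / 2 > 0\<close> unfolding continuous_on_iff by (metis atLeastAtMost_iff order_trans)
        show "\<exists>d>0. \<forall>u v. u \<le> y \<and> y \<le> v \<and> v - u < d \<longrightarrow> P u v"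
        proof (intro exI conjI allI impI)
          show "min d1 d2 > 0" using d1 d2 by simp
          fix u v assume uv: "u \<le> y \<and> y \<le> v \<and> v - u < min d1 d2"
          show "P u v"
            unfolding P_def
          proof
            assume uv': "a \<le> u \<and> v \<le> x"
            have s: "\<bar>f s - f y\<bar> < \<epsilon> / 2" "\<bar>g s - g y\<bar> < \<epsilon> / 2" if "s \<in> {u..v}" for s
              using d1(2)[of s] d2(2)[of s] that uv uv' x by (auto simp: dist_real_def)
            show "\<bar>f v * g v - f u * g u - integral {u..v} ?h\<bar> \<le> \<epsilon> * integral {u..v} ?k"
            proof (rule est)
              have "u \<in> {u..v}" "v \<in> {u..v}" using uv by auto
              note s' = this[THEN s(1)] this[THEN s(2)]
              fix z assume z: "z \<in> {u..v}"
              show "\<bar>g v - g z\<bar> \<le> \<epsilon>" using s(2)[OF z] s' by linarith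
              show "\<bar>f u - f z\<bar> \<le> \<epsilon>" using s(1)[OF z] s' by linarith
            qed (use uv uv' x in auto)
          qed
        qed
      qed
      then show ?thesis by (simp add: P_def)
    qed
    have lim: "((\<lambda>\<epsilon>. \<epsilon> * integral {a..x} ?k) \<longlongrightarrow> 0 * integral {a..x} ?k) (at_right 0)"
      by (intro tendsto_mult tendsto_ident_at tendsto_const)
    have "\<bar>f x * g x - f a * g a - integral {a..x} ?h\<bar> \<le> 0 * integral {a..x} ?k"
    proof (rule tendsto_lowerbound[OF lim])
      show "\<forall>\<^sub>F \<epsilon> in at_right 0. \<bar>f x * g x - f a * g a - integral {a..x} ?h\<bar> \<le> \<epsilon> * integral {a..x} ?k"
        using eventually_at_right_less[of "0 :: real"] by eventually_elim (rule bound)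
    qed (rule trivial_limit_at_right_real)
    then show ?thesis by simp
  qed
  then show ?thesis using h unfolding AC_on_def by blast
qed

lemma AC_on_pointwise_bound:
  assumes f: "AC_on 0 1 f f'" and x: "x \<in> {0..1}" and y: "y \<in> {0..1}"
  shows "\<bar>f x\<bar> \<le> \<bar>f y\<bar> + integral {0..1} (\<lambda>x. \<bar>f' x\<bar>)"
proof -
  have i: "f' integrable_on {c..d}" "(\<lambda>x. \<bar>f' x\<bar>) integrable_on {c..d}" if "0 \<le> c" "d \<le> 1" for c d
    using f that
    by - (rule integrable_on_subinterval[of _ "{0..1}"]; simp add: AC_on_def absolutely_integrable_on_def)+
  have *: "\<bar>f d - f c\<bar> \<le> integral {0..1} (\<lambda>x. \<bar>f' x\<bar>)" if "0 \<le> c" "c \<le> d" "d \<le> 1" for c d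
  proof -
    have "\<bar>f d - f c\<bar> = \<bar>integral {c..d} f'\<bar>" using AC_on_FTC[OF f that] by simp
    also have "\<dots> \<le> integral {c..d} (\<lambda>x. \<bar>f' x\<bar>)"
      using integral_norm_bound_integral[OF i(1,2)[OF that(1,3)]] by simp
    also have "\<dots> \<le> integral {0..1} (\<lambda>x. \<bar>f' x\<bar>)"
      using that by (intro integral_subset_le i) auto
    finally show ?thesis .
  qed
  show ?thesis
    using *[of x y] *[of y x] x y by (cases "x \<le> y") auto
qed

lemma LINT_Ioo:
  fixes h :: "real \<Rightarrow> real"
  assumes "h absolutely_integrable_on {a..b}"
  shows "(LINT x|lebesgue_on {a<..<b}. h x) = integral {a..b} h" "integrable (lebesgue_on {a<..<b}) h"
proof -
  have "h absolutely_integrable_on {a<..<b}"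
    using assms absolutely_integrable_on_open_interval[of a b h] by simp
  then show i: "integrable (lebesgue_on {a<..<b}) h"
    by (intro absolutely_integrable_imp_integrable) auto
  show "(LINT x|lebesgue_on {a<..<b}. h x) = integral {a..b} h"
    using lebesgue_integral_eq_integral[OF i] integral_open_interval_real[of a b h] by simp
qed

lemma integrable_imp_absolutely_integrable_Icc:
  fixes h :: "real \<Rightarrow> real"
  assumes "integrable (lebesgue_on {a<..<b}) h"
  shows "h absolutely_integrable_on {a..b}"
  using assms absolutely_integrable_on_open_interval[of a b h]
  by (simp add: set_integrable_def integrable_restrict_space)

lemma integrable_continuous_Ioo:
  assumes "continuous_on {a..b} (f :: real \<Rightarrow> real)"
  shows "integrable (lebesgue_on {a<..<b}) f"
  by (intro LINT_Ioo(2) absolutely_integrable_continuous_real assms)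

lemma continuous_in_L2_Ioo:
  assumes "continuous_on {a..b} (f :: real \<Rightarrow> real)"
  shows "f \<in> L2 {a<..<b}"
  using integrable_continuous_Ioo[OF assms] integrable_continuous_Ioo[of a b "\<lambda>x. (f x)\<^sup>2"] assms
  by (auto simp: L2_def intro!: continuous_intros borel_measurable_integrable)

lemma LINT_unit_const: "(LINT x|lebesgue_on {0<..<1::real}. c) = (c :: real)"
  by (simp add: measure_restrict_space)

lemma LINT_AC_on:
  assumes "AC_on 0 1 f f'"
  shows "(LINT x|lebesgue_on {0<..<1}. f' x) = f 1 - f 0" "integrable (lebesgue_on {0<..<1}) f'"
  using LINT_Ioo[OF AC_on_absolutely_integrable[OF assms]] AC_on_FTC[OF assms, of 0 1]
  by simp_all

lemma L2_imp_integrable: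
  assumes f: "f \<in> L2 S" and S: "S \<in> lmeasurable"
  shows "integrable (lebesgue_on S) f"
proof -
  interpret finite_measure "lebesgue_on S" by (rule finite_measure_lebesgue_on[OF S])
  have "(\<lambda>_. 1) \<in> L2 S" by (simp add: L2_def)
  from L2_mult_integrable[OF f this] show ?thesis by simp
qed

text \<open>
  The fundamental theorem for weak derivatives holds on compact subintervals of \<open>(0, 1)\<close>; both sides are
  continuous up to the end points.
\<close>

theorem H1_AC_on:
  assumes f: "f \<in> H 1 {0<..<1}" and c: "continuous_on {0..1} f"
  shows "AC_on 0 1 f (weak_deriv 1 {0<..<1} f)"
proof -
  let ?g = "weak_deriv 1 {0<..<1} f"
  have wd: "is_weak_deriv 1 {0<..<1} f ?g" by (rule is_weak_deriv_weak_deriv[OF f]) simp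
  have "?g \<in> L2 {0<..<1}" by (rule weak_deriv_in_L2[OF f]) auto
  then have g: "?g absolutely_integrable_on {0..1}"
    by (intro integrable_imp_absolutely_integrable_Icc L2_imp_integrable) auto
  then have gi: "?g integrable_on {0..1}" by (simp add: set_lebesgue_integral_eq_integral)
  let ?h = "\<lambda>x. f x - integral {0..x} ?g"
  have ch: "continuous_on {0..1} ?h"
    by (intro continuous_on_diff c indefinite_integral_continuous_1 gi)
  have eq: "?h x = ?h y" if "0 < x" "x \<le> y" "y < 1" for x y
  proof -
    have "f y - f x = (LINT s|lebesgue_on {x..y}. ?g s)"
      using that by (intro weak_deriv_FTC[OF wd] continuous_on_subset[OF c]) auto
    also have "\<dots> = integral {x..y} ?g"
      using that by (intro lebesgue_integral_eq_integral is_weak_deriv_integrable(2)[OF wd]) auto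
    also have "\<dots> = integral {0..y} ?g - integral {0..x} ?g"
    proof -
      have "?g integrable_on {0..y}" by (rule integrable_on_subinterval[OF gi]) (use that in auto)
      then have "integral {0..x} ?g + integral {x..y} ?g = integral {0..y} ?g"
        using that by (intro Henstock_Kurzweil_Integration.integral_combine) auto
      then show ?thesis by linarith
    qed
    finally show ?thesis by linarith
  qed
  have half: "?h x = ?h (1/2)" if "x \<in> {0..1}" for x
  proof (rule continuous_constant_on_closure[of "{0<..<1}" ?h])
    show "continuous_on (closure {0<..<1}) ?h" using ch by simp
    show "x \<in> closure {0<..<1}" using that by simp
    show "?h y = ?h (1/2)" if "y \<in> {0<..<1}" for y
    proof (cases "y \<le> 1/2")
      case True
      show ?thesis by (rule eq) (use True that in auto)
    next
      case False
      show ?thesis by (rule eq[symmetric]) (use False that in auto)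
    qed
  qed
  have "f x = f 0 + integral {0..x} ?g" if "x \<in> {0..1}" for x
  proof -
    have "?h 0 = ?h (1/2)" by (rule half) simp
    then have "?h x = ?h 0" unfolding half[OF that] by (rule sym)
    then show ?thesis by simp
  qed
  then show ?thesis using g unfolding AC_on_def by blast
qed

section \<open>Curves of square integrable functions\<close>

lemma L2_scale: "f \<in> L2 S \<Longrightarrow> (\<lambda>x. c * f x) \<in> L2 S"
  by (auto simp: L2_def power_mult_distrib)

lemma L2_norm_sq: "(L2_norm S f)\<^sup>2 = (LINT x|lebesgue_on S. (f x)\<^sup>2)"
  by (simp add: L2_norm_def)

lemma L2_norm_nonneg [simp]: "0 \<le> L2_norm S f"
  by (simp add: L2_norm_def)

lemma L2_norm_scale: "L2_norm S (\<lambda>x. c * f x) = \<bar>c\<bar> * L2_norm S f"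
  by (simp add: L2_norm_def power_mult_distrib real_sqrt_mult)

lemma L2_norm_triangle_diff:
  assumes "f \<in> L2 S" "g \<in> L2 S"
  shows "L2_norm S (\<lambda>x. f x - g x) \<le> L2_norm S f + L2_norm S g"
  using L2_norm_triangle[OF assms(1) L2_scale[OF assms(2)], of "- 1"] L2_norm_scale[of S "- 1" g]
  by simp

lemma L2_Cauchy_Schwarz:
  assumes f: "f \<in> L2 S" and g: "g \<in> L2 S"
  shows "\<bar>LINT x|lebesgue_on S. f x * g x\<bar> \<le> L2_norm S f * L2_norm S g"
proof -
  have upper: "(LINT x|lebesgue_on S. f x * g x) \<le> L2_norm S f * L2_norm S g" if g: "g \<in> L2 S" for g
  proof -
    note i = f g L2_mult_integrable[OF f g]
    have "(\<lambda>x. (f x + g x)\<^sup>2) = (\<lambda>x. (f x)\<^sup>2 + (g x)\<^sup>2 + 2 * (f x * g x))"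
      by (simp add: power2_sum mult.assoc)
    then have "(L2_norm S (\<lambda>x. f x + g x))\<^sup>2
        = (L2_norm S f)\<^sup>2 + (L2_norm S g)\<^sup>2 + 2 * (LINT x|lebesgue_on S. f x * g x)"
      using i by (simp add: L2_norm_sq L2_def)
    moreover have "(L2_norm S (\<lambda>x. f x + g x))\<^sup>2 \<le> (L2_norm S f + L2_norm S g)\<^sup>2"
      by (intro power_mono L2_norm_triangle f g L2_norm_nonneg)
    ultimately show ?thesis by (simp add: power2_sum)
  qed
  show ?thesis
    using upper[OF g] upper[OF L2_scale[OF g, of "- 1"]] L2_norm_scale[of S "- 1" g]
    by (simp add: abs_le_iff)
qed

lemma L2_norm_mono:
  assumes "f \<in> L2 S" "g \<in> L2 S" "\<And>x. x \<in> S \<Longrightarrow> \<bar>f x\<bar> \<le> \<bar>g x\<bar>"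
  shows "L2_norm S f \<le> L2_norm S g"
  unfolding L2_norm_def
proof (intro real_sqrt_le_mono integral_mono)
  show "integrable (lebesgue_on S) (\<lambda>x. (f x)\<^sup>2)" "integrable (lebesgue_on S) (\<lambda>x. (g x)\<^sup>2)"
    using assms by (auto simp: L2_def)
  show "(f x)\<^sup>2 \<le> (g x)\<^sup>2" if "x \<in> space (lebesgue_on S)" for x
    using assms(3)[of x] that by (simp add: abs_le_square_iff)
qed

lemma L2_difference_quotient:
  assumes "f \<in> L2 S" "g \<in> L2 S"
  shows "(\<lambda>x. (f x - g x) / c) \<in> L2 S"
  using L2_scale[OF L2_diff[OF assms], of "inverse c"] by (simp add: divide_inverse mult.commute)

text \<open>
  Expand \<open>f\<^sub>s g\<^sub>s - f\<^sub>0 g\<^sub>0 = (f\<^sub>s - f\<^sub>0) (g\<^sub>s - g\<^sub>0) + (f\<^sub>s - f\<^sub>0) g\<^sub>0 + f\<^sub>0 (g\<^sub>s - g\<^sub>0)\<close> and apply the Cauchy-Schwarz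
  inequality to each term.
\<close>

lemma L2_inner_tendsto:
  assumes f: "\<forall>\<^sub>F s in F. f s \<in> L2 S" "f0 \<in> L2 S" "((\<lambda>s. L2_norm S (\<lambda>x. f s x - f0 x)) \<longlongrightarrow> 0) F"
    and g: "\<forall>\<^sub>F s in F. g s \<in> L2 S" "g0 \<in> L2 S" "((\<lambda>s. L2_norm S (\<lambda>x. g s x - g0 x)) \<longlongrightarrow> 0) F"
  shows "((\<lambda>s. LINT x|lebesgue_on S. f s x * g s x) \<longlongrightarrow> (LINT x|lebesgue_on S. f0 x * g0 x)) F"
proof -
  let ?n = "L2_norm S" and ?I = "\<lambda>h. LINT x|lebesgue_on S. h x"
  let ?df = "\<lambda>s. ?n (\<lambda>x. f s x - f0 x)" and ?dg = "\<lambda>s. ?n (\<lambda>x. g s x - g0 x)"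
  have "((\<lambda>s. ?I (\<lambda>x. f s x * g s x) - ?I (\<lambda>x. f0 x * g0 x)) \<longlongrightarrow> 0) F"
  proof (rule Lim_null_comparison)
    show "((\<lambda>s. ?df s * ?dg s + ?df s * ?n g0 + ?n f0 * ?dg s) \<longlongrightarrow> 0) F"
      using f(3) g(3) by (auto intro!: tendsto_eq_intros)
    show "\<forall>\<^sub>F s in F. norm (?I (\<lambda>x. f s x * g s x) - ?I (\<lambda>x. f0 x * g0 x))
        \<le> ?df s * ?dg s + ?df s * ?n g0 + ?n f0 * ?dg s"
      using f(1) g(1)
    proof eventually_elim
      case (elim s)
      let ?a = "\<lambda>x. f s x - f0 x" and ?b = "\<lambda>x. g s x - g0 x"
      have ab: "?a \<in> L2 S" "?b \<in> L2 S" using elim f(2) g(2) by (auto intro: L2_diff)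
      note int = L2_mult_integrable[OF ab] L2_mult_integrable[OF ab(1) g(2)]
        L2_mult_integrable[OF f(2) ab(2)]
      have "?I (\<lambda>x. f s x * g s x) - ?I (\<lambda>x. f0 x * g0 x) = ?I (\<lambda>x. f s x * g s x - f0 x * g0 x)"
        by (rule Bochner_Integration.integral_diff[symmetric])
          (intro L2_mult_integrable elim f(2) g(2))+
      also have "(\<lambda>x. f s x * g s x - f0 x * g0 x) = (\<lambda>x. ?a x * ?b x + ?a x * g0 x + f0 x * ?b x)"
        by (simp add: algebra_simps)
      also have "?I \<dots> = ?I (\<lambda>x. ?a x * ?b x) + ?I (\<lambda>x. ?a x * g0 x) + ?I (\<lambda>x. f0 x * ?b x)"
        using int by (simp only: Bochner_Integration.integral_add Bochner_Integration.integrable_add)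
      finally show ?case
        using L2_Cauchy_Schwarz[OF ab] L2_Cauchy_Schwarz[OF ab(1) g(2)] L2_Cauchy_Schwarz[OF f(2) ab(2)]
        unfolding real_norm_def by linarith
    qed
  qed
  then show ?thesis by (simp add: LIM_zero_iff)
qed

text \<open>
  The difference quotient of the inner product is \<open>\<langle>v\<^sub>s, (w\<^sub>s - w\<^sub>t)/(s - t)\<rangle> + \<langle>(v\<^sub>s - v\<^sub>t)/(s - t), w\<^sub>t\<rangle>\<close>.
\<close>

lemma C1_curve_inner_derivative:
  assumes v: "C1_curve (L2 S) (L2_norm S) I v v'" and w: "C1_curve (L2 S) (L2_norm S) I w w'"
    and t: "t \<in> I"
  shows "((\<lambda>s. LINT x|lebesgue_on S. v s x * w s x) has_real_derivative
     (LINT x|lebesgue_on S. v t x * w' t x + v' t x * w t x)) (at t within I)"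
proof -
  let ?I = "\<lambda>h. LINT x|lebesgue_on S. h x"
  have L: "v s \<in> L2 S" "w s \<in> L2 S" "v' s \<in> L2 S" "w' s \<in> L2 S" if "s \<in> I" for s
    using v w that by (auto simp: C1_curve_def C0_curve_def)
  have ev: "\<forall>\<^sub>F s in at t within I. s \<in> I \<and> s \<noteq> t"
    by (auto simp: eventually_at_filter)
  have Ld: "(\<lambda>x. (v s x - v t x) / (s - t)) \<in> L2 S" "(\<lambda>x. (w s x - w t x) / (s - t)) \<in> L2 S" if "s \<in> I" for s
    by (intro L2_difference_quotient L that t)+
  have 1: "((\<lambda>s. ?I (\<lambda>x. v s x * ((w s x - w t x) / (s - t)))) \<longlongrightarrow> ?I (\<lambda>x. v t x * w' t x)) (at t within I)"
    by (rule L2_inner_tendsto)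
      (use v w t L Ld ev in \<open>auto simp: C1_curve_def C0_curve_def elim: eventually_mono\<close>)
  have "((\<lambda>s. L2_norm S (\<lambda>x. w t x - w t x)) \<longlongrightarrow> 0) (at t within I)"
    by (simp add: L2_norm_def)
  then have 2: "((\<lambda>s. ?I (\<lambda>x. (v s x - v t x) / (s - t) * w t x)) \<longlongrightarrow> ?I (\<lambda>x. v' t x * w t x)) (at t within I)"
    by (intro L2_inner_tendsto)
      (use v w t L Ld ev in \<open>auto simp: C1_curve_def C0_curve_def elim: eventually_mono\<close>)
  have D: "?I (\<lambda>x. v t x * w' t x + v' t x * w t x) = ?I (\<lambda>x. v t x * w' t x) + ?I (\<lambda>x. v' t x * w t x)"
    by (intro Bochner_Integration.integral_add L2_mult_integrable L t)
  show ?thesis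
    unfolding has_field_derivative_iff D
  proof (rule Lim_transform_eventually[OF tendsto_add[OF 1 2]])
    show "\<forall>\<^sub>F s in at t within I.
        ?I (\<lambda>x. v s x * ((w s x - w t x) / (s - t))) + ?I (\<lambda>x. (v s x - v t x) / (s - t) * w t x)
        = (?I (\<lambda>x. v s x * w s x) - ?I (\<lambda>x. v t x * w t x)) / (s - t)"
      using ev
    proof eventually_elim
      case (elim s)
      then have s: "s \<in> I" "s \<noteq> t" by auto
      have "?I (\<lambda>x. v s x * ((w s x - w t x) / (s - t))) + ?I (\<lambda>x. (v s x - v t x) / (s - t) * w t x)
          = ?I (\<lambda>x. v s x * ((w s x - w t x) / (s - t)) + (v s x - v t x) / (s - t) * w t x)"
        by (intro Bochner_Integration.integral_add[symmetric] L2_mult_integrable L Ld s t)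
      also have "(\<lambda>x. v s x * ((w s x - w t x) / (s - t)) + (v s x - v t x) / (s - t) * w t x)
          = (\<lambda>x. (v s x * w s x - v t x * w t x) / (s - t))"
        by (simp add: fun_eq_iff add_divide_distrib[symmetric]) (simp add: algebra_simps)
      also have "?I \<dots> = ?I (\<lambda>x. v s x * w s x - v t x * w t x) / (s - t)"
        by simp
      also have "?I (\<lambda>x. v s x * w s x - v t x * w t x) = ?I (\<lambda>x. v s x * w s x) - ?I (\<lambda>x. v t x * w t x)"
        by (intro Bochner_Integration.integral_diff L2_mult_integrable L s t)
      finally show ?case .
    qed
  qed
qed

lemma L2_norm_diff_diff_tendsto:
  assumes "((\<lambda>s. L2_norm S (\<lambda>x. f s x - f0 x)) \<longlongrightarrow> 0) F"
    and "((\<lambda>s. L2_norm S (\<lambda>x. g s x - g0 x)) \<longlongrightarrow> 0) F"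
    and "\<forall>\<^sub>F s in F. f s \<in> L2 S" "f0 \<in> L2 S" "\<forall>\<^sub>F s in F. g s \<in> L2 S" "g0 \<in> L2 S"
  shows "((\<lambda>s. L2_norm S (\<lambda>x. (f s x - g s x) - (f0 x - g0 x))) \<longlongrightarrow> 0) F"
proof (rule Lim_null_comparison)
  show "((\<lambda>s. L2_norm S (\<lambda>x. f s x - f0 x) + L2_norm S (\<lambda>x. g s x - g0 x)) \<longlongrightarrow> 0) F"
    using tendsto_add[OF assms(1,2)] by simp
  show "\<forall>\<^sub>F s in F. norm (L2_norm S (\<lambda>x. (f s x - g s x) - (f0 x - g0 x)))
      \<le> L2_norm S (\<lambda>x. f s x - f0 x) + L2_norm S (\<lambda>x. g s x - g0 x)"
    using assms(3,5)
  proof eventually_elim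
    case (elim s)
    have "(\<lambda>x. (f s x - g s x) - (f0 x - g0 x)) = (\<lambda>x. (f s x - f0 x) - (g s x - g0 x))"
      by (simp add: algebra_simps)
    then show ?case
      using L2_norm_triangle_diff[OF L2_diff[OF elim(1) assms(4)] L2_diff[OF elim(2) assms(6)]]
      by simp
  qed
qed

lemma eventually_at_within_in: "\<forall>\<^sub>F s in at t within I. s \<in> I"
  by (simp add: eventually_at_filter)

lemma C0_curve_L2_diff:
  assumes "C0_curve (L2 S) (L2_norm S) I v" "C0_curve (L2 S) (L2_norm S) I w"
  shows "C0_curve (L2 S) (L2_norm S) I (\<lambda>t x. v t x - w t x)"
  using assms unfolding C0_curve_def
  by (auto intro!: L2_diff L2_norm_diff_diff_tendsto
      intro: eventually_mono[OF eventually_at_within_in])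

lemma C1_curve_L2_diff:
  assumes v: "C1_curve (L2 S) (L2_norm S) I v v'" and w: "C1_curve (L2 S) (L2_norm S) I w w'"
  shows "C1_curve (L2 S) (L2_norm S) I (\<lambda>t x. v t x - w t x) (\<lambda>t x. v' t x - w' t x)"
  unfolding C1_curve_def
proof (intro conjI ballI)
  show "C0_curve (L2 S) (L2_norm S) I (\<lambda>t x. v t x - w t x)"
    "C0_curve (L2 S) (L2_norm S) I (\<lambda>t x. v' t x - w' t x)"
    using v w by (auto simp: C1_curve_def intro: C0_curve_L2_diff)
  fix t assume t: "t \<in> I"
  have L: "v s \<in> L2 S" "w s \<in> L2 S" "v' s \<in> L2 S" "w' s \<in> L2 S" if "s \<in> I" for s
    using v w that by (auto simp: C1_curve_def C0_curve_def)
  have Ld: "(\<lambda>x. (v s x - v t x) / (s - t)) \<in> L2 S" "(\<lambda>x. (w s x - w t x) / (s - t)) \<in> L2 S" if "s \<in> I" for s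
    by (intro L2_difference_quotient L that t)+
  have "(\<lambda>x. (v s x - w s x - (v t x - w t x)) / (s - t) - (v' t x - w' t x))
      = (\<lambda>x. ((v s x - v t x) / (s - t) - (w s x - w t x) / (s - t)) - (v' t x - w' t x))" for s
    by (simp add: diff_divide_distrib[symmetric] algebra_simps)
  then show "((\<lambda>s. L2_norm S (\<lambda>x. (v s x - w s x - (v t x - w t x)) / (s - t) - (v' t x - w' t x))) \<longlongrightarrow> 0)
      (at t within I)"
    using v w t by (auto simp: C1_curve_def L intro!: L2_norm_diff_diff_tendsto
        intro: eventually_mono[OF eventually_at_within_in Ld(1)] eventually_mono[OF eventually_at_within_in Ld(2)])
qed

lemma L2_bounded_mult:
  assumes "m \<in> borel_measurable (lebesgue_on S)" "\<And>x. x \<in> S \<Longrightarrow> \<bar>m x\<bar> \<le> 1" "f \<in> L2 S"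
  shows "(\<lambda>x. m x * f x) \<in> L2 S" "L2_norm S (\<lambda>x. m x * f x) \<le> L2_norm S f"
proof -
  have le: "\<bar>m x * f x\<bar> \<le> \<bar>f x\<bar>" if "x \<in> S" for x
    using assms(2)[OF that] by (simp add: abs_mult mult_left_le_one_le)
  have "integrable (lebesgue_on S) (\<lambda>x. (m x * f x)\<^sup>2)"
    by (rule Bochner_Integration.integrable_bound[of _ "\<lambda>x. (f x)\<^sup>2"])
      (use assms le in \<open>auto simp: L2_def abs_le_square_iff\<close>)
  then show "(\<lambda>x. m x * f x) \<in> L2 S" using assms by (auto simp: L2_def)
  then show "L2_norm S (\<lambda>x. m x * f x) \<le> L2_norm S f"
    using assms(3) le by (rule L2_norm_mono)
qed

lemma C1_curve_bounded_mult:
  assumes m: "m \<in> borel_measurable (lebesgue_on S)" "\<And>x. x \<in> S \<Longrightarrow> \<bar>m x\<bar> \<le> 1"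
    and v: "C1_curve (L2 S) (L2_norm S) I v v'"
  shows "C1_curve (L2 S) (L2_norm S) I (\<lambda>t x. m x * v t x) (\<lambda>t x. m x * v' t x)"
proof -
  have lim: "((\<lambda>s. L2_norm S (\<lambda>x. m x * g s x)) \<longlongrightarrow> 0) (at t within I)"
    if "((\<lambda>s. L2_norm S (g s)) \<longlongrightarrow> 0) (at t within I)" "\<And>s. s \<in> I \<Longrightarrow> g s \<in> L2 S" for g t
    by (rule Lim_null_comparison[OF _ that(1)])
      (auto intro!: eventually_mono[OF eventually_at_within_in] L2_bounded_mult m that(2))
  have L: "v s \<in> L2 S" "v' s \<in> L2 S" if "s \<in> I" for s
    using v that by (auto simp: C1_curve_def C0_curve_def)
  have Ld: "(\<lambda>x. (v s x - v t x) / (s - t) - v' t x) \<in> L2 S" if "s \<in> I" "t \<in> I" for s t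
    by (intro L2_diff L2_difference_quotient L that)
  have C0: "C0_curve (L2 S) (L2_norm S) I (\<lambda>t x. m x * g t x)"
    if g: "C0_curve (L2 S) (L2_norm S) I g" for g
    unfolding C0_curve_def
  proof (intro conjI ballI)
    show "(\<lambda>x. m x * g t x) \<in> L2 S" if "t \<in> I" for t
      using g m that by (auto simp: C0_curve_def intro: L2_bounded_mult)
    show "((\<lambda>s. L2_norm S (\<lambda>x. m x * g s x - m x * g t x)) \<longlongrightarrow> 0) (at t within I)" if t: "t \<in> I" for t
      using lim[of "\<lambda>s x. g s x - g t x" t] g t
      by (simp add: C0_curve_def L2_diff right_diff_distrib)
  qed
  show ?thesis
    unfolding C1_curve_def
  proof (intro conjI ballI)
    show "C0_curve (L2 S) (L2_norm S) I (\<lambda>t x. m x * v t x)"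
      "C0_curve (L2 S) (L2_norm S) I (\<lambda>t x. m x * v' t x)"
      using v by (auto simp: C1_curve_def intro: C0)
    fix t assume t: "t \<in> I"
    have eq: "(\<lambda>x. m x * ((v s x - v t x) / (s - t) - v' t x))
      = (\<lambda>x. (m x * v s x - m x * v t x) / (s - t) - m x * v' t x)" for s
      by (simp add: algebra_simps)
    show "((\<lambda>s. L2_norm S (\<lambda>x. (m x * v s x - m x * v t x) / (s - t) - m x * v' t x)) \<longlongrightarrow> 0)
        (at t within I)"
      using lim[of "\<lambda>s x. (v s x - v t x) / (s - t) - v' t x" t] v t Ld[OF _ t]
      unfolding eq by (simp add: C1_curve_def)
  qed
qed

section \<open>Completeness of the space of square integrable functions\<close>

lemma L2_class_in_space: "f \<in> L2 S \<Longrightarrow> L2_class S f \<in> L2_space S"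
  by (simp add: L2_class_def L2_space_def quotientI)

lemma L2_class_representative:
  assumes "f \<in> L2 S"
  shows "(SOME h. h \<in> L2_class S f) \<in> L2 S"
    and "AE x in lebesgue_on S. (SOME h. h \<in> L2_class S f) x = f x"
proof -
  have "f \<in> L2_class S f"
    using assms by (simp add: L2_class_def L2_rel_def)
  then have "(SOME h. h \<in> L2_class S f) \<in> L2_class S f"
    by (rule someI[of "\<lambda>h. h \<in> L2_class S f"])
  then have h: "(SOME h. h \<in> L2_class S f) \<in> L2 S"
    "AE x in lebesgue_on S. f x = (SOME h. h \<in> L2_class S f) x"
    by (auto simp: L2_class_def L2_rel_def)
  from h(1) show "(SOME h. h \<in> L2_class S f) \<in> L2 S" .
  from h(2) show "AE x in lebesgue_on S. (SOME h. h \<in> L2_class S f) x = f x"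
    by eventually_elim (rule sym)
qed

lemma L2_dist_class:
  assumes f: "f \<in> L2 S" and g: "g \<in> L2 S"
  shows "L2_dist S (L2_class S f) (L2_class S g) = L2_norm S (\<lambda>x. f x - g x)"
proof -
  let ?f = "SOME h. h \<in> L2_class S f" and ?g = "SOME h. h \<in> L2_class S g"
  have "(LINT x|lebesgue_on S. (?f x - ?g x)\<^sup>2) = (LINT x|lebesgue_on S. (f x - g x)\<^sup>2)"
  proof (rule integral_cong_AE)
    show "(\<lambda>x. (?f x - ?g x)\<^sup>2) \<in> borel_measurable (lebesgue_on S)"
      using L2_class_representative(1)[OF f] L2_class_representative(1)[OF g] by (auto simp: L2_def)
    show "(\<lambda>x. (f x - g x)\<^sup>2) \<in> borel_measurable (lebesgue_on S)"
      using f g by (auto simp: L2_def)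
    show "AE x in lebesgue_on S. (?f x - ?g x)\<^sup>2 = (f x - g x)\<^sup>2"
      using L2_class_representative(2)[OF f] L2_class_representative(2)[OF g]
      by eventually_elim simp
  qed
  then show ?thesis by (simp add: L2_dist_def L2_norm_def)
qed

lemma L2_space_imp_class:
  assumes "A \<in> L2_space S"
  obtains f where "f \<in> L2 S" "A = L2_class S f"
  using assms by (auto simp: L2_space_def L2_class_def elim: quotientE)

text \<open>
  Fatou's lemma for \<open>(g - f\<^sub>i)\<^sup>2\<close>. Where the sequence is not Cauchy, the value of \<open>lim\<close> is arbitrary, but such
  points form a null set.
\<close>

lemma L2_limit_if_AE_Cauchy:
  assumes f: "\<And>i. f i \<in> L2 S" and C: "AE x in lebesgue_on S. Cauchy (\<lambda>i. f i x)"
    and g: "g \<in> L2 S" and e: "e \<ge> 0" and le: "\<And>i. i \<ge> N \<Longrightarrow> L2_norm S (\<lambda>x. g x - f i x) \<le> e"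
  shows "(\<lambda>x. g x - lim (\<lambda>i. f i x)) \<in> L2 S" "L2_norm S (\<lambda>x. g x - lim (\<lambda>i. f i x)) \<le> e"
proof -
  let ?M = "lebesgue_on S" and ?l = "\<lambda>x. lim (\<lambda>i. f i x)"
  have m: "f i \<in> borel_measurable ?M" for i using f by (auto simp: L2_def)
  have gm: "g \<in> borel_measurable ?M" using g by (auto simp: L2_def)
  have lm: "?l \<in> borel_measurable ?M" by (rule borel_measurable_lim_metric[OF m])
  have "AE x in ?M. ennreal ((g x - ?l x)\<^sup>2) = liminf (\<lambda>i. ennreal ((g x - f i x)\<^sup>2))"
    using C
  proof eventually_elim
    case (elim x)
    then have "(\<lambda>i. f i x) \<longlonglongrightarrow> ?l x"
      using Cauchy_convergent_iff convergent_LIMSEQ_iff by blast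
    then have "(\<lambda>i. ennreal ((g x - f i x)\<^sup>2)) \<longlonglongrightarrow> ennreal ((g x - ?l x)\<^sup>2)"
      by (intro tendsto_ennrealI tendsto_intros)
    then show ?case by (intro lim_imp_Liminf[symmetric]) simp_all
  qed
  then have "(\<integral>\<^sup>+ x. ennreal ((g x - ?l x)\<^sup>2) \<partial>?M) = (\<integral>\<^sup>+ x. liminf (\<lambda>i. ennreal ((g x - f i x)\<^sup>2)) \<partial>?M)"
    by (rule nn_integral_cong_AE)
  also have "\<dots> \<le> liminf (\<lambda>i. \<integral>\<^sup>+ x. ennreal ((g x - f i x)\<^sup>2) \<partial>?M)"
    by (rule nn_integral_liminf) (use m gm in measurable)
  also have "\<dots> \<le> ennreal (e\<^sup>2)"
  proof (rule Liminf_le)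
    show "\<forall>\<^sub>F i in sequentially. (\<integral>\<^sup>+ x. ennreal ((g x - f i x)\<^sup>2) \<partial>?M) \<le> ennreal (e\<^sup>2)"
      using eventually_ge_at_top[of N]
    proof eventually_elim
      case (elim i)
      have "integrable ?M (\<lambda>x. (g x - f i x)\<^sup>2)"
        using L2_diff[OF g f] by (auto simp: L2_def)
      then have "(\<integral>\<^sup>+ x. ennreal ((g x - f i x)\<^sup>2) \<partial>?M) = ennreal ((L2_norm S (\<lambda>x. g x - f i x))\<^sup>2)"
        unfolding L2_norm_sq by (rule nn_integral_eq_integral) simp
      also have "\<dots> \<le> ennreal (e\<^sup>2)"
        using le[OF elim] by (intro ennreal_leI power_mono) auto
      finally show ?case .
    qed
  qed simp
  finally have bound: "(\<integral>\<^sup>+ x. ennreal ((g x - ?l x)\<^sup>2) \<partial>?M) \<le> ennreal (e\<^sup>2)" .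
  have int: "integrable ?M (\<lambda>x. (g x - ?l x)\<^sup>2)"
  proof (rule integrableI_bounded)
    show "(\<lambda>x. (g x - ?l x)\<^sup>2) \<in> borel_measurable ?M" using gm lm by measurable
    show "(\<integral>\<^sup>+ x. ennreal (norm ((g x - ?l x)\<^sup>2)) \<partial>?M) < \<infinity>"
      using bound by (simp add: order_le_less_trans[OF _ ennreal_less_top])
  qed
  then show "(\<lambda>x. g x - ?l x) \<in> L2 S" using gm lm by (simp add: L2_def)
  have "ennreal ((L2_norm S (\<lambda>x. g x - ?l x))\<^sup>2) \<le> ennreal (e\<^sup>2)"
    using bound nn_integral_eq_integral[OF int] by (simp add: L2_norm_sq)
  then have "(L2_norm S (\<lambda>x. g x - ?l x))\<^sup>2 \<le> e\<^sup>2" by simp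
  then show "L2_norm S (\<lambda>x. g x - ?l x) \<le> e" using e by (rule power2_le_imp_le)
qed

text \<open>
  On a set of finite measure an \<open>L\<^sup>2\<close> Cauchy sequence is Cauchy in \<open>L\<^sup>1\<close>, so a subsequence converges almost
  everywhere; by Fatou's lemma its limit is the \<open>L\<^sup>2\<close> limit of the whole sequence.
\<close>

theorem mcomplete_L2:
  assumes S: "S \<in> lmeasurable"
  shows "Metric_space.mcomplete (L2_space S) (L2_dist S)"
proof -
  interpret L2: Metric_space "L2_space S" "L2_dist S" by (rule Metric_space_L2)
  interpret M: finite_measure "lebesgue_on S" by (rule finite_measure_lebesgue_on[OF S])
  show ?thesis
    unfolding L2.mcomplete_def
  proof (intro allI impI)
    fix \<sigma> assume \<sigma>: "L2.MCauchy \<sigma>"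
    have "\<forall>n. \<exists>f. f \<in> L2 S \<and> \<sigma> n = L2_class S f"
      using \<sigma> L2_space_imp_class unfolding L2.MCauchy_def by (metis UNIV_I image_subset_iff)
    then obtain f where f: "\<And>n. f n \<in> L2 S" "\<And>n. \<sigma> n = L2_class S (f n)" by metis
    have Cauchy: "\<exists>N. \<forall>i\<ge>N. \<forall>j\<ge>N. L2_norm S (\<lambda>x. f i x - f j x) < e" if "e > 0" for e
      using \<sigma> that f L2_dist_class unfolding L2.MCauchy_def by metis
    have one: "(\<lambda>_. 1) \<in> L2 S" by (simp add: L2_def)
    \<comment> \<open>The summand \<open>1\<close> only makes the constant positive when \<open>S\<close> is a null set.\<close>
    define c where "c = L2_norm S (\<lambda>_. 1) + 1"
    have c: "c > 0" unfolding c_def by (intro add_nonneg_pos) auto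
    obtain r where r: "strict_mono r" "AE x in lebesgue_on S. Cauchy (\<lambda>i. f (r i) x)"
    proof (rule cauchy_L1_AE_cauchy_subseq)
      show "integrable (lebesgue_on S) (f n)" for n
        using L2_mult_integrable[OF f(1) one, of n] by simp
      fix e :: real assume "e > 0"
      then obtain N where N: "\<And>i j. i \<ge> N \<Longrightarrow> j \<ge> N \<Longrightarrow> L2_norm S (\<lambda>x. f i x - f j x) < e / c"
        using Cauchy[of "e / c"] c by auto
      have "(LINT x|lebesgue_on S. norm (f i x - f j x)) < e" if "i \<ge> N" "j \<ge> N" for i j
      proof -
        have L: "(\<lambda>x. \<bar>f i x - f j x\<bar>) \<in> L2 S"
          using L2_diff[OF f(1) f(1), of i j] by (auto simp: L2_def)
        have "(LINT x|lebesgue_on S. norm (f i x - f j x)) \<le> L2_norm S (\<lambda>x. \<bar>f i x - f j x\<bar>) * L2_norm S (\<lambda>_. 1)"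
          using L2_Cauchy_Schwarz[OF L one] by simp
        also have "L2_norm S (\<lambda>x. \<bar>f i x - f j x\<bar>) = L2_norm S (\<lambda>x. f i x - f j x)"
          by (simp add: L2_norm_def)
        also have "\<dots> * L2_norm S (\<lambda>_. 1) \<le> L2_norm S (\<lambda>x. f i x - f j x) * c"
          by (intro mult_left_mono) (auto simp: c_def)
        also have "\<dots> < e / c * c"
          using N[OF that] c by (intro mult_strict_right_mono)
        finally show ?thesis using c by simp
      qed
      then show "\<exists>N. \<forall>i\<ge>N. \<forall>j\<ge>N. (LINT x|lebesgue_on S. norm (f i x - f j x)) < e" by blast
    qed (blast intro: that)
    define l where "l = (\<lambda>x. lim (\<lambda>i. f (r i) x))"
    have limit: "(\<lambda>x. f n x - l x) \<in> L2 S \<and> L2_norm S (\<lambda>x. f n x - l x) \<le> e"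
      if "e > 0" "\<And>i j. i \<ge> N \<Longrightarrow> j \<ge> N \<Longrightarrow> L2_norm S (\<lambda>x. f i x - f j x) < e" "n \<ge> N" for e n N
    proof -
      have "L2_norm S (\<lambda>x. f n x - f (r i) x) \<le> e" if "i \<ge> N" for i
      proof -
        have "r i \<ge> N" using seq_suble[OF r(1), of i] that by simp
        then show ?thesis using \<open>n \<ge> N\<close> \<open>\<And>i j. i \<ge> N \<Longrightarrow> j \<ge> N \<Longrightarrow> L2_norm S (\<lambda>x. f i x - f j x) < e\<close>
          by (intro less_imp_le)
      qed
      then show ?thesis
        using L2_limit_if_AE_Cauchy[of "\<lambda>i. f (r i)" S "f n" e N] f(1) r(2) \<open>e > 0\<close>
        unfolding l_def by auto
    qed
    obtain N1 where "\<And>i j. i \<ge> N1 \<Longrightarrow> j \<ge> N1 \<Longrightarrow> L2_norm S (\<lambda>x. f i x - f j x) < 1"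
      using Cauchy[of 1] by auto
    then have "(\<lambda>x. f N1 x - l x) \<in> L2 S" using limit[of 1 N1 N1] by auto
    from L2_diff[OF f(1)[of N1] this] have l: "l \<in> L2 S" by simp
    have "limitin L2.mtopology \<sigma> (L2_class S l) sequentially"
      unfolding L2.limit_metric_sequentially
    proof (intro conjI allI impI)
      show "L2_class S l \<in> L2_space S" by (rule L2_class_in_space[OF l])
      fix e :: real assume "e > 0"
      then obtain N where N: "\<And>i j. i \<ge> N \<Longrightarrow> j \<ge> N \<Longrightarrow> L2_norm S (\<lambda>x. f i x - f j x) < e / 2"
        using Cauchy[of "e / 2"] by auto
      show "\<exists>N. \<forall>n\<ge>N. \<sigma> n \<in> L2_space S \<and> L2_dist S (\<sigma> n) (L2_class S l) < e"
      proof (intro exI allI impI conjI)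
        fix n assume n: "n \<ge> N"
        show "\<sigma> n \<in> L2_space S" unfolding f(2) by (rule L2_class_in_space[OF f(1)])
        have "L2_norm S (\<lambda>x. f n x - l x) \<le> e / 2"
          using limit[of "e / 2" N n] N n \<open>e > 0\<close> by auto
        then show "L2_dist S (\<sigma> n) (L2_class S l) < e"
          using \<open>e > 0\<close> unfolding f(2) L2_dist_class[OF f(1) l] by linarith
      qed
    qed
    then show "\<exists>x. limitin L2.mtopology \<sigma> x sequentially" by blast
  qed
qed

section \<open>Sobolev norms and boundary traces\<close>

lemma L2_norm_weak_deriv_le_H_norm:
  assumes "i \<le> k"
  shows "L2_norm S (weak_deriv i S f) \<le> H_norm k S f"
  unfolding H_norm_def
proof (rule real_le_rsqrt)
  show "(L2_norm S (weak_deriv i S f))\<^sup>2 \<le> (\<Sum>i\<le>k. (L2_norm S (weak_deriv i S f))\<^sup>2)"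
    using assms by (intro member_le_sum) auto
qed

lemma L2_norm_cong_AE:
  assumes "f \<in> borel_measurable (lebesgue_on S)" "g \<in> borel_measurable (lebesgue_on S)"
    "AE x in lebesgue_on S. f x = g x"
  shows "L2_norm S f = L2_norm S g"
proof -
  have "(LINT x|lebesgue_on S. (f x)\<^sup>2) = (LINT x|lebesgue_on S. (g x)\<^sup>2)"
    by (rule integral_cong_AE) (use assms in \<open>auto elim: eventually_mono\<close>)
  then show ?thesis by (simp add: L2_norm_def)
qed

lemma is_weak_deriv_0_self: "locally_integrable S f \<Longrightarrow> is_weak_deriv 0 S f f"
  by (simp add: is_weak_deriv_def)

lemma H_imp_locally_integrable: "f \<in> H k S \<Longrightarrow> locally_integrable S f"
  by (auto simp: sobolev_def is_weak_deriv_def)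

text \<open>
  The Sobolev norm contains the weak derivative of order \<open>0\<close>, which is \<open>f\<close> only up to a null set.
\<close>

lemma L2_norm_le_H_norm:
  assumes f: "f \<in> H k S" and S: "open S"
  shows "L2_norm S f \<le> H_norm k S f"
proof -
  note li = H_imp_locally_integrable[OF f]
  note wd = is_weak_deriv_weak_deriv[OF f le0]
  have "L2_norm S f = L2_norm S (weak_deriv 0 S f)"
  proof (rule L2_norm_cong_AE)
    show "f \<in> borel_measurable (lebesgue_on S)" by (rule locally_integrable_measurable[OF li S])
    show "weak_deriv 0 S f \<in> borel_measurable (lebesgue_on S)"
      using weak_deriv_in_L2[OF f le0 S] by (simp add: L2_def)
    show "AE x in lebesgue_on S. f x = weak_deriv 0 S f x"
      by (rule weak_deriv_unique[OF is_weak_deriv_0_self[OF li] wd S])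
  qed
  then show ?thesis using L2_norm_weak_deriv_le_H_norm[OF le0, of S f k] by simp
qed

lemma LINT_abs_le_L2_norm_unit:
  assumes f: "f \<in> L2 {0<..<1}"
  shows "(LINT x|lebesgue_on {0<..<1}. \<bar>f x\<bar>) \<le> L2_norm {0<..<1} f"
proof -
  have "(\<lambda>x. \<bar>f x\<bar>) \<in> L2 {0<..<1}" using f by (auto simp: L2_def)
  from L2_Cauchy_Schwarz[OF this continuous_in_L2_Ioo[OF continuous_on_const, of 1]]
  have "(LINT x|lebesgue_on {0<..<1}. \<bar>f x\<bar>) \<le> L2_norm {0<..<1} (\<lambda>x. \<bar>f x\<bar>) * L2_norm {0<..<1} (\<lambda>_. 1)"
    by simp
  also have "L2_norm {0<..<1} (\<lambda>_. 1) = 1"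
    by (simp only: L2_norm_def LINT_unit_const power_one real_sqrt_one)
  finally show ?thesis by (simp add: L2_norm_def)
qed

text \<open>
  Average the bound \<open>\<bar>f x\<bar> \<le> \<bar>f y\<bar> + \<integral> \<bar>f'\<bar>\<close> over \<open>y \<in> (0, 1)\<close>.
\<close>

lemma H1_trace_bound:
  assumes f: "f \<in> H 1 {0<..<1}" and c: "continuous_on {0..1} f" and x: "x \<in> {0..1}"
  shows "\<bar>f x\<bar> \<le> 2 * H_norm 1 {0<..<1} f"
proof -
  let ?M = "lebesgue_on {0<..<1 :: real}" and ?g = "weak_deriv 1 {0<..<1} f"
  have ac: "AC_on 0 1 f ?g" by (rule H1_AC_on[OF f c])
  have g: "?g \<in> L2 {0<..<1}" by (rule weak_deriv_in_L2[OF f]) auto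
  have ig: "(\<lambda>x. \<bar>?g x\<bar>) absolutely_integrable_on {0..1}"
    using absolutely_integrable_norm[OF AC_on_absolutely_integrable[OF ac]] by (simp add: o_def)
  define G where "G = (LINT x|?M. \<bar>?g x\<bar>)"
  have G: "G = integral {0..1} (\<lambda>x. \<bar>?g x\<bar>)" unfolding G_def by (rule LINT_Ioo(1)[OF ig])
  have i: "integrable ?M (\<lambda>y. \<bar>f y\<bar>)" by (intro integrable_continuous_Ioo continuous_intros c)
  have ic: "integrable ?M (\<lambda>y. c)" for c :: real by (intro integrable_continuous_Ioo continuous_on_const)
  have "\<bar>f x\<bar> = (LINT y|?M. \<bar>f x\<bar>)" by (simp only: LINT_unit_const)
  also have "\<dots> \<le> (LINT y|?M. \<bar>f y\<bar> + G)"
  proof (rule integral_mono)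
    show "integrable ?M (\<lambda>y. \<bar>f x\<bar>)" by (rule ic)
    show "integrable ?M (\<lambda>y. \<bar>f y\<bar> + G)" by (intro Bochner_Integration.integrable_add i ic)
    show "\<bar>f x\<bar> \<le> \<bar>f y\<bar> + G" if "y \<in> space ?M" for y
      unfolding G by (rule AC_on_pointwise_bound[OF ac x]) (use that in auto)
  qed
  also have "\<dots> = (LINT y|?M. \<bar>f y\<bar>) + G"
    using i ic by (simp only: Bochner_Integration.integral_add LINT_unit_const)
  also have "\<dots> \<le> L2_norm {0<..<1} f + L2_norm {0<..<1} ?g"
    unfolding G_def by (intro add_mono LINT_abs_le_L2_norm_unit g continuous_in_L2_Ioo c)
  also have "\<dots> \<le> H_norm 1 {0<..<1} f + H_norm 1 {0<..<1} f"
    using f by (intro add_mono L2_norm_le_H_norm L2_norm_weak_deriv_le_H_norm) auto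
  finally show ?thesis by simp
qed

lemma trace_continuous:
  assumes v: "C0_curve (H 1 {0<..<1}) (H_norm 1 {0<..<1}) I v"
    and c: "\<And>t. t \<in> I \<Longrightarrow> continuous_on {0..1} (v t)" and x: "x \<in> {0..1}"
  shows "continuous_on I (\<lambda>t. v t x)"
  unfolding continuous_on_def
proof
  fix t assume t: "t \<in> I"
  have H: "v s \<in> H 1 {0<..<1}" if "s \<in> I" for s using v that by (auto simp: C0_curve_def)
  have "((\<lambda>s. v s x - v t x) \<longlongrightarrow> 0) (at t within I)"
  proof (rule Lim_null_comparison)
    have "((\<lambda>s. H_norm 1 {0<..<1} (\<lambda>x. v s x - v t x)) \<longlongrightarrow> 0) (at t within I)"
      using v t by (auto simp: C0_curve_def)
    from tendsto_mult_right_zero[OF this, of 2]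
    show "((\<lambda>s. 2 * H_norm 1 {0<..<1} (\<lambda>x. v s x - v t x)) \<longlongrightarrow> 0) (at t within I)" .
    show "\<forall>\<^sub>F s in at t within I. norm (v s x - v t x) \<le> 2 * H_norm 1 {0<..<1} (\<lambda>x. v s x - v t x)"
      using eventually_at_within_in
    proof eventually_elim
      case (elim s)
      show ?case
        unfolding real_norm_def
        by (rule H1_trace_bound[OF H_diff[OF H[OF elim] H[OF t]] continuous_on_diff[OF c[OF elim] c[OF t]] x]) auto
    qed
  qed
  then show "((\<lambda>t. v t x) \<longlongrightarrow> v t x) (at t within I)" by (simp add: LIM_zero_iff)
qed

section \<open>Energy and multiplier estimates\<close>

text \<open>
  The function \<open>(Q + d) e\<^sup>-\<^sup>k\<^sup>t\<close> is nonincreasing.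
\<close>

lemma Gronwall:
  fixes Q :: "real \<Rightarrow> real"
  assumes Q: "continuous_on {0..T} Q" "Q 0 = 0" and k: "k > 0"
    and D: "\<And>t. 0 < t \<Longrightarrow> t < T \<Longrightarrow> (Q has_real_derivative Q' t) (at t)"
    and le: "\<And>t. 0 < t \<Longrightarrow> t < T \<Longrightarrow> Q' t \<le> k * Q t + k * d" and d: "d \<ge> 0"
    and t: "t \<in> {0..T}"
  shows "Q t \<le> d * exp (k * T)"
proof -
  let ?G = "\<lambda>s. (Q s + d) * exp (- k * s)"
  have "?G t \<le> ?G 0"
  proof (cases "t = 0")
    case False
    show ?thesis
    proof (rule DERIV_nonpos_imp_decreasing_open[where f = ?G])
      show "0 \<le> t" using t by simp
      show "continuous_on {0..t} ?G"
        using t by (intro continuous_intros continuous_on_subset[OF Q(1)]) auto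
      fix s assume s: "0 < s" "s < t"
      then have "(?G has_real_derivative (Q' s - k * (Q s + d)) * exp (- k * s)) (at s)"
        using t by (auto intro!: derivative_eq_intros D simp: algebra_simps)
      moreover have "(Q' s - k * (Q s + d)) * exp (- k * s) \<le> 0"
        using le[of s] s t by (intro mult_nonpos_nonneg) (auto simp: algebra_simps)
      ultimately show "\<exists>y. DERIV ?G s :> y \<and> y \<le> 0" by blast
    qed
  qed simp
  then have "(Q t + d) * exp (- k * t) \<le> d" using Q(2) by simp
  then have "(Q t + d) * exp (- k * t) * exp (k * t) \<le> d * exp (k * t)"
    by (rule mult_right_mono) simp
  then have "Q t + d \<le> d * exp (k * t)"
    by (simp add: mult.assoc exp_add[symmetric])
  also have "\<dots> \<le> d * exp (k * T)" using d k t by (intro mult_left_mono) auto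
  finally show ?thesis using d by simp
qed

text \<open>
  With \<open>e = exp ((2 L + 1) T)\<close>, the energy and the multiplier term are at most \<open>e \<delta>\<^sup>2\<close>, and the remaining terms
  of the multiplier identity at most \<open>((1 + L\<^sup>2) e + 1) \<delta>\<^sup>2\<close> at each time.
\<close>

definition trace_const :: "real \<Rightarrow> real \<Rightarrow> real" where
  "trace_const T L = 4 * (((1 + L\<^sup>2) * exp ((2 * L + 1) * T) + 1) * T + exp ((2 * L + 1) * T))"

text \<open>
  Traces of \<open>L\<^sup>2\<close> functions are not defined, but those of finite energy solutions of the wave system are
  square integrable in time and bounded by the data. \<open>Q\<close> is twice the energy, \<open>X\<close> is the multiplier term
  \<open>\<integral> m r w\<close>. The multiplier is \<open>m(x) = x - 1/2\<close> since \<open>m(1) = - m(0) = 1/2\<close> lets both boundary terms enter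
  with the same sign.
\<close>

theorem hidden_trace_regularity:
  fixes r w r' w' rx wx f :: "real \<Rightarrow> real \<Rightarrow> real"
  assumes T: "T > 0" and L: "L \<ge> 0"
    and Cr: "C1_curve (L2 {0<..<1}) (L2_norm {0<..<1}) {0..T} r r'"
    and Cw: "C1_curve (L2 {0<..<1}) (L2_norm {0<..<1}) {0..T} w w'"
    and Ar: "\<And>t. t \<in> {0..T} \<Longrightarrow> AC_on 0 1 (r t) (rx t)"
    and Aw: "\<And>t. t \<in> {0..T} \<Longrightarrow> AC_on 0 1 (w t) (wx t)"
    and eq: "\<And>t. t \<in> {0<..<T} \<Longrightarrow> AE x in lebesgue_on {0<..<1}.
      r' t x = - wx t x \<and> w' t x = - rx t x - f t x"
    and cf: "\<And>t. t \<in> {0..T} \<Longrightarrow> continuous_on {0..1} (f t)"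
    and f: "\<And>t x. t \<in> {0..T} \<Longrightarrow> x \<in> {0..1} \<Longrightarrow> \<bar>f t x\<bar> \<le> L * \<bar>w t x\<bar> + \<delta>"
    and w0: "\<And>t. t \<in> {0..T} \<Longrightarrow> w t 0 = 0 \<and> w t 1 = 0"
    and init: "\<And>x. x \<in> {0..1} \<Longrightarrow> r 0 x = 0 \<and> w 0 x = 0"
    and tr: "continuous_on {0..T} (\<lambda>t. r t 0)" "continuous_on {0..T} (\<lambda>t. r t 1)"
  shows "integral {0..T} (\<lambda>t. (r t 0)\<^sup>2 + (r t 1)\<^sup>2) \<le> trace_const T L * \<delta>\<^sup>2"
proof -
  let ?M = "lebesgue_on {0<..<1 :: real}"
  define m :: "real \<Rightarrow> real" where "m = (\<lambda>x. x + - 1 / 2)"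
  have m: "\<bar>m x\<bar> \<le> 1 / 2" if "x \<in> {0..1}" for x using that unfolding m_def atLeastAtMost_iff by linarith
  have mAC: "AC_on 0 1 m (\<lambda>x. 1)" unfolding m_def by (rule AC_on_translate)
  note cm = AC_on_continuous[OF mAC]
  define Q where "Q = (\<lambda>t. (LINT x|?M. r t x * r t x) + (LINT x|?M. w t x * w t x))"
  define X where "X = (\<lambda>t. LINT x|?M. (m x * r t x) * w t x)"
  define b where "b = (\<lambda>t. (r t 0)\<^sup>2 + (r t 1)\<^sup>2)"
  define k where "k = 2 * L + 1"
  have k: "k \<ge> 1" using L by (simp add: k_def)
  define mr' where "mr' = (\<lambda>t x. m x * r' t x)"
  have Cmr: "C1_curve (L2 {0<..<1}) (L2_norm {0<..<1}) {0..T} (\<lambda>t x. m x * r t x) mr'"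
    unfolding mr'_def
  proof (rule C1_curve_bounded_mult[OF _ _ Cr])
    show "m \<in> borel_measurable ?M"
      by (rule borel_measurable_integrable[OF integrable_continuous_Ioo[OF cm]])
    show "\<bar>m x\<bar> \<le> 1" if "x \<in> {0<..<1}" for x using m[of x] that by auto
  qed
  note dr = C1_curve_inner_derivative[OF Cr Cr] and dw = C1_curve_inner_derivative[OF Cw Cw]
    and dX = C1_curve_inner_derivative[OF Cmr Cw]
  have cont: "continuous_on {0..T} Q" "continuous_on {0..T} X"
    unfolding Q_def X_def by (intro continuous_on_add DERIV_continuous_on[OF dr]
        DERIV_continuous_on[OF dw] DERIV_continuous_on[OF dX]; assumption)+
  have cr: "continuous_on {0..1} (r t)" and cw: "continuous_on {0..1} (w t)" if "t \<in> {0..T}" for t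
    using AC_on_continuous[OF Ar[OF that]] AC_on_continuous[OF Aw[OF that]] by auto
  have L2': "r' t \<in> L2 {0<..<1}" "w' t \<in> L2 {0<..<1}" if "t \<in> {0..T}" for t
    using Cr Cw that by (auto simp: C1_curve_def C0_curve_def)
  have Q_eq: "Q t = (LINT x|?M. (r t x)\<^sup>2 + (w t x)\<^sup>2)" and iQ: "integrable ?M (\<lambda>x. (r t x)\<^sup>2 + (w t x)\<^sup>2)"
    if t: "t \<in> {0..T}" for t
  proof -
    have "integrable ?M (\<lambda>x. (r t x)\<^sup>2)" "integrable ?M (\<lambda>x. (w t x)\<^sup>2)"
      by (intro integrable_continuous_Ioo continuous_intros cr cw t)+
    then show "Q t = (LINT x|?M. (r t x)\<^sup>2 + (w t x)\<^sup>2)" "integrable ?M (\<lambda>x. (r t x)\<^sup>2 + (w t x)\<^sup>2)"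
      by (simp_all add: Q_def power2_eq_square)
  qed
  have Q_nonneg: "0 \<le> Q t" if "t \<in> {0..T}" for t
    unfolding Q_eq[OF that] by (rule integral_nonneg_AE) simp
  have inner: "t \<in> {0..T}" "at t within {0..T} = at t" if "0 < t" "t < T" for t
    using that by (auto intro: at_within_Icc_at)
  define Q' where "Q' t = (LINT x|?M. - 2 * (w t x * f t x))" for t
  have DQ: "(Q has_real_derivative Q' t) (at t)" if t: "0 < t" "t < T" for t
  proof -
    note t' = inner(1)[OF t]
    have t'': "t \<in> {0<..<T}" using t by simp
    have rw: "AC_on 0 1 (\<lambda>x. r t x * w t x) (\<lambda>x. rx t x * w t x + r t x * wx t x)"
      by (rule AC_on_mult[OF Ar[OF t'] Aw[OF t']])
    have iwf: "integrable ?M (\<lambda>x. w t x * f t x)"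
      by (intro integrable_continuous_Ioo continuous_intros cw cf t')
    \<comment> \<open>\<open>r w\<^sub>x + w r\<^sub>x\<close> is the derivative of \<open>r w\<close>, which vanishes at both end points.\<close>
    let ?D = "(LINT x|?M. r t x * r' t x + r' t x * r t x) + (LINT x|?M. w t x * w' t x + w' t x * w t x)"
    have "?D = (LINT x|?M. (r t x * r' t x + r' t x * r t x) + (w t x * w' t x + w' t x * w t x))"
      by (intro Bochner_Integration.integral_add[symmetric] Bochner_Integration.integrable_add
          L2_mult_integrable L2' t' continuous_in_L2_Ioo cr cw)
    also have "\<dots> = (LINT x|?M. - 2 * (rx t x * w t x + r t x * wx t x) + - 2 * (w t x * f t x))"
    proof (rule integral_cong_AE)
      show "(\<lambda>x. (r t x * r' t x + r' t x * r t x) + (w t x * w' t x + w' t x * w t x)) \<in> borel_measurable ?M"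
        by (intro borel_measurable_integrable Bochner_Integration.integrable_add
          L2_mult_integrable L2' t' continuous_in_L2_Ioo cr cw)
      show "(\<lambda>x. - 2 * (rx t x * w t x + r t x * wx t x) + - 2 * (w t x * f t x)) \<in> borel_measurable ?M"
        by (intro borel_measurable_integrable Bochner_Integration.integrable_add
          integrable_mult_right LINT_AC_on(2)[OF rw] iwf)
      show "AE x in ?M. (r t x * r' t x + r' t x * r t x) + (w t x * w' t x + w' t x * w t x)
          = - 2 * (rx t x * w t x + r t x * wx t x) + - 2 * (w t x * f t x)"
        using eq[OF t'']
      proof eventually_elim
        case (elim x)
        show ?case
          unfolding elim[THEN conjunct1] elim[THEN conjunct2] by (simp add: algebra_simps)
      qed
    qed
    also have "\<dots> = - 2 * (LINT x|?M. rx t x * w t x + r t x * wx t x) + Q' t"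
      unfolding Q'_def using LINT_AC_on(2)[OF rw] iwf
      by (simp only: Bochner_Integration.integral_add integrable_mult_right integral_mult_right_zero)
    also have "\<dots> = Q' t"
      using LINT_AC_on(1)[OF rw] w0[OF t'] by simp
    finally have D: "?D = Q' t" .
    show ?thesis
      using DERIV_add[OF dr[OF t'] dw[OF t']] unfolding D inner(2)[OF t] Q_def .
  qed
  have Q'_le: "Q' t \<le> k * Q t + k * \<delta>\<^sup>2" if t: "0 < t" "t < T" for t
  proof -
    note t' = inner(1)[OF t]
    have t'': "t \<in> {0<..<T}" using t by simp
    have "Q' t \<le> (LINT x|?M. k * ((r t x)\<^sup>2 + (w t x)\<^sup>2) + \<delta>\<^sup>2)"
      unfolding Q'_def
    proof (rule integral_mono)
      show "integrable ?M (\<lambda>x. - 2 * (w t x * f t x))"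
        by (intro integrable_continuous_Ioo continuous_intros cw cf t')
      show "integrable ?M (\<lambda>x. k * ((r t x)\<^sup>2 + (w t x)\<^sup>2) + \<delta>\<^sup>2)"
        by (intro integrable_continuous_Ioo continuous_intros cw cr t')
      fix x assume "x \<in> space ?M"
      then have x: "x \<in> {0..1}" by simp
      have "- 2 * (w t x * f t x) \<le> 2 * (\<bar>w t x\<bar> * \<bar>f t x\<bar>)"
        unfolding abs_mult[symmetric] by linarith
      also have "\<dots> \<le> 2 * (\<bar>w t x\<bar> * (L * \<bar>w t x\<bar> + \<delta>))"
        using f[OF t' x] by (intro mult_left_mono) auto
      also have "\<dots> = 2 * L * (w t x)\<^sup>2 + 2 * \<bar>w t x\<bar> * \<delta>"
        by (simp add: algebra_simps power2_eq_square)
      also have "\<dots> \<le> 2 * L * (w t x)\<^sup>2 + ((w t x)\<^sup>2 + \<delta>\<^sup>2)"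
        using sum_squares_bound[of "\<bar>w t x\<bar>" \<delta>] by simp
      also have "\<dots> = k * (w t x)\<^sup>2 + \<delta>\<^sup>2" by (simp add: k_def algebra_simps)
      also have "\<dots> \<le> k * ((r t x)\<^sup>2 + (w t x)\<^sup>2) + \<delta>\<^sup>2"
        using k by (intro add_right_mono mult_left_mono) auto
      finally show "- 2 * (w t x * f t x) \<le> k * ((r t x)\<^sup>2 + (w t x)\<^sup>2) + \<delta>\<^sup>2" .
    qed
    also have "\<dots> = k * Q t + \<delta>\<^sup>2"
      unfolding Q_eq[OF t'] using iQ[OF t'] integrable_continuous_Ioo[OF continuous_on_const]
      by (simp only: Bochner_Integration.integral_add integrable_mult_right integral_mult_right_zero
          LINT_unit_const)
    also have "\<dots> \<le> k * Q t + k * \<delta>\<^sup>2"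
      using mult_right_mono[OF k, of "\<delta>\<^sup>2"] by simp
    finally show ?thesis .
  qed
  have zero: "Q 0 = 0" "X 0 = 0"
  proof -
    have "(LINT x|?M. r 0 x * r 0 x) = (LINT x|?M. 0)" "(LINT x|?M. w 0 x * w 0 x) = (LINT x|?M. 0)"
      "(LINT x|?M. (m x * r 0 x) * w 0 x) = (LINT x|?M. 0)"
      by (intro Bochner_Integration.integral_cong; use init in force)+
    then show "Q 0 = 0" "X 0 = 0" by (simp_all add: Q_def X_def)
  qed
  define e where "e = exp (k * T)"
  have Q_le: "Q t \<le> \<delta>\<^sup>2 * e" if "t \<in> {0..T}" for t
    unfolding e_def using k
    by (intro Gronwall[where Q' = Q'] cont(1) zero(1) DQ Q'_le that) auto
  have X_bound: "\<bar>X t\<bar> \<le> \<delta>\<^sup>2 * e" if t: "t \<in> {0..T}" for t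
  proof -
    have ci: "integrable ?M (\<lambda>x. (m x * r t x) * w t x)"
      by (intro integrable_continuous_Ioo continuous_intros cm cr cw t)
    have "\<bar>X t\<bar> \<le> (LINT x|?M. \<bar>(m x * r t x) * w t x\<bar>)"
      unfolding X_def by (rule integral_abs_bound)
    also have "\<dots> \<le> (LINT x|?M. (r t x)\<^sup>2 + (w t x)\<^sup>2)"
    proof (rule integral_mono[OF _ iQ[OF t]])
      show "integrable ?M (\<lambda>x. \<bar>(m x * r t x) * w t x\<bar>)" using ci by simp
      fix x assume "x \<in> space ?M"
      then have "\<bar>m x\<bar> \<le> 1" using m[of x] by simp
      then have "\<bar>m x\<bar> * (\<bar>r t x\<bar> * \<bar>w t x\<bar>) \<le> 1 * (\<bar>r t x\<bar> * \<bar>w t x\<bar>)"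
        by (rule mult_right_mono) simp
      moreover have "2 * (\<bar>r t x\<bar> * \<bar>w t x\<bar>) \<le> (r t x)\<^sup>2 + (w t x)\<^sup>2"
        using sum_squares_bound[of "\<bar>r t x\<bar>" "\<bar>w t x\<bar>"] by (simp add: mult.assoc)
      moreover have "0 \<le> \<bar>r t x\<bar> * \<bar>w t x\<bar>" by simp
      ultimately show "\<bar>(m x * r t x) * w t x\<bar> \<le> (r t x)\<^sup>2 + (w t x)\<^sup>2"
        unfolding abs_mult mult.assoc by linarith
    qed
    also have "\<dots> = Q t" by (rule Q_eq[OF t, symmetric])
    also have "\<dots> \<le> \<delta>\<^sup>2 * e" by (rule Q_le[OF t])
    finally show ?thesis .
  qed
  define K where "K = ((1 + L\<^sup>2) * e + 1) * \<delta>\<^sup>2"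
  define X' where "X' t = Q t / 2 - b t / 4 - (LINT x|?M. m x * (r t x * f t x))" for t
  have DX: "(X has_real_derivative X' t) (at t)" if t: "0 < t" "t < T" for t
  proof -
    note t' = inner(1)[OF t]
    have t'': "t \<in> {0<..<T}" using t by simp
    \<comment> \<open>\<open>h\<close> and \<open>g\<close> are the derivatives of \<open>m r\<^sup>2\<close> and \<open>m w\<^sup>2\<close>.\<close>
    define h where "h = (\<lambda>x. 1 * (r t x * r t x) + m x * (rx t x * r t x + r t x * rx t x))"
    define g where "g = (\<lambda>x. 1 * (w t x * w t x) + m x * (wx t x * w t x + w t x * wx t x))"
    have h: "AC_on 0 1 (\<lambda>x. m x * (r t x * r t x)) h"
      unfolding h_def by (intro AC_on_mult mAC Ar t')
    have g: "AC_on 0 1 (\<lambda>x. m x * (w t x * w t x)) g"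
      unfolding g_def by (intro AC_on_mult mAC Aw t')
    have imrf: "integrable ?M (\<lambda>x. m x * (r t x * f t x))"
      by (intro integrable_continuous_Ioo continuous_intros cm cr cf t')
    have "(LINT x|?M. (m x * r t x) * w' t x + mr' t x * w t x)
        = (LINT x|?M. (((r t x)\<^sup>2 + (w t x)\<^sup>2) / 2 - (h x + g x) / 2) - m x * (r t x * f t x))"
    proof (rule integral_cong_AE)
      have mr: "mr' t \<in> L2 {0<..<1}" using Cmr t' by (auto simp: C1_curve_def C0_curve_def)
      show "(\<lambda>x. (m x * r t x) * w' t x + mr' t x * w t x) \<in> borel_measurable ?M"
        by (intro borel_measurable_integrable Bochner_Integration.integrable_add
          L2_mult_integrable mr L2' t' continuous_in_L2_Ioo continuous_on_mult cr cw cm)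
      show "(\<lambda>x. (((r t x)\<^sup>2 + (w t x)\<^sup>2) / 2 - (h x + g x) / 2) - m x * (r t x * f t x)) \<in> borel_measurable ?M"
        by (intro borel_measurable_integrable Bochner_Integration.integrable_diff
          Bochner_Integration.integrable_add integrable_divide
          LINT_AC_on(2)[OF h] LINT_AC_on(2)[OF g] iQ[OF t'] imrf)
      show "AE x in ?M. (m x * r t x) * w' t x + mr' t x * w t x
          = (((r t x)\<^sup>2 + (w t x)\<^sup>2) / 2 - (h x + g x) / 2) - m x * (r t x * f t x)"
        using eq[OF t'']
      proof eventually_elim
        case (elim x)
        show ?case
          unfolding mr'_def elim[THEN conjunct1] elim[THEN conjunct2] h_def g_def power2_eq_square
          by (simp add: algebra_simps add_divide_distrib)
      qed
    qed
    also have "\<dots> = ((LINT x|?M. (r t x)\<^sup>2 + (w t x)\<^sup>2) / 2 - ((LINT x|?M. h x) + (LINT x|?M. g x)) / 2)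
        - (LINT x|?M. m x * (r t x * f t x))"
      using LINT_AC_on(2)[OF h] LINT_AC_on(2)[OF g] iQ[OF t'] imrf
      by (simp only: Bochner_Integration.integral_diff Bochner_Integration.integral_add
          Bochner_Integration.integrable_diff Bochner_Integration.integrable_add
          integrable_divide integral_divide_zero)
    also have "(LINT x|?M. h x) = b t / 2"
      unfolding LINT_AC_on(1)[OF h] by (simp add: b_def m_def power2_eq_square)
    also have "(LINT x|?M. g x) = 0"
      unfolding LINT_AC_on(1)[OF g] using w0[OF t'] by simp
    finally have D: "(LINT x|?M. (m x * r t x) * w' t x + mr' t x * w t x) = X' t"
      unfolding X'_def Q_eq[OF t'] by simp
    show ?thesis
      using dX[OF t'] unfolding D inner(2)[OF t] X_def .
  qed
  have X'_le: "X' t + b t / 4 \<le> K" if t: "0 < t" "t < T" for t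
  proof -
    note t' = inner(1)[OF t]
    have t'': "t \<in> {0<..<T}" using t by simp
    have "- (LINT x|?M. m x * (r t x * f t x)) = (LINT x|?M. - (m x * (r t x * f t x)))" by simp
    also have "\<dots> \<le> (LINT x|?M. (1 / 2 + L\<^sup>2) * ((r t x)\<^sup>2 + (w t x)\<^sup>2) + \<delta>\<^sup>2)"
    proof (rule integral_mono)
      show "integrable ?M (\<lambda>x. - (m x * (r t x * f t x)))"
        by (intro integrable_continuous_Ioo continuous_intros cm cr cf t')
      show "integrable ?M (\<lambda>x. (1 / 2 + L\<^sup>2) * ((r t x)\<^sup>2 + (w t x)\<^sup>2) + \<delta>\<^sup>2)"
        by (intro integrable_continuous_Ioo continuous_intros cw cr t')
      fix x assume "x \<in> space ?M"
      then have x: "x \<in> {0..1}" by simp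
      have "- (m x * (r t x * f t x)) \<le> \<bar>m x\<bar> * \<bar>r t x * f t x\<bar>"
        unfolding abs_mult[symmetric] by linarith
      also have "\<dots> \<le> 1 / 2 * \<bar>r t x * f t x\<bar>"
        using m[OF x] by (rule mult_right_mono) simp
      finally have 1: "- (m x * (r t x * f t x)) \<le> 1 / 2 * (\<bar>r t x\<bar> * \<bar>f t x\<bar>)"
        by (simp add: abs_mult)
      have 2: "2 * (\<bar>r t x\<bar> * \<bar>f t x\<bar>) \<le> (r t x)\<^sup>2 + (f t x)\<^sup>2"
        using sum_squares_bound[of "\<bar>r t x\<bar>" "\<bar>f t x\<bar>"] by (simp add: mult.assoc)
      have "(f t x)\<^sup>2 \<le> (L * \<bar>w t x\<bar> + \<delta>)\<^sup>2"
        using power_mono[OF f[OF t' x], of 2] by simp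
      also have "\<dots> \<le> 2 * (L\<^sup>2 * (w t x)\<^sup>2) + 2 * \<delta>\<^sup>2"
        using sum_squares_bound[of "L * \<bar>w t x\<bar>" \<delta>] by (simp add: power2_sum power_mult_distrib)
      finally have 3: "(f t x)\<^sup>2 \<le> 2 * (L\<^sup>2 * (w t x)\<^sup>2) + 2 * \<delta>\<^sup>2" .
      have 4: "0 \<le> L\<^sup>2 * (w t x)\<^sup>2" "0 \<le> L\<^sup>2 * (r t x)\<^sup>2" "0 \<le> (r t x)\<^sup>2" "0 \<le> (w t x)\<^sup>2" "0 \<le> \<delta>\<^sup>2"
        by simp_all
      show "- (m x * (r t x * f t x)) \<le> (1 / 2 + L\<^sup>2) * ((r t x)\<^sup>2 + (w t x)\<^sup>2) + \<delta>\<^sup>2"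
        unfolding distrib_left distrib_right using 1 2 3 4 by linarith
    qed
    also have "\<dots> = (1 / 2 + L\<^sup>2) * Q t + \<delta>\<^sup>2"
      unfolding Q_eq[OF t'] using iQ[OF t'] integrable_continuous_Ioo[OF continuous_on_const]
      by (simp only: Bochner_Integration.integral_add integrable_mult_right integral_mult_right_zero
          LINT_unit_const)
    finally have "X' t + b t / 4 \<le> (1 + L\<^sup>2) * Q t + \<delta>\<^sup>2"
      unfolding X'_def by (simp add: distrib_right)
    also have "\<dots> \<le> (1 + L\<^sup>2) * (\<delta>\<^sup>2 * e) + \<delta>\<^sup>2"
      by (intro add_right_mono mult_left_mono Q_le t') simp
    finally show ?thesis by (simp add: K_def algebra_simps)
  qed
  have cb: "continuous_on {0..T} b" unfolding b_def by (intro continuous_intros tr)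
  \<comment> \<open>Integration of the differential inequality \<open>X' + b / 4 \<le> K\<close> in time.\<close>
  let ?G = "\<lambda>t. X t + integral {0..t} b / 4 - K * t"
  have "?G T \<le> ?G 0"
  proof (rule DERIV_nonpos_imp_decreasing_open[where f = ?G])
    show "0 \<le> T" using T by simp
    have "continuous_on {0..T} (\<lambda>t. integral {0..t} b)"
      by (rule indefinite_integral_continuous_1[OF integrable_continuous_interval[OF cb]])
    then show "continuous_on {0..T} ?G" by (intro continuous_intros cont) auto
    fix t assume t: "0 < t" "t < T"
    have "((\<lambda>t. integral {0..t} b) has_real_derivative b t) (at t)"
      using integral_has_real_derivative[OF cb inner(1)[OF t]] inner(2)[OF t] by simp
    then have "(?G has_real_derivative X' t + b t / 4 - K) (at t)"
      by (auto intro!: derivative_eq_intros DX t)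
    then show "\<exists>y. DERIV ?G t :> y \<and> y \<le> 0" using X'_le[OF t] by fastforce
  qed
  then have "integral {0..T} b / 4 \<le> K * T - X T" using zero(2) by simp
  also have "\<dots> \<le> K * T + \<delta>\<^sup>2 * e" using X_bound[of T] T by (simp add: abs_le_iff)
  finally show ?thesis
    unfolding b_def trace_const_def K_def e_def k_def by (simp add: algebra_simps)
qed

section \<open>Lipschitz dependence of the output on the parameter\<close>

lemma continuous_if_Lipschitz:
  fixes b :: "real \<Rightarrow> real"
  assumes "\<And>x y. \<bar>b y - b x\<bar> \<le> L * \<bar>y - x\<bar>"
  shows "continuous_on S b"
proof -
  have "(\<lambda>y. b y) \<midarrow>x\<rightarrow> b x" for x
  proof (rule LIM_zero_cancel, rule Lim_null_comparison)
    show "\<forall>\<^sub>F y in at x. norm (b y - b x) \<le> L * \<bar>y - x\<bar>" using assms by simp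
    show "((\<lambda>y. L * \<bar>y - x\<bar>) \<longlongrightarrow> 0) (at x)" by (auto intro!: tendsto_eq_intros)
  qed
  then show ?thesis by (intro continuous_at_imp_continuous_on) (simp add: isCont_def)
qed

text \<open>
  The splitting \<open>a(u) - b(v) = (a(u) - a(v)) + (a(v) - b(v))\<close> bounds the right-hand side of the system for
  the differences by \<open>L\<bar>u - v\<bar> + \<delta>\<close>, as \<open>v\<close> takes values in \<open>J\<close>. With \<open>\<delta> = 0\<close> this is uniqueness of
  the output.
\<close>

theorem solution_stability:
  assumes T: "T > 0" and L: "L \<ge> 0"
    and p: "classical_solution T p0 u0 g0 g1 a p u" and q: "classical_solution T p0 u0 g0 g1 b q v"
    and La: "\<And>y z. \<bar>a y - a z\<bar> \<le> L * \<bar>y - z\<bar>" and Lb: "\<And>y z. \<bar>b y - b z\<bar> \<le> L * \<bar>y - z\<bar>"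
    and v: "\<And>t x. t \<in> {0..T} \<Longrightarrow> x \<in> {0..1} \<Longrightarrow> v t x \<in> J"
    and \<delta>: "\<And>y. y \<in> J \<Longrightarrow> \<bar>a y - b y\<bar> \<le> \<delta>"
  shows "L2_norm {0<..<T} (\<lambda>t. (p t 0 - p t 1) - (q t 0 - q t 1)) \<le> sqrt (2 * trace_const T L) * \<bar>\<delta>\<bar>"
proof -
  let ?U = "{0<..<1::real}"
  have C: "\<And>t. t \<in> {0..T} \<Longrightarrow> continuous_on {0..1} (p t)" "\<And>t. t \<in> {0..T} \<Longrightarrow> continuous_on {0..1} (u t)"
    "\<And>t. t \<in> {0..T} \<Longrightarrow> continuous_on {0..1} (q t)" "\<And>t. t \<in> {0..T} \<Longrightarrow> continuous_on {0..1} (v t)"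
    and H: "C0_curve (H 1 ?U) (H_norm 1 ?U) {0..T} p" "C0_curve (H 1 ?U) (H_norm 1 ?U) {0..T} u"
     "C0_curve (H 1 ?U) (H_norm 1 ?U) {0..T} q" "C0_curve (H 1 ?U) (H_norm 1 ?U) {0..T} v"
    and bc: "\<And>t. t \<in> {0..T} \<Longrightarrow> u t 0 = g0 t \<and> u t 1 = g1 t" "\<And>t. t \<in> {0..T} \<Longrightarrow> v t 0 = g0 t \<and> v t 1 = g1 t"
    and ic: "\<And>x. x \<in> {0..1} \<Longrightarrow> p 0 x = p0 x \<and> u 0 x = u0 x" "\<And>x. x \<in> {0..1} \<Longrightarrow> q 0 x = p0 x \<and> v 0 x = u0 x"
    using p q unfolding classical_solution_def by blast+
  obtain p' u' where pu: "C1_curve (L2 ?U) (L2_norm ?U) {0..T} p p'" "C1_curve (L2 ?U) (L2_norm ?U) {0..T} u u'"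
    "\<And>t. t \<in> {0<..<T} \<Longrightarrow> AE x in lebesgue_on ?U.
      p' t x + weak_deriv 1 ?U (u t) x = 0 \<and> u' t x + weak_deriv 1 ?U (p t) x + a (u t x) = 0"
    using p unfolding classical_solution_def by blast
  obtain q' v' where qv: "C1_curve (L2 ?U) (L2_norm ?U) {0..T} q q'" "C1_curve (L2 ?U) (L2_norm ?U) {0..T} v v'"
    "\<And>t. t \<in> {0<..<T} \<Longrightarrow> AE x in lebesgue_on ?U.
      q' t x + weak_deriv 1 ?U (v t) x = 0 \<and> v' t x + weak_deriv 1 ?U (q t) x + b (v t x) = 0"
    using q unfolding classical_solution_def by blast
  have mem: "p t \<in> H 1 ?U" "u t \<in> H 1 ?U" "q t \<in> H 1 ?U" "v t \<in> H 1 ?U" if "t \<in> {0..T}" for t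
    using H that by (auto simp: C0_curve_def)
  have tr: "continuous_on {0..T} (\<lambda>t. p t x - q t x)" if "x \<in> {0..1}" for x
    by (intro continuous_on_diff trace_continuous[OF H(1) C(1) that] trace_continuous[OF H(3) C(3) that])
  have ca: "continuous_on S a" "continuous_on S b" for S
    by (rule continuous_if_Lipschitz[OF La] continuous_if_Lipschitz[OF Lb])+
  have est: "integral {0..T} (\<lambda>t. (p t 0 - q t 0)\<^sup>2 + (p t 1 - q t 1)\<^sup>2) \<le> trace_const T L * \<delta>\<^sup>2"
  proof (rule hidden_trace_regularity[where r = "\<lambda>t x. p t x - q t x" and w = "\<lambda>t x. u t x - v t x"
        and f = "\<lambda>t x. a (u t x) - b (v t x)" and rx = "\<lambda>t x. weak_deriv 1 ?U (p t) x - weak_deriv 1 ?U (q t) x"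
        and wx = "\<lambda>t x. weak_deriv 1 ?U (u t) x - weak_deriv 1 ?U (v t) x"])
    show "C1_curve (L2 ?U) (L2_norm ?U) {0..T} (\<lambda>t x. p t x - q t x) (\<lambda>t x. p' t x - q' t x)"
      by (rule C1_curve_L2_diff[OF pu(1) qv(1)])
    show "C1_curve (L2 ?U) (L2_norm ?U) {0..T} (\<lambda>t x. u t x - v t x) (\<lambda>t x. u' t x - v' t x)"
      by (rule C1_curve_L2_diff[OF pu(2) qv(2)])
    fix t assume t: "t \<in> {0..T}"
    show "AC_on 0 1 (\<lambda>x. p t x - q t x) (\<lambda>x. weak_deriv 1 ?U (p t) x - weak_deriv 1 ?U (q t) x)"
      "AC_on 0 1 (\<lambda>x. u t x - v t x) (\<lambda>x. weak_deriv 1 ?U (u t) x - weak_deriv 1 ?U (v t) x)"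
      using t by (intro AC_on_diff H1_AC_on mem C; assumption)+
    show "continuous_on {0..1} (\<lambda>x. a (u t x) - b (v t x))"
      by (intro continuous_on_diff continuous_on_compose2[OF ca(1) C(2)[OF t], of UNIV]
          continuous_on_compose2[OF ca(2) C(4)[OF t], of UNIV]) auto
    show "u t 0 - v t 0 = 0 \<and> u t 1 - v t 1 = 0" using bc[OF t] by simp
    fix x :: real assume x: "x \<in> {0..1}"
    show "\<bar>a (u t x) - b (v t x)\<bar> \<le> L * \<bar>u t x - v t x\<bar> + \<delta>"
      using La[of "u t x" "v t x"] \<delta>[OF v[OF t x]] by linarith
  next
    fix t assume t: "t \<in> {0<..<T}"
    show "AE x in lebesgue_on ?U.
      p' t x - q' t x = - (weak_deriv 1 ?U (u t) x - weak_deriv 1 ?U (v t) x) \<and>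
      u' t x - v' t x = - (weak_deriv 1 ?U (p t) x - weak_deriv 1 ?U (q t) x) - (a (u t x) - b (v t x))"
      using pu(3)[OF t] qv(3)[OF t] by eventually_elim linarith
  next
    fix x :: real assume "x \<in> {0..1}"
    then show "p 0 x - q 0 x = 0 \<and> u 0 x - v 0 x = 0" using ic[of x] by simp
  qed (use T L tr in auto)
  let ?h = "\<lambda>t. ((p t 0 - p t 1) - (q t 0 - q t 1))\<^sup>2"
  have ch: "continuous_on {0..T} (\<lambda>t. ((p t 0 - q t 0) - (p t 1 - q t 1))\<^sup>2)"
    "continuous_on {0..T} (\<lambda>t. 2 * ((p t 0 - q t 0)\<^sup>2 + (p t 1 - q t 1)\<^sup>2))"
    by (intro continuous_intros tr; simp)+
  have h: "?h = (\<lambda>t. ((p t 0 - q t 0) - (p t 1 - q t 1))\<^sup>2)" by (simp add: algebra_simps)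
  have "?h absolutely_integrable_on {0..T}"
    unfolding h by (rule absolutely_integrable_continuous_real[OF ch(1)])
  then have "(LINT t|lebesgue_on {0<..<T}. ?h t) = integral {0..T} ?h"
    by (rule LINT_Ioo(1))
  also have "\<dots> \<le> integral {0..T} (\<lambda>t. 2 * ((p t 0 - q t 0)\<^sup>2 + (p t 1 - q t 1)\<^sup>2))"
    unfolding h
  proof (intro integral_le integrable_continuous_interval ch)
    show "((p t 0 - q t 0) - (p t 1 - q t 1))\<^sup>2 \<le> 2 * ((p t 0 - q t 0)\<^sup>2 + (p t 1 - q t 1)\<^sup>2)" for t
    proof -
      have "(A - B)\<^sup>2 \<le> 2 * (A\<^sup>2 + B\<^sup>2)" for A B :: real
        using zero_le_power2[of "A + B"] by (simp add: power2_sum power2_diff)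
      then show ?thesis .
    qed
  qed
  also have "\<dots> \<le> 2 * (trace_const T L * \<delta>\<^sup>2)"
    using est unfolding Henstock_Kurzweil_Integration.integral_mult_right by simp
  finally have "L2_norm {0<..<T} (\<lambda>t. (p t 0 - p t 1) - (q t 0 - q t 1)) \<le> sqrt (2 * trace_const T L * \<delta>\<^sup>2)"
    unfolding L2_norm_def by (intro real_sqrt_le_mono) simp
  then show ?thesis by (simp add: real_sqrt_mult)
qed

lemma classical_solution_output_in_L2:
  assumes "classical_solution T p0 u0 g0 g1 a p u"
  shows "(\<lambda>t. p t 0 - p t 1) \<in> L2 {0<..<T}"
proof -
  have "C0_curve (H 1 {0<..<1}) (H_norm 1 {0<..<1}) {0..T} p"
    and c: "\<And>t. t \<in> {0..T} \<Longrightarrow> continuous_on {0..1} (p t)"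
    using assms unfolding classical_solution_def by blast+
  then have "continuous_on {0..T} (\<lambda>t. p t x)" if "x \<in> {0..1}" for x
    using that by (rule trace_continuous)
  then show ?thesis by (intro continuous_in_L2_Ioo continuous_on_diff) auto
qed

text \<open>
  The forward operator is a choice among the outputs of solutions; this exposes the solution behind the
  chosen output.
\<close>

lemma forward_solution:
  assumes a: "a \<in> DF a0 a1 a2 a3 ul uu"
    and wp: "\<And>b. A1 a0 a1 a2 a3 b \<Longrightarrow> \<exists>p u. classical_solution T p0 u0 g0 g1 b p u"
  obtains b p u where "restricts_A1 a0 a1 a2 a3 ul uu a b" "classical_solution T p0 u0 g0 g1 b p u"
    "forward a0 a1 a2 a3 ul uu T p0 u0 g0 g1 a = (\<lambda>t. p t 0 - p t 1)"
proof -
  obtain b where b: "restricts_A1 a0 a1 a2 a3 ul uu a b" using a by (auto simp: DF_def)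
  then obtain p u where "classical_solution T p0 u0 g0 g1 b p u"
    using wp[of b] unfolding restricts_A1_def by blast
  with b have "\<exists>y b p u. restricts_A1 a0 a1 a2 a3 ul uu a b \<and>
      classical_solution T p0 u0 g0 g1 b p u \<and> y = (\<lambda>t. p t 0 - p t 1)" by blast
  from someI_ex[OF this] show ?thesis
    unfolding forward_def[symmetric] using that by blast
qed

section \<open>Uniform convergence in the parameter set\<close>

text \<open>
  \<open>b\<close> is the integral of its weak derivative, which lies between \<open>0\<close> and \<open>a1\<close> almost everywhere.
\<close>

lemma A1_Lipschitz:
  assumes b: "A1 a0 a1 a2 a3 b" and a0: "a0 > 0"
  shows "\<bar>b y - b x\<bar> \<le> a1 * \<bar>y - x\<bar>"
proof -
  have le: "\<bar>b y - b x\<bar> \<le> a1 * (y - x)" if "x \<le> y" for x y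
  proof -
    let ?M = "lebesgue_on {x..y}" and ?g = "weak_deriv 1 UNIV b"
    have wd: "is_weak_deriv 1 UNIV b ?g"
      using b by (intro is_weak_deriv_weak_deriv[of b 3]) (auto simp: A1_def)
    have "AE s in ?M. a0 \<le> ?g s \<and> ?g s \<le> a1"
      using b by (simp add: A1_def AE_restrict_space_iff) (auto elim: eventually_mono)
    then have AE: "AE s in ?M. 0 \<le> ?g s" "AE s in ?M. ?g s \<le> a1"
      by (eventually_elim, use a0 in linarith)+
    have ig: "integrable ?M ?g" by (rule is_weak_deriv_integrable(2)[OF wd]) simp
    have "b y - b x = (LINT s|?M. ?g s)"
      by (rule weak_deriv_FTC[OF wd _ _ that])
        (use b in \<open>auto simp: A1_def intro: continuous_on_subset\<close>)
    moreover have "0 \<le> (LINT s|?M. ?g s)" by (rule integral_nonneg_AE[OF AE(1)])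
    moreover have "(LINT s|?M. ?g s) \<le> (LINT s|?M. a1)"
      by (rule integral_mono_AE[OF ig _ AE(2)]) simp
    moreover have "(LINT s|?M. a1) = a1 * (y - x)"
      using that by (simp add: measure_restrict_space)
    ultimately show ?thesis by linarith
  qed
  show ?thesis using le[of x y] le[of y x] by (cases "x \<le> y") (auto simp: abs_minus_commute)
qed

lemma DF_Lipschitz:
  assumes a: "a \<in> DF a0 a1 a2 a3 ul uu" and "a0 > 0" and "x \<in> {ul..uu}" "y \<in> {ul..uu}"
  shows "\<bar>a y - a x\<bar> \<le> a1 * \<bar>y - x\<bar>"
proof -
  obtain b where "A1 a0 a1 a2 a3 b" "\<And>y. y \<in> {ul..uu} \<Longrightarrow> a y = b y"
    using a by (auto simp: DF_def restricts_A1_def)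
  then show ?thesis using A1_Lipschitz[of a0 a1 a2 a3 b y x] assms by simp
qed

lemma DF_bounded:
  assumes a: "a \<in> DF a0 a1 a2 a3 ul uu" and "a0 > 0" "a1 > 0" and x: "x \<in> {ul..uu}"
  shows "\<bar>a x\<bar> \<le> a1 * (\<bar>ul\<bar> + \<bar>uu\<bar>)"
proof -
  obtain b where b: "A1 a0 a1 a2 a3 b" "\<And>y. y \<in> {ul..uu} \<Longrightarrow> a y = b y"
    using a by (auto simp: DF_def restricts_A1_def)
  have "b 0 = 0" using b(1) by (simp add: A1_def)
  then have "\<bar>a x\<bar> \<le> a1 * \<bar>x\<bar>"
    using A1_Lipschitz[OF b(1) \<open>a0 > 0\<close>, of x 0] b(2)[OF x] by simp
  also have "\<dots> \<le> a1 * (\<bar>ul\<bar> + \<bar>uu\<bar>)"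
    using x \<open>a1 > 0\<close> by (intro mult_left_mono) auto
  finally show ?thesis .
qed

lemma DF_sequentially_precompact:
  assumes a: "\<And>n. a n \<in> DF a0 a1 a2 a3 ul uu" and pos: "a0 > 0" "a1 > 0"
  obtains k :: "nat \<Rightarrow> nat" where "strict_mono k" "uniformly_Cauchy_on {ul..uu} (\<lambda>n. a (k n))"
proof -
  obtain g k where k: "strict_mono (k :: nat \<Rightarrow> nat)"
    and g: "\<And>e. 0 < e \<Longrightarrow> \<exists>N. \<forall>n x. n \<ge> N \<and> x \<in> {ul..uu} \<longrightarrow> norm (a (k n) x - g x) < e"
  proof (rule Arzela_Ascoli[of "{ul..uu}" a "a1 * (\<bar>ul\<bar> + \<bar>uu\<bar>)"])
    show "norm (a n x) \<le> a1 * (\<bar>ul\<bar> + \<bar>uu\<bar>)" if "x \<in> {ul..uu}" for n x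
      unfolding real_norm_def by (rule DF_bounded[OF a pos that])
    fix x e :: real assume x: "x \<in> {ul..uu}" and e: "0 < e"
    show "\<exists>d>0. \<forall>n y. y \<in> {ul..uu} \<and> norm (x - y) < d \<longrightarrow> norm (a n x - a n y) < e"
    proof (intro exI conjI allI impI)
      show "0 < e / a1" using e pos by simp
      fix n y assume y: "y \<in> {ul..uu} \<and> norm (x - y) < e / a1"
      have "\<bar>a n x - a n y\<bar> \<le> a1 * \<bar>x - y\<bar>"
        using y by (intro DF_Lipschitz[OF a pos(1) _ x]) simp
      also have "\<dots> < e" using y pos by (simp add: field_simps)
      finally show "norm (a n x - a n y) < e" by simp
    qed
  qed (auto intro: that)
  have "uniformly_Cauchy_on {ul..uu} (\<lambda>n. a (k n))"
    unfolding uniformly_Cauchy_on_def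
  proof (intro allI impI)
    fix e :: real assume "e > 0"
    then obtain N where N: "\<And>n x. n \<ge> N \<Longrightarrow> x \<in> {ul..uu} \<Longrightarrow> \<bar>a (k n) x - g x\<bar> < e / 2"
      using g[of "e / 2"] by auto
    show "\<exists>N. \<forall>y\<in>{ul..uu}. \<forall>i\<ge>N. \<forall>j\<ge>N. dist (a (k i) y) (a (k j) y) < e"
    proof (intro exI allI impI ballI)
      fix i j y assume "i \<ge> N" "j \<ge> N" "y \<in> {ul..uu}"
      then show "dist (a (k i) y) (a (k j) y) < e"
        using N[of i y] N[of j y] unfolding dist_real_def by linarith
    qed
  qed
  with k show ?thesis by (rule that)
qed

text \<open>
  Integrate \<open>d y = (d y - d z) + d z\<close> over \<open>z\<close>. The point \<open>y\<close> may lie outside \<open>[\<alpha>, \<beta>]\<close>: the interval must stay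
  inside an open set, whereas \<open>y\<close> may be a boundary point of that set.
\<close>

lemma Lipschitz_pointwise_by_mean:
  fixes d :: "real \<Rightarrow> real"
  assumes d: "integrable (lebesgue_on {\<alpha>..\<beta>}) d" and "\<alpha> \<le> \<beta>"
    and near: "\<And>z. z \<in> {\<alpha>..\<beta>} \<Longrightarrow> \<bar>d y - d z\<bar> \<le> e"
  shows "(\<beta> - \<alpha>) * \<bar>d y\<bar> \<le> (\<beta> - \<alpha>) * e + \<bar>LINT z|lebesgue_on {\<alpha>..\<beta>}. d z\<bar>"
proof -
  let ?M = "lebesgue_on {\<alpha>..\<beta>}"
  have const: "(LINT z|?M. c) = (\<beta> - \<alpha>) * c" for c :: real
    using \<open>\<alpha> \<le> \<beta>\<close> by (simp add: measure_restrict_space)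
  have ic: "integrable ?M (\<lambda>z. c)" for c :: real by simp
  have "\<bar>LINT z|?M. d y - d z\<bar> \<le> (LINT z|?M. \<bar>d y - d z\<bar>)" by (rule integral_abs_bound)
  also have "\<dots> \<le> (LINT z|?M. e)"
    by (rule integral_mono) (use d near in auto)
  finally have "\<bar>(\<beta> - \<alpha>) * d y - (LINT z|?M. d z)\<bar> \<le> (\<beta> - \<alpha>) * e"
    unfolding Bochner_Integration.integral_diff[OF ic d] const .
  moreover have "(\<beta> - \<alpha>) * \<bar>d y\<bar> = \<bar>(\<beta> - \<alpha>) * d y\<bar>" using \<open>\<alpha> \<le> \<beta>\<close> by (simp add: abs_mult)
  ultimately show ?thesis by linarith
qed

text \<open>
  Cut \<open>[ul, uu]\<close> into \<open>N\<close> pieces of length \<open>h\<close>. In the middle third of each piece the mean of \<open>a\<^sub>i - a\<^sub>j\<close>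
  becomes small, and by the Lipschitz bound it differs from the values of \<open>a\<^sub>i - a\<^sub>j\<close> on the whole piece by
  at most \<open>2 L h\<close>. The middle thirds are compact subsets of the open interval.
\<close>

lemma uniformly_Cauchy_if_integrals_converge:
  fixes a :: "nat \<Rightarrow> real \<Rightarrow> real"
  assumes J: "ul < uu" and L: "L > 0"
    and Lip: "\<And>n x y. x \<in> {ul..uu} \<Longrightarrow> y \<in> {ul..uu} \<Longrightarrow> \<bar>a n y - a n x\<bar> \<le> L * \<bar>y - x\<bar>"
    and int: "\<And>n \<alpha> \<beta>. {\<alpha>..\<beta>} \<subseteq> {ul<..<uu} \<Longrightarrow> integrable (lebesgue_on {\<alpha>..\<beta>}) (a n)"
    and conv: "\<And>\<alpha> \<beta>. {\<alpha>..\<beta>} \<subseteq> {ul<..<uu} \<Longrightarrow> convergent (\<lambda>n. LINT x|lebesgue_on {\<alpha>..\<beta>}. a n x)"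
  shows "uniformly_Cauchy_on {ul..uu} a"
  unfolding uniformly_Cauchy_on_def
proof (intro allI impI)
  fix e' :: real assume "e' > 0"
  define e where "e = e' / 2"
  have e: "e > 0" "e < e'" using \<open>e' > 0\<close> by (simp_all add: e_def)
  obtain N :: nat where N: "N > 0" "4 * L * (uu - ul) / e < real N"
    using reals_Archimedean2[of "max 1 (4 * L * (uu - ul) / e)"] by (metis less_trans max_less_iff_conj of_nat_0_less_iff zero_less_one)
  define h where "h = (uu - ul) / real N"
  have h: "h > 0" "2 * L * h \<le> e / 2"
    using J N L e(1) by (auto simp: h_def field_simps)
  have hN: "ul + real N * h = uu" using N by (simp add: h_def)
  define \<alpha> \<beta> where "\<alpha> m = ul + real m * h + h / 3" and "\<beta> m = ul + real m * h + 2 * h / 3" for m :: nat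
  have len: "\<beta> m - \<alpha> m = h / 3" for m by (simp add: \<alpha>_def \<beta>_def)
  have in_J: "ul + real m * h \<ge> ul" "ul + real m * h + h \<le> uu" if "m < N" for m
  proof -
    show "ul + real m * h \<ge> ul" using h by simp
    have "(real m + 1) * h \<le> real N * h" using that h by (intro mult_right_mono) auto
    then show "ul + real m * h + h \<le> uu" using hN by (simp add: distrib_right)
  qed
  have sub: "{\<alpha> m..\<beta> m} \<subseteq> {ul<..<uu}" if "m < N" for m
  proof
    fix x assume "x \<in> {\<alpha> m..\<beta> m}"
    then have "ul + real m * h + h / 3 \<le> x" "x \<le> ul + real m * h + 2 * h / 3"
      by (auto simp: \<alpha>_def \<beta>_def)
    then have "ul < x" "x < uu" using in_J[OF that] h(1) by linarith+
    then show "x \<in> {ul<..<uu}" by simp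
  qed
  let ?I = "\<lambda>m n. LINT x|lebesgue_on {\<alpha> m..\<beta> m}. a n x"
  have "\<forall>m<N. \<exists>l. \<forall>\<^sub>F n in sequentially. \<bar>?I m n - l\<bar> < h * e / 12"
  proof (intro allI impI)
    fix m assume "m < N"
    then obtain l where "?I m \<longlonglongrightarrow> l" using conv[OF sub] unfolding convergent_def by blast
    then have "\<forall>\<^sub>F n in sequentially. dist (?I m n) l < h * e / 12"
      using h e(1) by (intro tendstoD) auto
    then show "\<exists>l. \<forall>\<^sub>F n in sequentially. \<bar>?I m n - l\<bar> < h * e / 12"
      by (auto simp: dist_real_def)
  qed
  then obtain l where "\<forall>m<N. \<forall>\<^sub>F n in sequentially. \<bar>?I m n - l m\<bar> < h * e / 12" by metis
  then have "\<forall>\<^sub>F n in sequentially. \<forall>m\<in>{..<N}. \<bar>?I m n - l m\<bar> < h * e / 12"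
    by (intro eventually_ball_finite) auto
  then obtain K where K: "\<And>n m. n \<ge> K \<Longrightarrow> m < N \<Longrightarrow> \<bar>?I m n - l m\<bar> < h * e / 12"
    unfolding eventually_sequentially by auto
  show "\<exists>K. \<forall>y\<in>{ul..uu}. \<forall>i\<ge>K. \<forall>j\<ge>K. dist (a i y) (a j y) < e'"
  proof (intro exI allI impI ballI)
    fix i j y assume ij: "i \<ge> K" "j \<ge> K" and y: "y \<in> {ul..uu}"
    obtain m where m: "m < N" "ul + real m * h \<le> y" "y \<le> ul + real m * h + h"
    proof (cases "y = uu")
      case True
      show ?thesis
        by (rule that[of "N - 1"]) (use True N h hN in \<open>auto simp: of_nat_diff algebra_simps\<close>)
    next
      case False
      define m where "m = nat \<lfloor>(y - ul) / h\<rfloor>"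
      have q: "(y - ul) / h \<ge> 0" "(y - ul) / h < real N"
        using y False h hN by (auto simp: pos_divide_less_eq)
      then have "real m \<le> (y - ul) / h" "(y - ul) / h < real m + 1" by (auto simp: m_def)
      then have *: "real m * h \<le> y - ul" "y - ul < (real m + 1) * h"
        using h by (auto simp: pos_le_divide_eq pos_divide_less_eq)
      have "m < N" using \<open>real m \<le> (y - ul) / h\<close> q(2) by linarith
      then show ?thesis using * by (intro that[of m]) (auto simp: distrib_right)
    qed
    define d where "d = (\<lambda>z. a i z - a j z)"
    have I: "{\<alpha> m..\<beta> m} \<subseteq> {ul<..<uu}" by (rule sub[OF m(1)])
    have "(\<beta> m - \<alpha> m) * \<bar>d y\<bar> \<le> (\<beta> m - \<alpha> m) * (e / 2) + \<bar>LINT z|lebesgue_on {\<alpha> m..\<beta> m}. d z\<bar>"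
    proof (rule Lipschitz_pointwise_by_mean)
      show "integrable (lebesgue_on {\<alpha> m..\<beta> m}) d"
        unfolding d_def by (intro Bochner_Integration.integrable_diff int I)
      show "\<alpha> m \<le> \<beta> m" using len[of m] h by linarith
      fix z assume z: "z \<in> {\<alpha> m..\<beta> m}"
      then have zJ: "z \<in> {ul..uu}" using I by auto
      have "\<bar>y - z\<bar> \<le> h" using z m(2,3) h unfolding \<alpha>_def \<beta>_def by auto
      then have "L * \<bar>y - z\<bar> \<le> L * h" using L by (intro mult_left_mono) auto
      then show "\<bar>d y - d z\<bar> \<le> e / 2"
        using Lip[OF zJ y, of i] Lip[OF zJ y, of j] h(2) unfolding d_def by linarith
    qed
    moreover have "(LINT z|lebesgue_on {\<alpha> m..\<beta> m}. d z) = ?I m i - ?I m j"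
      unfolding d_def by (intro Bochner_Integration.integral_diff int I)
    moreover have "\<bar>?I m i - ?I m j\<bar> \<le> h * e / 6"
      using K[OF ij(1) m(1)] K[OF ij(2) m(1)] by linarith
    ultimately have "h / 3 * \<bar>d y\<bar> \<le> h / 3 * (e / 2) + h * e / 6"
      unfolding len by linarith
    also have "\<dots> = h / 3 * e" by (simp add: field_simps)
    finally have "\<bar>d y\<bar> \<le> e" using h by simp
    then show "dist (a i y) (a j y) < e'" using e(2) by (simp add: d_def dist_real_def)
  qed
qed

lemma DF_uniformly_Cauchy_if_integrals_converge:
  assumes J: "ul < uu" and pos: "a0 > 0" "a1 > 0"
    and a: "\<And>n. a n \<in> DF a0 a1 a2 a3 ul uu" and w: "\<And>\<alpha> \<beta>. {\<alpha>..\<beta>} \<subseteq> {ul<..<uu} \<Longrightarrow>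
      convergent (\<lambda>n. LINT x|lebesgue_on {\<alpha>..\<beta>}. a n x)"
  shows "uniformly_Cauchy_on {ul..uu} a"
proof (rule uniformly_Cauchy_if_integrals_converge[OF J pos(2)])
  show "\<bar>a n y - a n x\<bar> \<le> a1 * \<bar>y - x\<bar>" if "x \<in> {ul..uu}" "y \<in> {ul..uu}" for n x y
    by (rule DF_Lipschitz[OF a pos(1) that])
  show "integrable (lebesgue_on {\<alpha>..\<beta>}) (a n)" if "{\<alpha>..\<beta>} \<subseteq> {ul<..<uu}" for n \<alpha> \<beta>
  proof -
    have "a n \<in> H 2 {ul<..<uu}" using a by (simp add: DF_def)
    from H_imp_locally_integrable[OF this] show ?thesis using that by (simp add: locally_integrable_def)
  qed
qed (rule w)

text \<open>
  The supply of functionals on \<open>H\<^sup>k\<close> that weak convergence is tested with.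
\<close>

lemma interval_integral_in_H_dual:
  assumes I: "{\<alpha>..\<beta>} \<subseteq> S" and S: "open S" "S \<in> lmeasurable"
  shows "(\<lambda>f. LINT x|lebesgue_on {\<alpha>..\<beta>}. f x) \<in> H_dual k S"
  unfolding H_dual_def
proof (intro CollectI conjI ballI allI)
  have int: "integrable (lebesgue_on {\<alpha>..\<beta>}) f" if "f \<in> H k S" for f
    using H_imp_locally_integrable[OF that] I by (simp add: locally_integrable_def)
  show "(LINT x|lebesgue_on {\<alpha>..\<beta>}. f x + g x)
      = (LINT x|lebesgue_on {\<alpha>..\<beta>}. f x) + (LINT x|lebesgue_on {\<alpha>..\<beta>}. g x)"
    if "f \<in> H k S" "g \<in> H k S" for f g
    by (rule Bochner_Integration.integral_add[OF int[OF that(1)] int[OF that(2)]])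
  show "(LINT x|lebesgue_on {\<alpha>..\<beta>}. r * f x) = r * (LINT x|lebesgue_on {\<alpha>..\<beta>}. f x)"
    if "f \<in> H k S" for r f by simp
  have S': "S \<in> sets lebesgue" using S(1) by auto
  interpret finite_measure "lebesgue_on S" by (rule finite_measure_lebesgue_on[OF S(2)])
  have one: "(\<lambda>_. 1) \<in> L2 S" by (simp add: L2_def)
  have chi: "indicator {\<alpha>..\<beta>} \<in> L2 S"
  proof -
    have "(\<lambda>x. indicator {\<alpha>..\<beta>} x * 1) \<in> L2 S"
    proof (rule L2_bounded_mult(1)[OF _ _ one])
      show "(indicator {\<alpha>..\<beta>} :: real \<Rightarrow> real) \<in> borel_measurable (lebesgue_on S)"
        by (rule measurable_restrict_space1, rule borel_measurable_indicator) auto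
    qed (simp add: indicator_def)
    then show ?thesis by simp
  qed
  show "\<exists>C. \<forall>f\<in>H k S. \<bar>LINT x|lebesgue_on {\<alpha>..\<beta>}. f x\<bar> \<le> C * H_norm k S f"
  proof (intro exI ballI)
    fix f assume f: "f \<in> H k S"
    let ?g = "weak_deriv 0 S f"
    have g: "?g \<in> L2 S" by (rule weak_deriv_in_L2[OF f le0 S(1)])
    have "(LINT x|lebesgue_on {\<alpha>..\<beta>}. f x) = (LINT x|lebesgue_on {\<alpha>..\<beta>}. ?g x)"
      by (rule weak_deriv_integral_unique[OF is_weak_deriv_0_self[OF H_imp_locally_integrable[OF f]]
            is_weak_deriv_weak_deriv[OF f le0] S' I])
    also have "\<dots> = (LINT x|lebesgue_on {\<alpha>..\<beta>}. indicator {\<alpha>..\<beta>} x * ?g x)"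
      by (rule Bochner_Integration.integral_cong) auto
    also have "\<dots> = (LINT x|lebesgue_on S. indicator {\<alpha>..\<beta>} x * ?g x)"
      by (rule LINT_restrict_support[symmetric]) (use S' I in auto)
    finally have "\<bar>LINT x|lebesgue_on {\<alpha>..\<beta>}. f x\<bar> \<le> L2_norm S (indicator {\<alpha>..\<beta>}) * L2_norm S ?g"
      using L2_Cauchy_Schwarz[OF chi g] by simp
    also have "\<dots> \<le> L2_norm S (indicator {\<alpha>..\<beta>}) * H_norm k S f"
      by (intro mult_left_mono L2_norm_weak_deriv_le_H_norm) auto
    finally show "\<bar>LINT x|lebesgue_on {\<alpha>..\<beta>}. f x\<bar> \<le> L2_norm S (indicator {\<alpha>..\<beta>}) * H_norm k S f" .
  qed
qed

section \<open>Weak-to-strong continuity and compactness of the forward operator\<close>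

theorem theorem4p2:
  fixes T a0 a1 a2 a3 c ul uu :: real
    and p0 u0 g0 g1 :: "real \<Rightarrow> real"
  assumes "T > 0" "a0 > 0" "a1 > 0" "a2 > 0" "a3 > 0"
    and A2: "\<And>x. u0 x = 0" "\<And>x. p0 x = c"
    and A3: "A3 T g0" "A3 T g1"
    and well_posed: "\<And>a. A1 a0 a1 a2 a3 a \<Longrightarrow> \<exists>p u. classical_solution T p0 u0 g0 g1 a p u"
    and "ul < uu"
    and bounds: "\<And>a p u x t. A1 a0 a1 a2 a3 a \<Longrightarrow> classical_solution T p0 u0 g0 g1 a p u \<Longrightarrow>
      x \<in> {0..1} \<Longrightarrow> t \<in> {0..T} \<Longrightarrow> ul \<le> u t x \<and> u t x \<le> uu"
  shows "let D = DF a0 a1 a2 a3 ul uu; F = forward a0 a1 a2 a3 ul uu T p0 u0 g0 g1 in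
    F \<in> D \<rightarrow> L2 {0<..<T} \<and>
    (\<forall>a a_lim. (\<forall>n. a n \<in> D) \<and> H_weakly_converges 2 {ul<..<uu} a a_lim \<longrightarrow>
      (\<exists>y. limitin (L2_topology {0<..<T}) (\<lambda>n. L2_class {0<..<T} (F (a n))) y sequentially \<and>
           (a_lim \<in> D \<longrightarrow> y = L2_class {0<..<T} (F a_lim)))) \<and>
    (\<forall>B. B \<subseteq> D \<and> H_bounded 2 {ul<..<uu} B \<longrightarrow>
      compactin (L2_topology {0<..<T})
        (L2_topology {0<..<T} closure_of (L2_class {0<..<T} ` F ` B)))"
proof -
  define D where "D = DF a0 a1 a2 a3 ul uu"
  define F where "F = forward a0 a1 a2 a3 ul uu T p0 u0 g0 g1"
  let ?S = "{0<..<T}"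
  interpret L2: Metric_space "L2_space ?S" "L2_dist ?S" by (rule Metric_space_L2)
  have top: "L2_topology ?S = L2.mtopology" by (simp add: L2_topology_def)
  have complete: "L2.mcomplete" by (rule mcomplete_L2) simp
  have sol: "\<exists>b p u. restricts_A1 a0 a1 a2 a3 ul uu a b \<and> classical_solution T p0 u0 g0 g1 b p u
      \<and> F a = (\<lambda>t. p t 0 - p t 1)" if "a \<in> D" for a
    using forward_solution[OF that[unfolded D_def] well_posed] unfolding F_def by blast
  have F_L2: "F a \<in> L2 ?S" if "a \<in> D" for a
    using sol[OF that] classical_solution_output_in_L2 by metis
  \<comment> \<open>The summand \<open>1\<close> makes the Lipschitz constant positive, so that one can divide by it.\<close>
  define C where "C = sqrt (2 * trace_const T a1) + 1"
  have "trace_const T a1 \<ge> 0"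
    using \<open>T > 0\<close> \<open>a1 > 0\<close> unfolding trace_const_def by (intro mult_nonneg_nonneg add_nonneg_nonneg) auto
  then have C: "C > 0" "sqrt (2 * trace_const T a1) \<le> C" by (auto simp: C_def intro: add_nonneg_pos)
  have stable: "L2_dist ?S (L2_class ?S (F a)) (L2_class ?S (F a')) \<le> C * e"
    if a: "a \<in> D" "a' \<in> D" and e: "e \<ge> 0" "\<And>y. y \<in> {ul..uu} \<Longrightarrow> \<bar>a y - a' y\<bar> \<le> e" for a a' e
  proof -
    obtain b p u where b: "restricts_A1 a0 a1 a2 a3 ul uu a b" "classical_solution T p0 u0 g0 g1 b p u"
      "F a = (\<lambda>t. p t 0 - p t 1)" using sol[OF a(1)] by blast
    obtain b' q v where b': "restricts_A1 a0 a1 a2 a3 ul uu a' b'" "classical_solution T p0 u0 g0 g1 b' q v"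
      "F a' = (\<lambda>t. q t 0 - q t 1)" using sol[OF a(2)] by blast
    have A: "A1 a0 a1 a2 a3 b" "A1 a0 a1 a2 a3 b'"
      and r: "\<And>y. y \<in> {ul..uu} \<Longrightarrow> a y = b y" "\<And>y. y \<in> {ul..uu} \<Longrightarrow> a' y = b' y"
      using b(1) b'(1) by (auto simp: restricts_A1_def)
    have "L2_norm ?S (\<lambda>t. (p t 0 - p t 1) - (q t 0 - q t 1)) \<le> sqrt (2 * trace_const T a1) * \<bar>e\<bar>"
    proof (rule solution_stability[OF \<open>T > 0\<close> _ b(2) b'(2), where J = "{ul..uu}"])
      show "a1 \<ge> 0" using \<open>a1 > 0\<close> by simp
      show "\<bar>b y - b z\<bar> \<le> a1 * \<bar>y - z\<bar>" "\<bar>b' y - b' z\<bar> \<le> a1 * \<bar>y - z\<bar>" for y z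
        using A1_Lipschitz[OF A(1) \<open>a0 > 0\<close>] A1_Lipschitz[OF A(2) \<open>a0 > 0\<close>] by auto
      show "v t x \<in> {ul..uu}" if "t \<in> {0..T}" "x \<in> {0..1}" for t x
        using bounds[OF A(2) b'(2) that(2,1)] by simp
      show "\<bar>b y - b' y\<bar> \<le> e" if "y \<in> {ul..uu}" for y
        using e(2)[OF that] r(1)[OF that] r(2)[OF that] by simp
    qed
    also have "\<dots> \<le> C * e" using C(2) e(1) by (simp add: mult_right_mono)
    finally show ?thesis
      using L2_dist_class[OF F_L2[OF a(1)] F_L2[OF a(2)]] unfolding b(3) b'(3) by simp
  qed
  have Cauchy: "L2.MCauchy (\<lambda>n. L2_class ?S (F (a n)))"
    if a: "\<And>n. a n \<in> D" and u: "uniformly_Cauchy_on {ul..uu} a" for a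
    unfolding L2.MCauchy_def
  proof (intro conjI allI impI)
    show "range (\<lambda>n. L2_class ?S (F (a n))) \<subseteq> L2_space ?S"
      using L2_class_in_space[OF F_L2[OF a]] by blast
    fix e :: real assume e: "e > 0"
    then have "e / (2 * C) > 0" using C by simp
    then obtain N where N: "\<And>i j y. i \<ge> N \<Longrightarrow> j \<ge> N \<Longrightarrow> y \<in> {ul..uu} \<Longrightarrow> \<bar>a i y - a j y\<bar> \<le> e / (2 * C)"
      using u unfolding uniformly_Cauchy_on_def dist_real_def by (metis less_imp_le)
    show "\<exists>N. \<forall>n n'. N \<le> n \<longrightarrow> N \<le> n' \<longrightarrow> L2_dist ?S (L2_class ?S (F (a n))) (L2_class ?S (F (a n'))) < e"
    proof (intro exI allI impI)
      fix n n' assume "N \<le> n" "N \<le> n'"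
      then have "L2_dist ?S (L2_class ?S (F (a n))) (L2_class ?S (F (a n'))) \<le> C * (e / (2 * C))"
        using N e C by (intro stable a) auto
      also have "\<dots> < e" using e C by simp
      finally show "L2_dist ?S (L2_class ?S (F (a n))) (L2_class ?S (F (a n'))) < e" .
    qed
  qed
  have weak: "\<exists>y. limitin L2.mtopology (\<lambda>n. L2_class ?S (F (a n))) y sequentially \<and>
      (a_lim \<in> D \<longrightarrow> y = L2_class ?S (F a_lim))"
    if a: "\<And>n. a n \<in> D" and w: "H_weakly_converges 2 {ul<..<uu} a a_lim" for a a_lim
  proof -
    let ?l = "\<lambda>\<alpha> \<beta> f. LINT x|lebesgue_on {\<alpha>..\<beta>}. (f x :: real)"
    have lim: "(\<lambda>n. ?l \<alpha> \<beta> (a n)) \<longlonglongrightarrow> ?l \<alpha> \<beta> a_lim" if "{\<alpha>..\<beta>} \<subseteq> {ul<..<uu}" for \<alpha> \<beta>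
      using w interval_integral_in_H_dual[OF that, of 2] unfolding H_weakly_converges_def by simp
    note uC = DF_uniformly_Cauchy_if_integrals_converge[where ?a2.0 = a2 and ?a3.0 = a3,
        OF \<open>ul < uu\<close> \<open>a0 > 0\<close> \<open>a1 > 0\<close>, folded D_def]
    show ?thesis
    proof (cases "a_lim \<in> D")
      case False
      have "uniformly_Cauchy_on {ul..uu} a"
        by (rule uC[OF a]) (rule convergentI[OF lim])
      from Cauchy[OF a this] show ?thesis
        using complete False unfolding L2.mcomplete_def by blast
    next
      case True
      \<comment> \<open>Interleaving the sequence with its limit reduces the identification of the limit to the Cauchy
          property: the odd members are \<open>a_lim\<close>.\<close>
      define c where "c n = (if even n then a (n div 2) else a_lim)" for n
      have c: "c n \<in> D" for n using a True by (simp add: c_def)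
      have "uniformly_Cauchy_on {ul..uu} c"
      proof (rule uC[OF c])
        fix \<alpha> \<beta> assume I: "{\<alpha>..\<beta>} \<subseteq> {ul<..<uu}"
        have half: "(\<lambda>n. ?l \<alpha> \<beta> (a (n div 2))) \<longlonglongrightarrow> ?l \<alpha> \<beta> a_lim"
          by (rule filterlim_compose[OF lim[OF I]]) (simp add: filterlim_at_top_div_const_nat)
        have "(\<lambda>n. if even n then ?l \<alpha> \<beta> (a (n div 2)) else ?l \<alpha> \<beta> a_lim) \<longlonglongrightarrow> ?l \<alpha> \<beta> a_lim"
          by (rule filterlim_If; rule tendsto_mono[OF inf_le1]) (rule half, rule tendsto_const)
        moreover have "(\<lambda>n. ?l \<alpha> \<beta> (c n))
            = (\<lambda>n. if even n then ?l \<alpha> \<beta> (a (n div 2)) else ?l \<alpha> \<beta> a_lim)"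
          by (rule ext) (simp add: c_def)
        ultimately show "convergent (\<lambda>n. ?l \<alpha> \<beta> (c n))"
          by (simp only: convergentI)
      qed
      from Cauchy[OF c this] have M: "L2.MCauchy (\<lambda>n. L2_class ?S (F (c n)))" .
      have "limitin L2.mtopology (\<lambda>n. L2_class ?S (F (a n))) (L2_class ?S (F a_lim)) sequentially"
        unfolding L2.limit_metric_sequentially
      proof (intro conjI allI impI)
        show "L2_class ?S (F a_lim) \<in> L2_space ?S" by (rule L2_class_in_space[OF F_L2[OF True]])
        fix e :: real assume "e > 0"
        then obtain N where N: "\<And>i j. i \<ge> N \<Longrightarrow> j \<ge> N \<Longrightarrow>
            L2_dist ?S (L2_class ?S (F (c i))) (L2_class ?S (F (c j))) < e"
          using M unfolding L2.MCauchy_def by metis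
        have "L2_dist ?S (L2_class ?S (F (a n))) (L2_class ?S (F a_lim)) < e" if "n \<ge> N" for n
          using N[of "2 * n" "2 * n + 1"] that by (simp add: c_def)
        then show "\<exists>N. \<forall>n\<ge>N. L2_class ?S (F (a n)) \<in> L2_space ?S \<and>
            L2_dist ?S (L2_class ?S (F (a n))) (L2_class ?S (F a_lim)) < e"
          using L2_class_in_space[OF F_L2[OF a]] by blast
      qed
      then show ?thesis by blast
    qed
  qed
  have compact: "compactin L2.mtopology (L2.mtopology closure_of (L2_class ?S ` F ` B))" if B: "B \<subseteq> D" for B
  proof -
    have "L2.mtotally_bounded (L2_class ?S ` F ` B)"
      unfolding L2.mtotally_bounded_sequentially
    proof (intro conjI allI impI)
      show "L2_class ?S ` F ` B \<subseteq> L2_space ?S"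
        using B by (auto intro!: L2_class_in_space F_L2)
      fix \<sigma> :: "nat \<Rightarrow> (real \<Rightarrow> real) set" assume "range \<sigma> \<subseteq> L2_class ?S ` F ` B"
      then have "\<forall>n. \<exists>a. a \<in> D \<and> \<sigma> n = L2_class ?S (F a)" using B by blast
      then obtain a where a: "\<And>n. a n \<in> D" "\<And>n. \<sigma> n = L2_class ?S (F (a n))" by metis
      obtain k :: "nat \<Rightarrow> nat" where k: "strict_mono k" "uniformly_Cauchy_on {ul..uu} (\<lambda>n. a (k n))"
        by (rule DF_sequentially_precompact[OF a(1)[unfolded D_def] \<open>a0 > 0\<close> \<open>a1 > 0\<close>])
      have "L2.MCauchy (\<sigma> \<circ> k)"
        using Cauchy[OF a(1) k(2)] by (simp add: a(2) o_def)
      with k(1) show "\<exists>r. strict_mono r \<and> L2.MCauchy (\<sigma> \<circ> r)" by blast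
    qed
    then show ?thesis
      unfolding L2.mtotally_bounded_eq_compact_closure_of[OF complete] by (rule conjunct2)
  qed
  show ?thesis
    unfolding Let_def top D_def[symmetric] F_def[symmetric]
  proof (intro conjI allI impI)
    show "F \<in> D \<rightarrow> L2 ?S" using F_L2 by (rule Pi_I)
    show "\<exists>y. limitin L2.mtopology (\<lambda>n. L2_class ?S (F (a n))) y sequentially \<and>
        (a_lim \<in> D \<longrightarrow> y = L2_class ?S (F a_lim))"
      if "(\<forall>n. a n \<in> D) \<and> H_weakly_converges 2 {ul<..<uu} a a_lim" for a a_lim
      using that by (intro weak) auto
    show "compactin L2.mtopology (L2.mtopology closure_of (L2_class ?S ` F ` B))"
      if "B \<subseteq> D \<and> H_bounded 2 {ul<..<uu} B" for B
      using that by (intro compact) auto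
  qed
qed

end
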